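(* Let $\mathcal{C}$ be a directed category with respect to a partial order $\leqslant$ on $\operatorname{Ob}\mathcal{C}$. Then $\mathcal{C}$ is standardly stratified for the canonical pre-order $\preccurlyeq$ if and only if the morphism space $\mathcal{C}(x,y)$ is a projective $\mathcal{C}(y,y)$-module for every pair of objects $x,y\in\operatorname{Ob}\mathcal{C}$.
   Context: $k$ is an algebraically closed field. All categories are $k$-linear, skeletal (isomorphic objects are equal), have finitely many objects, and are locally finite: each $\mathcal{C}(x,y)$ is a finite-dimensional $k$-vector space. $\mathcal{C}$ is a directed category with respect to a partial order $\leqslant$ on $\operatorname{Ob}\mathcal{C}$ if $\mathcal{C}(x,y)\neq 0$ only if $x\leqslant y$. $\mathcal{C}$ is identified with its associated finite-dimensional algebra $\bigoplus_{x,y}\mathcal{C}(x,y)$ (product $\beta\cdot\alpha=\beta\circ\alpha$ when composable, $0$ otherwise). $\mathcal{C}$-modules are left modules over this algebra, i.e. $k$-linear functors from $\mathcal{C}$ to finite-dimensional vector spaces. $\mathcal{C}(x,y)$ is a left $\mathcal{C}(y,y)$-module by post-composition. The zero module is regarded as projective. For each object $x$ choose a complete set $E_x=\{e_\lambda\}_{\lambda\in\Lambda_x}$ of orthogonal primitive idempotents of $\mathcal{C}(x,x)$, so $\sum_{\lambda\in\Lambda_x}e_\lambda=1_x$; put $\Lambda=\bigsqcup_x\Lambda_x$. The canonical pre-order $\preccurlyeq$ on $\Lambda$ is: for $\lambda\in\Lambda_x$, $\mu\in\Lambda_y$, $\lambda\preccurlyeq\mu$ if and only if $x\leqslant y$.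 Put $P_\lambda=\mathcal{C}e_\lambda$ and define the standard module $\Delta_\lambda=P_\lambda/\sum_{\mu\not\preccurlyeq\lambda}\operatorname{tr}_{P_\mu}(P_\lambda)$, where $\operatorname{tr}_{P_\mu}(P_\lambda)$ is the trace, i.e. the sum of the images of all homomorphisms $P_\mu\to P_\lambda$. $\mathcal{C}$ is standardly stratified (for $\preccurlyeq$) if every $P_\lambda$ has a finite filtration by submodules whose successive quotients are isomorphic to standard modules. *)

theory Defs
  imports "HOL-Algebra.Algebraic_Closure" "HOL-Algebra.AbelCoset" "HOL-Algebra.Module"
begin

section \<open>Left modules over a not necessarily commutative ring\<close>

text \<open>The library locale \<open>module\<close> requires a commutative ring of scalars. The record
  type \<open>module\<close> and the locale \<open>submodule\<close> are reused; the record fields \<open>mult\<close> and \<open>one\<close>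
  of a module carry no meaning.\<close>

locale left_module = R?: ring R + M?: abelian_group M
  for R :: "('a, 'r) ring_scheme" (structure) and M :: "('a, 'm, 'n) module_scheme" (structure) +
  assumes smult_closed [simp, intro]:
      "\<lbrakk>a \<in> carrier R; x \<in> carrier M\<rbrakk> \<Longrightarrow> a \<odot>\<^bsub>M\<^esub> x \<in> carrier M"
    and smult_l_distr:
      "\<lbrakk>a \<in> carrier R; b \<in> carrier R; x \<in> carrier M\<rbrakk> \<Longrightarrow>
        (a \<oplus>\<^bsub>R\<^esub> b) \<odot>\<^bsub>M\<^esub> x = a \<odot>\<^bsub>M\<^esub> x \<oplus>\<^bsub>M\<^esub> b \<odot>\<^bsub>M\<^esub> x"
    and smult_r_distr:
      "\<lbrakk>a \<in> carrier R; x \<in> carrier M; y \<in> carrier M\<rbrakk> \<Longrightarrow>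
        a \<odot>\<^bsub>M\<^esub> (x \<oplus>\<^bsub>M\<^esub> y) = a \<odot>\<^bsub>M\<^esub> x \<oplus>\<^bsub>M\<^esub> a \<odot>\<^bsub>M\<^esub> y"
    and smult_assoc:
      "\<lbrakk>a \<in> carrier R; b \<in> carrier R; x \<in> carrier M\<rbrakk> \<Longrightarrow>
        (a \<otimes>\<^bsub>R\<^esub> b) \<odot>\<^bsub>M\<^esub> x = a \<odot>\<^bsub>M\<^esub> (b \<odot>\<^bsub>M\<^esub> x)"
    and smult_one [simp]:
      "x \<in> carrier M \<Longrightarrow> \<one>\<^bsub>R\<^esub> \<odot>\<^bsub>M\<^esub> x = x"

definition left_module_hom ::
    "('a, 'r) ring_scheme \<Rightarrow> ('a, 'm) module \<Rightarrow> ('a, 'n) module \<Rightarrow> ('m \<Rightarrow> 'n) set" where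
  "left_module_hom R M N = {h. h \<in> carrier M \<rightarrow> carrier N
     \<and> (\<forall>x\<in>carrier M. \<forall>y\<in>carrier M. h (x \<oplus>\<^bsub>M\<^esub> y) = h x \<oplus>\<^bsub>N\<^esub> h y)
     \<and> (\<forall>r\<in>carrier R. \<forall>x\<in>carrier M. h (r \<odot>\<^bsub>M\<^esub> x) = r \<odot>\<^bsub>N\<^esub> h x)}"

definition left_module_iso ::
    "('a, 'r) ring_scheme \<Rightarrow> ('a, 'm) module \<Rightarrow> ('a, 'n) module \<Rightarrow> bool" where
  "left_module_iso R M N \<longleftrightarrow> (\<exists>h \<in> left_module_hom R M N. bij_betw h (carrier M) (carrier N))"

text \<open>The scalar \<open>r\<close> sends the coset \<open>N + m\<close> to \<open>N + r m\<close>.\<close>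

definition quotient_module :: "('a, 'm) module \<Rightarrow> 'm set \<Rightarrow> ('a, 'm set) module" where
  "quotient_module M N =
     \<lparr>carrier = a_rcosets\<^bsub>M\<^esub> N, monoid.mult = undefined, one = undefined, zero = N, add = set_add M,
      smult = (\<lambda>r S. \<Union>m\<in>S. N +>\<^bsub>M\<^esub> (r \<odot>\<^bsub>M\<^esub> m))\<rparr>"

definition generated_submodule ::
    "('a, 'r) ring_scheme \<Rightarrow> ('a, 'm) module \<Rightarrow> 'm set \<Rightarrow> 'm set" where
  "generated_submodule R M S = \<Inter>{N. submodule N R M \<and> S \<subseteq> N}"

text \<open>The sum of a family of submodules is the submodule generated by their union.\<close>

definition trace_submodule ::
    "('a, 'r) ring_scheme \<Rightarrow> ('a, 'm) module \<Rightarrow> ('a, 'n) module \<Rightarrow> 'n set" where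
  "trace_submodule R M N =
     generated_submodule R N (\<Union>h\<in>left_module_hom R M N. h ` carrier M)"

text \<open>Projectivity is the lifting property against epimorphisms. A definition cannot quantify over
  types, so the epimorphisms range over modules with carriers in fixed types, which are chosen large
  enough to contain the canonical epimorphism onto \<open>M\<close> from the free module on \<open>carrier M\<close>. The
  lemma \<open>projective_module_lift\<close> below shows that lifting then holds for modules of all types.\<close>

definition projective_module :: "('a, 'r) ring_scheme \<Rightarrow> ('a, 'm) module \<Rightarrow> bool" where
  "projective_module R M \<longleftrightarrow> left_module R M \<and>
     (\<forall>(N :: ('a, 'm \<Rightarrow> 'a) module) (L :: ('a, 'm) module).
        \<forall>g \<in> left_module_hom R N L. \<forall>f \<in> left_module_hom R M L.
          left_module R N \<longrightarrow> left_module R L \<longrightarrow> g ` carrier N = carrier L \<longrightarrow>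
            (\<exists>h \<in> left_module_hom R M N. \<forall>x\<in>carrier M. g (h x) = f x))"

context left_module begin

lemma smult_l_null [simp]:
  assumes "x \<in> carrier M" shows "\<zero>\<^bsub>R\<^esub> \<odot>\<^bsub>M\<^esub> x = \<zero>\<^bsub>M\<^esub>"
proof -
  have "\<zero>\<^bsub>R\<^esub> \<odot>\<^bsub>M\<^esub> x \<oplus>\<^bsub>M\<^esub> \<zero>\<^bsub>R\<^esub> \<odot>\<^bsub>M\<^esub> x = \<zero>\<^bsub>R\<^esub> \<odot>\<^bsub>M\<^esub> x"
    using smult_l_distr[of "\<zero>\<^bsub>R\<^esub>" "\<zero>\<^bsub>R\<^esub>" x] assms by simp
  then show ?thesis using assms by (metis M.add.r_cancel_one' R.zero_closed smult_closed)
qed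

lemma smult_r_null [simp]:
  assumes "a \<in> carrier R" shows "a \<odot>\<^bsub>M\<^esub> \<zero>\<^bsub>M\<^esub> = \<zero>\<^bsub>M\<^esub>"
proof -
  have "a \<odot>\<^bsub>M\<^esub> \<zero>\<^bsub>M\<^esub> \<oplus>\<^bsub>M\<^esub> a \<odot>\<^bsub>M\<^esub> \<zero>\<^bsub>M\<^esub> = a \<odot>\<^bsub>M\<^esub> \<zero>\<^bsub>M\<^esub>"
    using smult_r_distr[of a "\<zero>\<^bsub>M\<^esub>" "\<zero>\<^bsub>M\<^esub>"] assms by simp
  then show ?thesis using assms by (metis M.add.r_cancel_one' M.zero_closed smult_closed)
qed

lemma smult_finsum:
  assumes "finite A" "a \<in> carrier R" "f \<in> A \<rightarrow> carrier M"
  shows "a \<odot>\<^bsub>M\<^esub> finsum M f A = (\<Oplus>\<^bsub>M\<^esub>i\<in>A. a \<odot>\<^bsub>M\<^esub> f i)"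
  using assms
proof (induction A rule: finite_induct)
  case empty then show ?case by simp
next
  case (insert i A)
  then have "f \<in> A \<rightarrow> carrier M" "f i \<in> carrier M" "(\<lambda>i. a \<odot>\<^bsub>M\<^esub> f i) \<in> A \<rightarrow> carrier M" by auto
  then show ?case using insert by (simp add: smult_r_distr)
qed

end

definition free_left_module :: "('a, 'r) ring_scheme \<Rightarrow> 's set \<Rightarrow> ('a, 's \<Rightarrow> 'a) module" where
  "free_left_module R S =
     \<lparr>carrier = {\<phi>. (\<forall>s. \<phi> s \<in> carrier R) \<and> finite {s. \<phi> s \<noteq> \<zero>\<^bsub>R\<^esub>} \<and> (\<forall>s. s \<notin> S \<longrightarrow> \<phi> s = \<zero>\<^bsub>R\<^esub>)},
      monoid.mult = undefined, one = undefined, zero = (\<lambda>_. \<zero>\<^bsub>R\<^esub>),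
      add = (\<lambda>\<phi> \<psi> s. \<phi> s \<oplus>\<^bsub>R\<^esub> \<psi> s), smult = (\<lambda>r \<phi> s. r \<otimes>\<^bsub>R\<^esub> \<phi> s)\<rparr>"

lemma free_left_module_is_left_module:
  fixes R :: "('a, 'r) ring_scheme" (structure)
  assumes "ring R"
  shows "left_module R (free_left_module R S)"
proof -
  interpret ring R by fact
  let ?F = "free_left_module R S"
  have fin_add: "finite {s. \<phi> s \<oplus> \<psi> s \<noteq> \<zero>}"
    if "finite {s. \<phi> s \<noteq> \<zero>}" "finite {s. \<psi> s \<noteq> \<zero>}" for \<phi> \<psi> :: "'s \<Rightarrow> 'a"
    by (rule finite_subset[OF _ finite_UnI[OF that]]) auto
  have fin_smult: "finite {s. r \<otimes> \<phi> s \<noteq> \<zero>}"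
    if "finite {s. \<phi> s \<noteq> \<zero>}" "r \<in> carrier R" for \<phi> :: "'s \<Rightarrow> 'a" and r
    by (rule finite_subset[OF _ that(1)]) (use that in auto)
  have ab: "abelian_group ?F"
  proof (rule abelian_groupI)
    fix \<phi> assume \<phi>: "\<phi> \<in> carrier ?F"
    show "\<exists>\<psi>\<in>carrier ?F. \<psi> \<oplus>\<^bsub>?F\<^esub> \<phi> = \<zero>\<^bsub>?F\<^esub>"
    proof (rule bexI[where x = "\<lambda>s. \<ominus> \<phi> s"])
      show "(\<lambda>s. \<ominus> \<phi> s) \<oplus>\<^bsub>?F\<^esub> \<phi> = \<zero>\<^bsub>?F\<^esub>"
        using \<phi> by (auto simp: free_left_module_def l_neg)
      have "{s. \<ominus> \<phi> s \<noteq> \<zero>} \<subseteq> {s. \<phi> s \<noteq> \<zero>}" by auto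
      then show "(\<lambda>s. \<ominus> \<phi> s) \<in> carrier ?F"
        using \<phi> by (auto simp: free_left_module_def intro: finite_subset)
    qed
  qed (auto simp: free_left_module_def fin_add a_ac intro!: ext)
  show ?thesis
    apply (intro left_module.intro left_module_axioms.intro ab assms)
    by (auto simp: free_left_module_def fin_smult l_distr r_distr m_assoc intro!: ext)
qed

definition free_extension ::
    "('a, 'r) ring_scheme \<Rightarrow> ('a, 'n) module \<Rightarrow> ('s \<Rightarrow> 'n) \<Rightarrow> ('s \<Rightarrow> 'a) \<Rightarrow> 'n" where
  "free_extension R N v \<phi> = (\<Oplus>\<^bsub>N\<^esub>s\<in>{s. \<phi> s \<noteq> \<zero>\<^bsub>R\<^esub>}. \<phi> s \<odot>\<^bsub>N\<^esub> v s)"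

lemma free_extension_superset:
  assumes "left_module R N" and v: "v \<in> S \<rightarrow> carrier N" and \<phi>: "\<phi> \<in> carrier (free_left_module R S)"
    and T: "finite T" "{s. \<phi> s \<noteq> \<zero>\<^bsub>R\<^esub>} \<subseteq> T" "T \<subseteq> S"
  shows "free_extension R N v \<phi> = (\<Oplus>\<^bsub>N\<^esub>s\<in>T. \<phi> s \<odot>\<^bsub>N\<^esub> v s)"
proof -
  interpret N: left_module R N by fact
  show ?thesis unfolding free_extension_def
    by (rule N.M.add.finprod_mono_neutral_cong_left)
       (use \<phi> T v in \<open>auto simp: free_left_module_def Pi_iff subset_iff\<close>)
qed

lemma free_extension_hom:
  assumes "left_module R N" and v: "v \<in> S \<rightarrow> carrier N"
  shows "free_extension R N v \<in> left_module_hom R (free_left_module R S) N"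
proof -
  interpret N: left_module R N by fact
  let ?F = "free_left_module R S"
  let ?s = "\<lambda>\<phi>. {s. \<phi> s \<noteq> \<zero>\<^bsub>R\<^esub>}"
  interpret F: left_module R ?F
    by (rule free_left_module_is_left_module) (rule N.R.ring_axioms)
  have D: "finite (?s \<phi>)" "?s \<phi> \<subseteq> S" "\<And>s. \<phi> s \<in> carrier R" if "\<phi> \<in> carrier ?F" for \<phi>
    using that by (auto simp: free_left_module_def)
  have sm: "(\<lambda>s. \<phi> s \<odot>\<^bsub>N\<^esub> v s) \<in> T \<rightarrow> carrier N" if "\<phi> \<in> carrier ?F" "T \<subseteq> S" for \<phi> T
    using D[OF that(1)] that v by (auto intro!: N.smult_closed)
  show ?thesis unfolding left_module_hom_def
  proof (intro CollectI conjI ballI)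
    show "free_extension R N v \<in> carrier ?F \<rightarrow> carrier N"
      unfolding free_extension_def using D sm by (auto intro!: N.M.finsum_closed)
  next
    fix \<phi> \<psi> assume h: "\<phi> \<in> carrier ?F" "\<psi> \<in> carrier ?F"
    then have h3: "\<phi> \<oplus>\<^bsub>?F\<^esub> \<psi> \<in> carrier ?F" by simp
    define T where "T = ?s \<phi> \<union> ?s \<psi> \<union> ?s (\<phi> \<oplus>\<^bsub>?F\<^esub> \<psi>)"
    have T: "finite T" "T \<subseteq> S" using D[OF h(1)] D[OF h(2)] D[OF h3] by (auto simp: T_def)
    have e: "free_extension R N v \<chi> = (\<Oplus>\<^bsub>N\<^esub>s\<in>T. \<chi> s \<odot>\<^bsub>N\<^esub> v s)"
      if "\<chi> \<in> {\<phi>, \<psi>, \<phi> \<oplus>\<^bsub>?F\<^esub> \<psi>}" for \<chi>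
      by (rule free_extension_superset[OF assms _ T(1) _ T(2)]) (use that h h3 in \<open>auto simp: T_def\<close>)
    have "(\<Oplus>\<^bsub>N\<^esub>s\<in>T. (\<phi> \<oplus>\<^bsub>?F\<^esub> \<psi>) s \<odot>\<^bsub>N\<^esub> v s)
        = (\<Oplus>\<^bsub>N\<^esub>s\<in>T. \<phi> s \<odot>\<^bsub>N\<^esub> v s \<oplus>\<^bsub>N\<^esub> \<psi> s \<odot>\<^bsub>N\<^esub> v s)"
    proof (rule N.M.finsum_cong')
      show "(\<lambda>s. \<phi> s \<odot>\<^bsub>N\<^esub> v s \<oplus>\<^bsub>N\<^esub> \<psi> s \<odot>\<^bsub>N\<^esub> v s) \<in> T \<rightarrow> carrier N"
        using sm[OF h(1) T(2)] sm[OF h(2) T(2)] by auto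
      fix s assume "s \<in> T"
      then have "v s \<in> carrier N" using T v by auto
      then show "(\<phi> \<oplus>\<^bsub>?F\<^esub> \<psi>) s \<odot>\<^bsub>N\<^esub> v s = \<phi> s \<odot>\<^bsub>N\<^esub> v s \<oplus>\<^bsub>N\<^esub> \<psi> s \<odot>\<^bsub>N\<^esub> v s"
        using D[OF h(1)] D[OF h(2)] by (simp add: free_left_module_def N.smult_l_distr)
    qed simp
    also have "\<dots> = (\<Oplus>\<^bsub>N\<^esub>s\<in>T. \<phi> s \<odot>\<^bsub>N\<^esub> v s) \<oplus>\<^bsub>N\<^esub> (\<Oplus>\<^bsub>N\<^esub>s\<in>T. \<psi> s \<odot>\<^bsub>N\<^esub> v s)"
      by (rule N.M.finsum_addf) (use sm h T in auto)
    finally show "free_extension R N v (\<phi> \<oplus>\<^bsub>?F\<^esub> \<psi>)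
        = free_extension R N v \<phi> \<oplus>\<^bsub>N\<^esub> free_extension R N v \<psi>"
      by (simp add: e)
  next
    fix r \<phi> assume h: "r \<in> carrier R" "\<phi> \<in> carrier ?F"
    then have h3: "r \<odot>\<^bsub>?F\<^esub> \<phi> \<in> carrier ?F" by simp
    define T where "T = ?s \<phi> \<union> ?s (r \<odot>\<^bsub>?F\<^esub> \<phi>)"
    have T: "finite T" "T \<subseteq> S" using D[OF h(2)] D[OF h3] by (auto simp: T_def)
    have e: "free_extension R N v \<chi> = (\<Oplus>\<^bsub>N\<^esub>s\<in>T. \<chi> s \<odot>\<^bsub>N\<^esub> v s)"
      if "\<chi> \<in> {\<phi>, r \<odot>\<^bsub>?F\<^esub> \<phi>}" for \<chi>
      by (rule free_extension_superset[OF assms _ T(1) _ T(2)]) (use that h h3 in \<open>auto simp: T_def\<close>)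
    have "(\<Oplus>\<^bsub>N\<^esub>s\<in>T. (r \<odot>\<^bsub>?F\<^esub> \<phi>) s \<odot>\<^bsub>N\<^esub> v s) = (\<Oplus>\<^bsub>N\<^esub>s\<in>T. r \<odot>\<^bsub>N\<^esub> (\<phi> s \<odot>\<^bsub>N\<^esub> v s))"
    proof (rule N.M.finsum_cong')
      show "(\<lambda>s. r \<odot>\<^bsub>N\<^esub> (\<phi> s \<odot>\<^bsub>N\<^esub> v s)) \<in> T \<rightarrow> carrier N"
        using sm[OF h(2) T(2)] h by auto
      fix s assume "s \<in> T"
      then have "v s \<in> carrier N" using T v by auto
      then show "(r \<odot>\<^bsub>?F\<^esub> \<phi>) s \<odot>\<^bsub>N\<^esub> v s = r \<odot>\<^bsub>N\<^esub> (\<phi> s \<odot>\<^bsub>N\<^esub> v s)"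
        using D[OF h(2)] h by (simp add: free_left_module_def N.smult_assoc)
    qed simp
    also have "\<dots> = r \<odot>\<^bsub>N\<^esub> (\<Oplus>\<^bsub>N\<^esub>s\<in>T. \<phi> s \<odot>\<^bsub>N\<^esub> v s)"
      by (rule N.smult_finsum[symmetric]) (use sm h T in auto)
    finally show "free_extension R N v (r \<odot>\<^bsub>?F\<^esub> \<phi>) = r \<odot>\<^bsub>N\<^esub> free_extension R N v \<phi>"
      by (simp add: e)
  qed
qed

lemma free_extension_basis:
  assumes "left_module R N" "v \<in> S \<rightarrow> carrier N" "s \<in> S"
  defines "\<delta> \<equiv> (\<lambda>t. if t = s then \<one>\<^bsub>R\<^esub> else \<zero>\<^bsub>R\<^esub>)"
  shows "\<delta> \<in> carrier (free_left_module R S)" "free_extension R N v \<delta> = v s"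
proof -
  interpret N: left_module R N by fact
  show d: "\<delta> \<in> carrier (free_left_module R S)"
    using assms(3) by (auto simp: free_left_module_def \<delta>_def intro: finite_subset[of _ "{s}"])
  have "free_extension R N v \<delta> = (\<Oplus>\<^bsub>N\<^esub>t\<in>{s}. \<delta> t \<odot>\<^bsub>N\<^esub> v t)"
    by (rule free_extension_superset[OF assms(1,2) d]) (use assms(3) in \<open>auto simp: \<delta>_def\<close>)
  also have "\<dots> = v s"
  proof -
    have "v s \<in> carrier N" using assms by auto
    then show ?thesis by (simp add: \<delta>_def)
  qed
  finally show "free_extension R N v \<delta> = v s" .
qed

lemma hom_free_extension:
  assumes "left_module R N" "left_module R L" and g: "g \<in> left_module_hom R N L"
    and v: "v \<in> S \<rightarrow> carrier N" and \<phi>: "\<phi> \<in> carrier (free_left_module R S)"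
  shows "g (free_extension R N v \<phi>) = free_extension R L (\<lambda>s. g (v s)) \<phi>"
proof -
  interpret N: left_module R N by fact
  interpret L: left_module R L by fact
  have G: "\<And>x. x \<in> carrier N \<Longrightarrow> g x \<in> carrier L"
      "\<And>x y. x \<in> carrier N \<Longrightarrow> y \<in> carrier N \<Longrightarrow> g (x \<oplus>\<^bsub>N\<^esub> y) = g x \<oplus>\<^bsub>L\<^esub> g y"
      "\<And>r x. r \<in> carrier R \<Longrightarrow> x \<in> carrier N \<Longrightarrow> g (r \<odot>\<^bsub>N\<^esub> x) = r \<odot>\<^bsub>L\<^esub> g x"
    using g by (auto simp: left_module_hom_def)
  have g0: "g \<zero>\<^bsub>N\<^esub> = \<zero>\<^bsub>L\<^esub>"
    using G(3)[of "\<zero>\<^bsub>R\<^esub>" "\<zero>\<^bsub>N\<^esub>"] G(1)[of "\<zero>\<^bsub>N\<^esub>"] by simp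
  have "g (\<Oplus>\<^bsub>N\<^esub>s\<in>T. \<phi> s \<odot>\<^bsub>N\<^esub> v s) = (\<Oplus>\<^bsub>L\<^esub>s\<in>T. \<phi> s \<odot>\<^bsub>L\<^esub> g (v s))" if "finite T" "T \<subseteq> S" for T
    using that
  proof (induction T rule: finite_induct)
    case empty then show ?case by (simp add: g0)
  next
    case (insert t T)
    have c: "\<And>s. \<phi> s \<in> carrier R" using \<phi> by (simp add: free_left_module_def)
    have vs: "\<And>s. s \<in> insert t T \<Longrightarrow> v s \<in> carrier N" using insert v by auto
    have "(\<lambda>s. \<phi> s \<odot>\<^bsub>N\<^esub> v s) \<in> T \<rightarrow> carrier N" "(\<lambda>s. \<phi> s \<odot>\<^bsub>L\<^esub> g (v s)) \<in> T \<rightarrow> carrier L"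
      using c vs G(1) by auto
    then show ?case using insert c vs G by simp
  qed
  then show ?thesis using \<phi> by (auto simp: free_extension_def free_left_module_def)
qed

lemma projective_module_lift:
  fixes M :: "('a, 'm) module" and N :: "('a, 'n) module" and L :: "('a, 'l) module"
  assumes "projective_module R M" and N: "left_module R N" and L: "left_module R L"
    and g: "g \<in> left_module_hom R N L" and f: "f \<in> left_module_hom R M L"
    and surj: "g ` carrier N = carrier L"
  shows "\<exists>h \<in> left_module_hom R M N. \<forall>x\<in>carrier M. g (h x) = f x"
proof -
  have M: "left_module R M" using assms(1) by (simp add: projective_module_def)
  interpret M: left_module R M by fact
  let ?F = "free_left_module R (carrier M)"
  let ?p = "free_extension R M (\<lambda>x. x)"
  have F: "left_module R ?F" by (rule free_left_module_is_left_module) (rule M.R.ring_axioms)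
  have p: "?p \<in> left_module_hom R ?F M" by (rule free_extension_hom) (auto simp: M)
  have ps: "?p ` carrier ?F = carrier M"
  proof
    show "?p ` carrier ?F \<subseteq> carrier M" using p by (auto simp: left_module_hom_def)
    show "carrier M \<subseteq> ?p ` carrier ?F"
    proof
      fix x assume "x \<in> carrier M"
      from free_extension_basis[OF M _ this, of "\<lambda>x. x"] show "x \<in> ?p ` carrier ?F"
        by (metis (no_types, lifting) Pi_I image_eqI)
    qed
  qed
  have idM: "(\<lambda>x. x) \<in> left_module_hom R M M" by (auto simp: left_module_hom_def)
  have "\<exists>s \<in> left_module_hom R M ?F. \<forall>x\<in>carrier M. ?p (s x) = x"
    using assms(1)[unfolded projective_module_def, THEN conjunct2, rule_format, OF p idM F M ps] .
  then obtain s where s: "s \<in> left_module_hom R M ?F" and sp: "\<forall>x\<in>carrier M. ?p (s x) = x" ..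
  define v where "v = (\<lambda>x. inv_into (carrier N) g (f x))"
  have fc: "f x \<in> g ` carrier N" if "x \<in> carrier M" for x
    using f surj that by (auto simp: left_module_hom_def)
  have v: "v \<in> carrier M \<rightarrow> carrier N" using fc by (auto simp: v_def intro: inv_into_into)
  have gv: "\<And>x. x \<in> carrier M \<Longrightarrow> g (v x) = f x" using fc by (simp add: v_def f_inv_into_f)
  let ?q = "free_extension R N v"
  have q: "?q \<in> left_module_hom R ?F N" by (rule free_extension_hom[OF N v])
  show ?thesis
  proof (intro bexI ballI)
    show "(\<lambda>x. ?q (s x)) \<in> left_module_hom R M N"
      using q s by (auto simp: left_module_hom_def Pi_iff)
    fix x assume x: "x \<in> carrier M"
    have sx: "s x \<in> carrier ?F" using s x by (auto simp: left_module_hom_def)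
    have "g (?q (s x)) = free_extension R L (\<lambda>y. g (v y)) (s x)"
      by (rule hom_free_extension[OF N L g v sx])
    also have "\<dots> = free_extension R L (\<lambda>y. f y) (s x)"
    proof -
      interpret L: left_module R L by fact
      have "f \<in> carrier M \<rightarrow> carrier L" using f by (auto simp: left_module_hom_def)
      moreover have "y \<in> carrier M" "s x y \<in> carrier R" if "s x y \<noteq> \<zero>\<^bsub>R\<^esub>" for y
        using sx that by (auto simp: free_left_module_def)
      ultimately show ?thesis unfolding free_extension_def
        by (intro L.M.finsum_cong') (auto simp: gv Pi_iff)
    qed
    also have "\<dots> = f (?p (s x))"
      by (rule hom_free_extension[OF M L f _ sx, symmetric]) auto
    finally show "g (?q (s x)) = f x" using sp x by simp
  qed
qed


section \<open>Idempotents\<close>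

definition ring_idempotent :: "('a, 'r) ring_scheme \<Rightarrow> 'a \<Rightarrow> bool" where
  "ring_idempotent R e \<longleftrightarrow> e \<in> carrier R \<and> e \<otimes>\<^bsub>R\<^esub> e = e"

definition orthogonal :: "('a, 'r) ring_scheme \<Rightarrow> 'a \<Rightarrow> 'a \<Rightarrow> bool" where
  "orthogonal R e f \<longleftrightarrow> e \<otimes>\<^bsub>R\<^esub> f = \<zero>\<^bsub>R\<^esub> \<and> f \<otimes>\<^bsub>R\<^esub> e = \<zero>\<^bsub>R\<^esub>"

definition primitive_idempotent :: "('a, 'r) ring_scheme \<Rightarrow> 'a \<Rightarrow> bool" where
  "primitive_idempotent R e \<longleftrightarrow> ring_idempotent R e \<and> e \<noteq> \<zero>\<^bsub>R\<^esub> \<and>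
     \<not> (\<exists>f g. ring_idempotent R f \<and> ring_idempotent R g \<and> f \<noteq> \<zero>\<^bsub>R\<^esub> \<and> g \<noteq> \<zero>\<^bsub>R\<^esub>
            \<and> orthogonal R f g \<and> e = f \<oplus>\<^bsub>R\<^esub> g)"

definition complete_primitive_idempotents :: "('a, 'r) ring_scheme \<Rightarrow> 'a set \<Rightarrow> bool" where
  "complete_primitive_idempotents R E \<longleftrightarrow> finite E \<and> (\<forall>e\<in>E. primitive_idempotent R e)
     \<and> pairwise (orthogonal R) E \<and> (\<Oplus>\<^bsub>R\<^esub>e\<in>E. e) = \<one>\<^bsub>R\<^esub>"


section \<open>Linear categories\<close>

text \<open>\<open>Comp C x y z g f\<close> is the composite of \<open>f : x \<rightarrow> y\<close> and \<open>g : y \<rightarrow> z\<close>. Since the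
  composition knows its objects, morphism spaces of different pairs of objects may overlap.\<close>

record ('k, 'o, 'm) lincat =
  Ob :: "'o set"
  Mor :: "'o \<Rightarrow> 'o \<Rightarrow> ('k, 'm) module"
  Comp :: "'o \<Rightarrow> 'o \<Rightarrow> 'o \<Rightarrow> 'm \<Rightarrow> 'm \<Rightarrow> 'm"
  Ident :: "'o \<Rightarrow> 'm"

locale linear_category =
  fixes K :: "('k, 'r) ring_scheme" and C :: "('k, 'o, 'm) lincat"
  assumes Mor_module: "\<lbrakk>x \<in> Ob C; y \<in> Ob C\<rbrakk> \<Longrightarrow> module K (Mor C x y)"
    and Ident_closed: "x \<in> Ob C \<Longrightarrow> Ident C x \<in> carrier (Mor C x x)"
    and Comp_closed:
      "\<lbrakk>x \<in> Ob C; y \<in> Ob C; z \<in> Ob C; f \<in> carrier (Mor C x y); g \<in> carrier (Mor C y z)\<rbrakk> \<Longrightarrow>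
        Comp C x y z g f \<in> carrier (Mor C x z)"
    and Comp_assoc:
      "\<lbrakk>w \<in> Ob C; x \<in> Ob C; y \<in> Ob C; z \<in> Ob C;
        f \<in> carrier (Mor C w x); g \<in> carrier (Mor C x y); h \<in> carrier (Mor C y z)\<rbrakk> \<Longrightarrow>
        Comp C w x z (Comp C x y z h g) f = Comp C w y z h (Comp C w x y g f)"
    and Comp_Ident_left:
      "\<lbrakk>x \<in> Ob C; y \<in> Ob C; f \<in> carrier (Mor C x y)\<rbrakk> \<Longrightarrow> Comp C x y y (Ident C y) f = f"
    and Comp_Ident_right:
      "\<lbrakk>x \<in> Ob C; y \<in> Ob C; f \<in> carrier (Mor C x y)\<rbrakk> \<Longrightarrow> Comp C x x y f (Ident C x) = f"
    and Comp_add_left: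
      "\<lbrakk>x \<in> Ob C; y \<in> Ob C; z \<in> Ob C; f \<in> carrier (Mor C x y);
        g \<in> carrier (Mor C y z); g' \<in> carrier (Mor C y z)\<rbrakk> \<Longrightarrow>
        Comp C x y z (g \<oplus>\<^bsub>Mor C y z\<^esub> g') f = Comp C x y z g f \<oplus>\<^bsub>Mor C x z\<^esub> Comp C x y z g' f"
    and Comp_add_right:
      "\<lbrakk>x \<in> Ob C; y \<in> Ob C; z \<in> Ob C; f \<in> carrier (Mor C x y); f' \<in> carrier (Mor C x y);
        g \<in> carrier (Mor C y z)\<rbrakk> \<Longrightarrow>
        Comp C x y z g (f \<oplus>\<^bsub>Mor C x y\<^esub> f') = Comp C x y z g f \<oplus>\<^bsub>Mor C x z\<^esub> Comp C x y z g f'"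
    and Comp_smult_left:
      "\<lbrakk>x \<in> Ob C; y \<in> Ob C; z \<in> Ob C; f \<in> carrier (Mor C x y); g \<in> carrier (Mor C y z);
        c \<in> carrier K\<rbrakk> \<Longrightarrow>
        Comp C x y z (c \<odot>\<^bsub>Mor C y z\<^esub> g) f = c \<odot>\<^bsub>Mor C x z\<^esub> Comp C x y z g f"
    and Comp_smult_right:
      "\<lbrakk>x \<in> Ob C; y \<in> Ob C; z \<in> Ob C; f \<in> carrier (Mor C x y); g \<in> carrier (Mor C y z);
        c \<in> carrier K\<rbrakk> \<Longrightarrow>
        Comp C x y z g (c \<odot>\<^bsub>Mor C x y\<^esub> f) = c \<odot>\<^bsub>Mor C x z\<^esub> Comp C x y z g f"

definition skeletal :: "('k, 'o, 'm) lincat \<Rightarrow> bool" where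
  "skeletal C \<longleftrightarrow> (\<forall>x\<in>Ob C. \<forall>y\<in>Ob C.
     (\<exists>f\<in>carrier (Mor C x y). \<exists>g\<in>carrier (Mor C y x).
        Comp C x y x g f = Ident C x \<and> Comp C y x y f g = Ident C y) \<longrightarrow> x = y)"

definition finite_dimensional :: "('k, 'r) ring_scheme \<Rightarrow> ('k, 'm) module \<Rightarrow> bool" where
  "finite_dimensional K V \<longleftrightarrow> (\<exists>B. finite B \<and> B \<subseteq> carrier V \<and>
     (\<forall>v\<in>carrier V. \<exists>c \<in> B \<rightarrow> carrier K. v = (\<Oplus>\<^bsub>V\<^esub>b\<in>B. c b \<odot>\<^bsub>V\<^esub> b)))"

definition locally_finite :: "('k, 'r) ring_scheme \<Rightarrow> ('k, 'o, 'm) lincat \<Rightarrow> bool" where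
  "locally_finite K C \<longleftrightarrow> (\<forall>x\<in>Ob C. \<forall>y\<in>Ob C. finite_dimensional K (Mor C x y))"

definition directed_category :: "('k, 'o, 'm) lincat \<Rightarrow> ('o \<times> 'o) set \<Rightarrow> bool" where
  "directed_category C leq \<longleftrightarrow> partial_order_on (Ob C) leq \<and>
     (\<forall>x\<in>Ob C. \<forall>y\<in>Ob C. carrier (Mor C x y) \<noteq> {\<zero>\<^bsub>Mor C x y\<^esub>} \<longrightarrow> (x, y) \<in> leq)"

definition end_ring :: "('k, 'o, 'm) lincat \<Rightarrow> 'o \<Rightarrow> 'm ring" where
  "end_ring C x =
     \<lparr>carrier = carrier (Mor C x x), monoid.mult = Comp C x x x, one = Ident C x,
      zero = \<zero>\<^bsub>Mor C x x\<^esub>, add = add (Mor C x x)\<rparr>"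

definition mor_left_module :: "('k, 'o, 'm) lincat \<Rightarrow> 'o \<Rightarrow> 'o \<Rightarrow> ('m, 'm) module" where
  "mor_left_module C x y =
     \<lparr>carrier = carrier (Mor C x y), monoid.mult = undefined, one = undefined,
      zero = \<zero>\<^bsub>Mor C x y\<^esub>, add = add (Mor C x y), smult = Comp C x y y\<rparr>"

text \<open>For finitely many objects, an element \<open>a\<close> of the direct sum of all morphism spaces is the
  family of its components \<open>a (x, y)\<close> in \<open>Mor C x y\<close>.\<close>

definition category_algebra :: "('k, 'o, 'm) lincat \<Rightarrow> ('o \<times> 'o \<Rightarrow> 'm) ring" where
  "category_algebra C =
     \<lparr>carrier = (\<Pi>\<^sub>E (x, y) \<in> Ob C \<times> Ob C. carrier (Mor C x y)),
      monoid.mult = (\<lambda>b a. \<lambda>(x, z) \<in> Ob C \<times> Ob C.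
                \<Oplus>\<^bsub>Mor C x z\<^esub>y\<in>Ob C. Comp C x y z (b (y, z)) (a (x, y))),
      one = (\<lambda>(x, y) \<in> Ob C \<times> Ob C. if x = y then Ident C x else \<zero>\<^bsub>Mor C x y\<^esub>),
      zero = (\<lambda>(x, y) \<in> Ob C \<times> Ob C. \<zero>\<^bsub>Mor C x y\<^esub>),
      add = (\<lambda>a b. \<lambda>(x, y) \<in> Ob C \<times> Ob C. a (x, y) \<oplus>\<^bsub>Mor C x y\<^esub> b (x, y))\<rparr>"

definition mor_embed :: "('k, 'o, 'm) lincat \<Rightarrow> 'o \<Rightarrow> 'o \<Rightarrow> 'm \<Rightarrow> ('o \<times> 'o \<Rightarrow> 'm)" where
  "mor_embed C x y f =
     (\<lambda>(u, v) \<in> Ob C \<times> Ob C. if u = x \<and> v = y then f else \<zero>\<^bsub>Mor C u v\<^esub>)"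

context linear_category begin

lemma Mor_abelian_group: "\<lbrakk>x \<in> Ob C; y \<in> Ob C\<rbrakk> \<Longrightarrow> abelian_group (Mor C x y)"
  using Mor_module module.axioms(2) by blast

lemma end_ring_is_ring:
  assumes "x \<in> Ob C" shows "ring (end_ring C x)"
proof -
  interpret V: abelian_group "Mor C x x" by (rule Mor_abelian_group) (rule assms)+
  show ?thesis
  proof (rule ringI)
    show "abelian_group (end_ring C x)"
    proof (rule abelian_groupI)
      fix f assume "f \<in> carrier (end_ring C x)"
      then show "\<exists>g\<in>carrier (end_ring C x). g \<oplus>\<^bsub>end_ring C x\<^esub> f = \<zero>\<^bsub>end_ring C x\<^esub>"
        by (intro bexI[of _ "\<ominus>\<^bsub>Mor C x x\<^esub> f"]) (auto simp: end_ring_def V.l_neg)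
    qed (auto simp: end_ring_def V.a_ac)
    show "monoid (end_ring C x)"
      by (rule monoidI)
         (auto simp: end_ring_def assms Comp_closed Comp_assoc Ident_closed Comp_Ident_left
           Comp_Ident_right)
  qed (auto simp: end_ring_def assms Comp_add_left Comp_add_right)
qed

lemma mor_left_module_is_left_module:
  assumes "x \<in> Ob C" "y \<in> Ob C" shows "left_module (end_ring C y) (mor_left_module C x y)"
proof -
  interpret V: abelian_group "Mor C x y" by (rule Mor_abelian_group) (rule assms)+
  have "abelian_group (mor_left_module C x y)"
  proof (rule abelian_groupI)
    fix f assume "f \<in> carrier (mor_left_module C x y)"
    then show "\<exists>g\<in>carrier (mor_left_module C x y). g \<oplus>\<^bsub>mor_left_module C x y\<^esub> f = \<zero>\<^bsub>mor_left_module C x y\<^esub>"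
      by (intro bexI[of _ "\<ominus>\<^bsub>Mor C x y\<^esub> f"]) (auto simp: mor_left_module_def V.l_neg)
  qed (auto simp: mor_left_module_def V.a_ac)
  with end_ring_is_ring[OF assms(2)] show ?thesis
    by (intro left_module.intro left_module_axioms.intro)
       (auto simp: end_ring_def mor_left_module_def assms Comp_closed Comp_assoc Comp_Ident_left
         Comp_add_left Comp_add_right)
qed

lemma Comp_zero_left:
  assumes "x \<in> Ob C" "y \<in> Ob C" "z \<in> Ob C" "f \<in> carrier (Mor C x y)"
  shows "Comp C x y z \<zero>\<^bsub>Mor C y z\<^esub> f = \<zero>\<^bsub>Mor C x z\<^esub>"
proof -
  interpret V: abelian_group "Mor C y z" by (rule Mor_abelian_group) (rule assms)+
  interpret W: abelian_group "Mor C x z" by (rule Mor_abelian_group) (rule assms)+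
  show ?thesis using Comp_add_left[OF assms V.zero_closed V.zero_closed] Comp_closed[OF assms V.zero_closed]
    by (simp add: W.add.r_cancel_one')
qed

lemma Comp_zero_right:
  assumes "x \<in> Ob C" "y \<in> Ob C" "z \<in> Ob C" "g \<in> carrier (Mor C y z)"
  shows "Comp C x y z g \<zero>\<^bsub>Mor C x y\<^esub> = \<zero>\<^bsub>Mor C x z\<^esub>"
proof -
  interpret V: abelian_group "Mor C x y" by (rule Mor_abelian_group) (rule assms)+
  interpret W: abelian_group "Mor C x z" by (rule Mor_abelian_group) (rule assms)+
  show ?thesis
    using Comp_add_right[OF assms(1-3) V.zero_closed V.zero_closed assms(4)]
      Comp_closed[OF assms(1-3) V.zero_closed assms(4)]
    by (simp add: W.add.r_cancel_one')
qed

lemma Comp_finsum_left: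
  assumes "x \<in> Ob C" "y \<in> Ob C" "z \<in> Ob C" "f \<in> carrier (Mor C x y)"
    "finite I" "g \<in> I \<rightarrow> carrier (Mor C y z)"
  shows "Comp C x y z (finsum (Mor C y z) g I) f = (\<Oplus>\<^bsub>Mor C x z\<^esub>i\<in>I. Comp C x y z (g i) f)"
  using assms(5,6)
proof (induction I rule: finite_induct)
  interpret V: abelian_group "Mor C y z" by (rule Mor_abelian_group) (rule assms)+
  interpret W: abelian_group "Mor C x z" by (rule Mor_abelian_group) (rule assms)+
  { case empty then show ?case by (simp add: Comp_zero_left assms) }
  { case (insert i I)
    then have "g \<in> I \<rightarrow> carrier (Mor C y z)" "g i \<in> carrier (Mor C y z)"
      "(\<lambda>i. Comp C x y z (g i) f) \<in> I \<rightarrow> carrier (Mor C x z)"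
      by (auto simp: Pi_iff intro!: Comp_closed assms)
    then show ?case using insert
      by (simp add: Comp_add_left Comp_closed assms) }
qed

lemma Comp_finsum_right:
  assumes "x \<in> Ob C" "y \<in> Ob C" "z \<in> Ob C" "g \<in> carrier (Mor C y z)"
    "finite I" "f \<in> I \<rightarrow> carrier (Mor C x y)"
  shows "Comp C x y z g (finsum (Mor C x y) f I) = (\<Oplus>\<^bsub>Mor C x z\<^esub>i\<in>I. Comp C x y z g (f i))"
  using assms(5,6)
proof (induction I rule: finite_induct)
  interpret V: abelian_group "Mor C x y" by (rule Mor_abelian_group) (rule assms)+
  interpret W: abelian_group "Mor C x z" by (rule Mor_abelian_group) (rule assms)+
  { case empty then show ?case by (simp add: Comp_zero_right assms) }
  { case (insert i I)
    then have "f \<in> I \<rightarrow> carrier (Mor C x y)" "f i \<in> carrier (Mor C x y)"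
      "(\<lambda>i. Comp C x y z g (f i)) \<in> I \<rightarrow> carrier (Mor C x z)"
      by (auto simp: Pi_iff intro!: Comp_closed assms)
    then show ?case using insert
      by (simp add: Comp_add_right Comp_closed assms) }
qed


lemma category_algebra_is_ring:
  assumes fin: "finite (Ob C)" shows "ring (category_algebra C)"
proof -
  let ?A = "category_algebra C"
  note G = Mor_abelian_group
  have car: "a (x, y) \<in> carrier (Mor C x y)" if "a \<in> carrier ?A" "x \<in> Ob C" "y \<in> Ob C" for a x y
    using that by (auto simp: category_algebra_def PiE_iff)
  have carI: "a \<in> carrier ?A" if "\<And>x y. x \<in> Ob C \<Longrightarrow> y \<in> Ob C \<Longrightarrow> a (x, y) \<in> carrier (Mor C x y)"
    "a \<in> extensional (Ob C \<times> Ob C)" for a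
    using that by (auto simp: category_algebra_def PiE_iff)
  have eqI: "a = b" if "a \<in> carrier ?A" "b \<in> carrier ?A"
    "\<And>x y. x \<in> Ob C \<Longrightarrow> y \<in> Ob C \<Longrightarrow> a (x, y) = b (x, y)" for a b
    by (rule PiE_ext[where k = "Ob C \<times> Ob C" and s = "\<lambda>(x, y). carrier (Mor C x y)"])
       (use that in \<open>auto simp: category_algebra_def\<close>)
  have add_at: "(a \<oplus>\<^bsub>?A\<^esub> b) (x, y) = a (x, y) \<oplus>\<^bsub>Mor C x y\<^esub> b (x, y)"
    if "x \<in> Ob C" "y \<in> Ob C" for a b x y using that by (simp add: category_algebra_def)
  have zero_at: "\<zero>\<^bsub>?A\<^esub> (x, y) = \<zero>\<^bsub>Mor C x y\<^esub>"
    if "x \<in> Ob C" "y \<in> Ob C" for x y using that by (simp add: category_algebra_def)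
  have one_at: "\<one>\<^bsub>?A\<^esub> (x, y) = (if x = y then Ident C x else \<zero>\<^bsub>Mor C x y\<^esub>)"
    if "x \<in> Ob C" "y \<in> Ob C" for x y using that by (simp add: category_algebra_def)
  have mult_at: "(b \<otimes>\<^bsub>?A\<^esub> a) (x, z) = (\<Oplus>\<^bsub>Mor C x z\<^esub>y\<in>Ob C. Comp C x y z (b (y, z)) (a (x, y)))"
    if "x \<in> Ob C" "z \<in> Ob C" for a b x z using that by (simp add: category_algebra_def)
  have term_cl: "(\<lambda>y. Comp C x y z (b (y, z)) (a (x, y))) \<in> Ob C \<rightarrow> carrier (Mor C x z)"
    if "a \<in> carrier ?A" "b \<in> carrier ?A" "x \<in> Ob C" "z \<in> Ob C" for a b x z
    using that by (simp add: Comp_closed car)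
  have add_cl: "a \<oplus>\<^bsub>?A\<^esub> b \<in> carrier ?A" if "a \<in> carrier ?A" "b \<in> carrier ?A" for a b
  proof (rule carI)
    show "(a \<oplus>\<^bsub>?A\<^esub> b) (x, y) \<in> carrier (Mor C x y)" if "x \<in> Ob C" "y \<in> Ob C" for x y
    proof -
      interpret V: abelian_group "Mor C x y" by (rule G) (rule that)+
      show ?thesis by (simp add: that add_at car \<open>a \<in> carrier ?A\<close> \<open>b \<in> carrier ?A\<close>)
    qed
  qed (simp add: category_algebra_def)
  have zero_cl: "\<zero>\<^bsub>?A\<^esub> \<in> carrier ?A"
    by (rule carI)
       (auto simp: zero_at intro: abelian_monoid.zero_closed[OF abelian_group.axioms(1)[OF G]],
        simp add: category_algebra_def)
  have one_cl: "\<one>\<^bsub>?A\<^esub> \<in> carrier ?A"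
    by (rule carI)
       (auto simp: one_at Ident_closed
          intro: abelian_monoid.zero_closed[OF abelian_group.axioms(1)[OF G]],
        simp add: category_algebra_def)
  have mult_cl: "b \<otimes>\<^bsub>?A\<^esub> a \<in> carrier ?A" if "a \<in> carrier ?A" "b \<in> carrier ?A" for a b
  proof (rule carI)
    show "(b \<otimes>\<^bsub>?A\<^esub> a) (x, y) \<in> carrier (Mor C x y)" if "x \<in> Ob C" "y \<in> Ob C" for x y
    proof -
      interpret V: abelian_group "Mor C x y" by (rule G) (rule that)+
      show ?thesis unfolding mult_at[OF that]
        by (intro V.finsum_closed term_cl that \<open>a \<in> carrier ?A\<close> \<open>b \<in> carrier ?A\<close>)
    qed
  qed (simp add: category_algebra_def)
  show ?thesis
  proof (rule ringI)
    show "abelian_group ?A"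
    proof (rule abelian_groupI)
      fix a b c assume abc: "a \<in> carrier ?A" "b \<in> carrier ?A" "c \<in> carrier ?A"
      show "a \<oplus>\<^bsub>?A\<^esub> b \<oplus>\<^bsub>?A\<^esub> c = a \<oplus>\<^bsub>?A\<^esub> (b \<oplus>\<^bsub>?A\<^esub> c)"
      proof (intro eqI add_cl abc)
        fix x y assume xy: "x \<in> Ob C" "y \<in> Ob C"
        interpret V: abelian_group "Mor C x y" by (rule G) (rule xy)+
        show "(a \<oplus>\<^bsub>?A\<^esub> b \<oplus>\<^bsub>?A\<^esub> c) (x, y) = (a \<oplus>\<^bsub>?A\<^esub> (b \<oplus>\<^bsub>?A\<^esub> c)) (x, y)"
          by (simp add: xy add_at car abc V.a_assoc)
      qed
    next
      fix a b assume abc: "a \<in> carrier ?A" "b \<in> carrier ?A"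
      show "a \<oplus>\<^bsub>?A\<^esub> b = b \<oplus>\<^bsub>?A\<^esub> a"
      proof (intro eqI add_cl abc)
        fix x y assume xy: "x \<in> Ob C" "y \<in> Ob C"
        interpret V: abelian_group "Mor C x y" by (rule G) (rule xy)+
        show "(a \<oplus>\<^bsub>?A\<^esub> b) (x, y) = (b \<oplus>\<^bsub>?A\<^esub> a) (x, y)"
          by (simp add: xy add_at car abc V.a_comm)
      qed
    next
      fix a assume a: "a \<in> carrier ?A"
      show "\<zero>\<^bsub>?A\<^esub> \<oplus>\<^bsub>?A\<^esub> a = a"
      proof (intro eqI add_cl zero_cl a)
        fix x y assume xy: "x \<in> Ob C" "y \<in> Ob C"
        interpret V: abelian_group "Mor C x y" by (rule G) (rule xy)+
        show "(\<zero>\<^bsub>?A\<^esub> \<oplus>\<^bsub>?A\<^esub> a) (x, y) = a (x, y)"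
          by (simp add: xy add_at zero_at car a)
      qed
      define b where "b = (\<lambda>(x, y) \<in> Ob C \<times> Ob C. \<ominus>\<^bsub>Mor C x y\<^esub> a (x, y))"
      have b: "b \<in> carrier ?A"
        by (rule carI) (auto simp: b_def a car intro: abelian_group.a_inv_closed[OF G])
      have "b \<oplus>\<^bsub>?A\<^esub> a = \<zero>\<^bsub>?A\<^esub>"
      proof (intro eqI add_cl zero_cl a b)
        fix x y assume xy: "x \<in> Ob C" "y \<in> Ob C"
        interpret V: abelian_group "Mor C x y" by (rule G) (rule xy)+
        show "(b \<oplus>\<^bsub>?A\<^esub> a) (x, y) = \<zero>\<^bsub>?A\<^esub> (x, y)"
          by (simp add: xy add_at zero_at car a b_def V.l_neg)
      qed
      then show "\<exists>b\<in>carrier ?A. b \<oplus>\<^bsub>?A\<^esub> a = \<zero>\<^bsub>?A\<^esub>" using b by (rule bexI)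
    qed (simp_all add: add_cl zero_cl)
  next
    show "monoid ?A"
    proof (rule monoidI)
      fix c b a assume abc: "c \<in> carrier ?A" "b \<in> carrier ?A" "a \<in> carrier ?A"
      show "c \<otimes>\<^bsub>?A\<^esub> b \<otimes>\<^bsub>?A\<^esub> a = c \<otimes>\<^bsub>?A\<^esub> (b \<otimes>\<^bsub>?A\<^esub> a)"
      proof (intro eqI mult_cl abc)
        fix w z assume wz: "w \<in> Ob C" "z \<in> Ob C"
        interpret V: abelian_group "Mor C w z" by (rule G) (rule wz)+
        let ?t = "\<lambda>x y. Comp C w x z (Comp C x y z (c (y, z)) (b (x, y))) (a (w, x))"
        have t: "?t x y \<in> carrier (Mor C w z)" if "x \<in> Ob C" "y \<in> Ob C" for x y
          by (simp add: Comp_closed car abc wz that)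
        have swap: "(\<Oplus>\<^bsub>Mor C w z\<^esub>x\<in>X'. \<Oplus>\<^bsub>Mor C w z\<^esub>y\<in>Ob C. ?t x y)
            = (\<Oplus>\<^bsub>Mor C w z\<^esub>y\<in>Ob C. \<Oplus>\<^bsub>Mor C w z\<^esub>x\<in>X'. ?t x y)" if "finite X'" "X' \<subseteq> Ob C" for X'
          using that
        proof (induction X' rule: finite_induct)
          case empty show ?case by (simp add: V.finsum_zero)
        next
          case (insert x X')
          have "(\<Oplus>\<^bsub>Mor C w z\<^esub>y\<in>Ob C. \<Oplus>\<^bsub>Mor C w z\<^esub>x\<in>insert x X'. ?t x y)
              = (\<Oplus>\<^bsub>Mor C w z\<^esub>y\<in>Ob C. ?t x y \<oplus>\<^bsub>Mor C w z\<^esub> (\<Oplus>\<^bsub>Mor C w z\<^esub>x\<in>X'. ?t x y))"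
            by (rule V.finsum_cong')
               (use insert t in \<open>auto simp: subset_iff intro!: V.finsum_closed V.finsum_insert\<close>)
          also have "\<dots> = (\<Oplus>\<^bsub>Mor C w z\<^esub>y\<in>Ob C. ?t x y)
              \<oplus>\<^bsub>Mor C w z\<^esub> (\<Oplus>\<^bsub>Mor C w z\<^esub>y\<in>Ob C. \<Oplus>\<^bsub>Mor C w z\<^esub>x\<in>X'. ?t x y)"
            by (rule V.finsum_addf) (use insert t in \<open>auto intro!: V.finsum_closed\<close>)
          also have "\<dots> = (\<Oplus>\<^bsub>Mor C w z\<^esub>x\<in>insert x X'. \<Oplus>\<^bsub>Mor C w z\<^esub>y\<in>Ob C. ?t x y)"
            using insert t
            by (subst V.finsum_insert) (auto intro!: V.finsum_closed)
          finally show ?case ..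
        qed
        have "(c \<otimes>\<^bsub>?A\<^esub> b \<otimes>\<^bsub>?A\<^esub> a) (w, z) = (\<Oplus>\<^bsub>Mor C w z\<^esub>x\<in>Ob C. \<Oplus>\<^bsub>Mor C w z\<^esub>y\<in>Ob C. ?t x y)"
          unfolding mult_at[OF wz]
        proof (rule V.finsum_cong')
          fix x assume x: "x \<in> Ob C"
          show "Comp C w x z ((c \<otimes>\<^bsub>?A\<^esub> b) (x, z)) (a (w, x)) = (\<Oplus>\<^bsub>Mor C w z\<^esub>y\<in>Ob C. ?t x y)"
            unfolding mult_at[OF x wz(2)]
            by (rule Comp_finsum_left) (simp_all add: wz x fin car abc term_cl)
        qed (use t in \<open>auto intro!: V.finsum_closed\<close>)
        also have "\<dots> = (\<Oplus>\<^bsub>Mor C w z\<^esub>y\<in>Ob C. \<Oplus>\<^bsub>Mor C w z\<^esub>x\<in>Ob C. ?t x y)"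
          by (rule swap[OF fin subset_refl])
        also have "\<dots> = (c \<otimes>\<^bsub>?A\<^esub> (b \<otimes>\<^bsub>?A\<^esub> a)) (w, z)"
          unfolding mult_at[OF wz]
        proof (rule V.finsum_cong')
          fix y assume y: "y \<in> Ob C"
          have "Comp C w y z (c (y, z)) ((b \<otimes>\<^bsub>?A\<^esub> a) (w, y))
              = (\<Oplus>\<^bsub>Mor C w z\<^esub>x\<in>Ob C. Comp C w y z (c (y, z)) (Comp C w x y (b (x, y)) (a (w, x))))"
            unfolding mult_at[OF wz(1) y]
            by (rule Comp_finsum_right) (simp_all add: wz y fin car abc term_cl)
          also have "\<dots> = (\<Oplus>\<^bsub>Mor C w z\<^esub>x\<in>Ob C. ?t x y)"
            by (rule V.finsum_cong') (use t y in \<open>simp_all add: Comp_assoc[symmetric] wz car abc\<close>)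
          finally show "(\<Oplus>\<^bsub>Mor C w z\<^esub>x\<in>Ob C. ?t x y) = Comp C w y z (c (y, z)) ((b \<otimes>\<^bsub>?A\<^esub> a) (w, y))" ..
        qed (simp_all add: Comp_closed car abc mult_cl wz)
        finally show "(c \<otimes>\<^bsub>?A\<^esub> b \<otimes>\<^bsub>?A\<^esub> a) (w, z) = (c \<otimes>\<^bsub>?A\<^esub> (b \<otimes>\<^bsub>?A\<^esub> a)) (w, z)" .
      qed
    next
      fix a assume a: "a \<in> carrier ?A"
      show "\<one>\<^bsub>?A\<^esub> \<otimes>\<^bsub>?A\<^esub> a = a"
      proof (intro eqI mult_cl one_cl a)
        fix x z assume xz: "x \<in> Ob C" "z \<in> Ob C"
        interpret V: abelian_group "Mor C x z" by (rule G) (rule xz)+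
        have "(\<one>\<^bsub>?A\<^esub> \<otimes>\<^bsub>?A\<^esub> a) (x, z) = (\<Oplus>\<^bsub>Mor C x z\<^esub>y\<in>Ob C. if z = y then a (x, z) else \<zero>\<^bsub>Mor C x z\<^esub>)"
          unfolding mult_at[OF xz]
          by (rule V.finsum_cong')
             (auto simp: one_at xz Comp_Ident_left Comp_zero_left car a)
        also have "\<dots> = a (x, z)"
          by (rule V.add.finprod_singleton) (auto simp: xz fin car a)
        finally show "(\<one>\<^bsub>?A\<^esub> \<otimes>\<^bsub>?A\<^esub> a) (x, z) = a (x, z)" .
      qed
      show "a \<otimes>\<^bsub>?A\<^esub> \<one>\<^bsub>?A\<^esub> = a"
      proof (intro eqI mult_cl one_cl a)
        fix x z assume xz: "x \<in> Ob C" "z \<in> Ob C"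
        interpret V: abelian_group "Mor C x z" by (rule G) (rule xz)+
        have "(a \<otimes>\<^bsub>?A\<^esub> \<one>\<^bsub>?A\<^esub>) (x, z) = (\<Oplus>\<^bsub>Mor C x z\<^esub>y\<in>Ob C. if x = y then a (x, z) else \<zero>\<^bsub>Mor C x z\<^esub>)"
          unfolding mult_at[OF xz]
          by (rule V.finsum_cong')
             (auto simp: one_at xz Comp_Ident_right Comp_zero_right car a)
        also have "\<dots> = a (x, z)"
          by (rule V.add.finprod_singleton) (auto simp: xz fin car a)
        finally show "(a \<otimes>\<^bsub>?A\<^esub> \<one>\<^bsub>?A\<^esub>) (x, z) = a (x, z)" .
      qed
    qed (simp_all add: mult_cl one_cl)
  next
    fix a b c assume abc: "a \<in> carrier ?A" "b \<in> carrier ?A" "c \<in> carrier ?A"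
    show "(a \<oplus>\<^bsub>?A\<^esub> b) \<otimes>\<^bsub>?A\<^esub> c = a \<otimes>\<^bsub>?A\<^esub> c \<oplus>\<^bsub>?A\<^esub> b \<otimes>\<^bsub>?A\<^esub> c"
    proof (intro eqI mult_cl add_cl abc)
      fix x z assume xz: "x \<in> Ob C" "z \<in> Ob C"
      interpret V: abelian_group "Mor C x z" by (rule G) (rule xz)+
      have "((a \<oplus>\<^bsub>?A\<^esub> b) \<otimes>\<^bsub>?A\<^esub> c) (x, z) = (\<Oplus>\<^bsub>Mor C x z\<^esub>y\<in>Ob C.
          Comp C x y z (a (y, z)) (c (x, y)) \<oplus>\<^bsub>Mor C x z\<^esub> Comp C x y z (b (y, z)) (c (x, y)))"
        unfolding mult_at[OF xz]
        by (rule V.finsum_cong')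
           (auto simp: add_at xz car abc Comp_add_left Comp_closed)
      also have "\<dots> = (a \<otimes>\<^bsub>?A\<^esub> c \<oplus>\<^bsub>?A\<^esub> b \<otimes>\<^bsub>?A\<^esub> c) (x, z)"
        unfolding add_at[OF xz] mult_at[OF xz] by (intro V.finsum_addf term_cl abc xz)
      finally show "((a \<oplus>\<^bsub>?A\<^esub> b) \<otimes>\<^bsub>?A\<^esub> c) (x, z) = (a \<otimes>\<^bsub>?A\<^esub> c \<oplus>\<^bsub>?A\<^esub> b \<otimes>\<^bsub>?A\<^esub> c) (x, z)" .
    qed
    show "c \<otimes>\<^bsub>?A\<^esub> (a \<oplus>\<^bsub>?A\<^esub> b) = c \<otimes>\<^bsub>?A\<^esub> a \<oplus>\<^bsub>?A\<^esub> c \<otimes>\<^bsub>?A\<^esub> b"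
    proof (intro eqI mult_cl add_cl abc)
      fix x z assume xz: "x \<in> Ob C" "z \<in> Ob C"
      interpret V: abelian_group "Mor C x z" by (rule G) (rule xz)+
      have "(c \<otimes>\<^bsub>?A\<^esub> (a \<oplus>\<^bsub>?A\<^esub> b)) (x, z) = (\<Oplus>\<^bsub>Mor C x z\<^esub>y\<in>Ob C.
          Comp C x y z (c (y, z)) (a (x, y)) \<oplus>\<^bsub>Mor C x z\<^esub> Comp C x y z (c (y, z)) (b (x, y)))"
        unfolding mult_at[OF xz]
        by (rule V.finsum_cong')
           (auto simp: add_at xz car abc Comp_add_right Comp_closed)
      also have "\<dots> = (c \<otimes>\<^bsub>?A\<^esub> a \<oplus>\<^bsub>?A\<^esub> c \<otimes>\<^bsub>?A\<^esub> b) (x, z)"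
        unfolding add_at[OF xz] mult_at[OF xz] by (intro V.finsum_addf term_cl abc xz)
      finally show "(c \<otimes>\<^bsub>?A\<^esub> (a \<oplus>\<^bsub>?A\<^esub> b)) (x, z) = (c \<otimes>\<^bsub>?A\<^esub> a \<oplus>\<^bsub>?A\<^esub> c \<otimes>\<^bsub>?A\<^esub> b) (x, z)" .
    qed
  qed
qed

end


section \<open>Standard modules and stratification\<close>

text \<open>\<open>E x\<close> is the chosen set of primitive idempotents at the object \<open>x\<close>; an index is a pair of
  an object and one of its idempotents.\<close>

definition idem_index :: "('k, 'o, 'm) lincat \<Rightarrow> ('o \<Rightarrow> 'm set) \<Rightarrow> ('o \<times> 'm) set" where
  "idem_index C E = (SIGMA x : Ob C. E x)"

definition canonical_preorder ::
    "('k, 'o, 'm) lincat \<Rightarrow> ('o \<Rightarrow> 'm set) \<Rightarrow> ('o \<times> 'o) set \<Rightarrow> (('o \<times> 'm) \<times> ('o \<times> 'm)) set" where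
  "canonical_preorder C E leq =
     {(l, m). l \<in> idem_index C E \<and> m \<in> idem_index C E \<and> (fst l, fst m) \<in> leq}"

definition idem_projective ::
    "('k, 'o, 'm) lincat \<Rightarrow> 'o \<times> 'm \<Rightarrow> ('o \<times> 'o \<Rightarrow> 'm, 'o \<times> 'o \<Rightarrow> 'm) module" where
  "idem_projective C l = (let A = category_algebra C in
     \<lparr>carrier = {a \<otimes>\<^bsub>A\<^esub> mor_embed C (fst l) (fst l) (snd l) | a. a \<in> carrier A},
      monoid.mult = undefined, one = undefined,
      zero = \<zero>\<^bsub>A\<^esub>, add = add A, smult = monoid.mult A\<rparr>)"

context linear_category begin

lemma idem_projective_is_left_module:
  assumes fin: "finite (Ob C)" and x: "x \<in> Ob C" and e: "e \<in> carrier (Mor C x x)"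
  shows "left_module (category_algebra C) (idem_projective C (x, e))"
proof -
  let ?A = "category_algebra C" and ?P = "idem_projective C (x, e)"
  interpret A: ring ?A by (rule category_algebra_is_ring[OF fin])
  define e' where "e' = mor_embed C x x e"
  have e': "e' \<in> carrier ?A"
    using e x abelian_monoid.zero_closed[OF abelian_group.axioms(1)[OF Mor_abelian_group]]
    by (auto simp: e'_def mor_embed_def category_algebra_def)
  have P: "carrier ?P = (\<lambda>a. a \<otimes>\<^bsub>?A\<^esub> e') ` carrier ?A" "zero ?P = zero ?A" "add ?P = add ?A"
    "smult ?P = monoid.mult ?A"
    by (auto simp: idem_projective_def e'_def Let_def)
  have sub: "p \<in> carrier ?A" if "p \<in> carrier ?P" for p using that e' by (auto simp: P)
  have add_cl: "p \<oplus>\<^bsub>?A\<^esub> q \<in> carrier ?P" if pq: "p \<in> carrier ?P" "q \<in> carrier ?P" for p q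
  proof -
    obtain a b where ab: "a \<in> carrier ?A" "p = a \<otimes>\<^bsub>?A\<^esub> e'" "b \<in> carrier ?A" "q = b \<otimes>\<^bsub>?A\<^esub> e'"
      using pq by (auto simp: P)
    then have "p \<oplus>\<^bsub>?A\<^esub> q = (a \<oplus>\<^bsub>?A\<^esub> b) \<otimes>\<^bsub>?A\<^esub> e'" using e' by (simp add: A.l_distr)
    then show ?thesis using ab by (simp add: P(1))
  qed
  have "abelian_group ?P"
  proof (rule abelian_groupI)
    fix p assume p: "p \<in> carrier ?P"
    then obtain a where a: "a \<in> carrier ?A" "p = a \<otimes>\<^bsub>?A\<^esub> e'" by (auto simp: P)
    then have "\<ominus>\<^bsub>?A\<^esub> p = (\<ominus>\<^bsub>?A\<^esub> a) \<otimes>\<^bsub>?A\<^esub> e'" using e' by (simp add: A.l_minus)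
    then have "\<ominus>\<^bsub>?A\<^esub> p \<in> carrier ?P" using a by (simp add: P(1))
    then show "\<exists>q\<in>carrier ?P. q \<oplus>\<^bsub>?P\<^esub> p = \<zero>\<^bsub>?P\<^esub>"
      using sub[OF p] by (intro bexI[of _ "\<ominus>\<^bsub>?A\<^esub> p"]) (auto simp: P(2,3) A.l_neg)
    have "\<zero>\<^bsub>?A\<^esub> = \<zero>\<^bsub>?A\<^esub> \<otimes>\<^bsub>?A\<^esub> e'" using e' by simp
    then show "\<zero>\<^bsub>?P\<^esub> \<oplus>\<^bsub>?P\<^esub> p = p" using sub[OF p] by (simp add: P(2,3))
  next
    show "\<zero>\<^bsub>?P\<^esub> \<in> carrier ?P" using e' by (auto simp: P intro!: image_eqI[of _ _ "\<zero>\<^bsub>?A\<^esub>"])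
  qed (simp_all add: P(2,3) sub add_cl A.a_ac)
  note ab = this
  show ?thesis
  proof (intro left_module.intro left_module_axioms.intro A.ring_axioms ab)
    fix a p assume a: "a \<in> carrier ?A" and "p \<in> carrier ?P"
    then obtain b where b: "b \<in> carrier ?A" "p = b \<otimes>\<^bsub>?A\<^esub> e'" by (auto simp: P)
    then have "a \<odot>\<^bsub>?P\<^esub> p = (a \<otimes>\<^bsub>?A\<^esub> b) \<otimes>\<^bsub>?A\<^esub> e'" using a e' by (simp add: P A.m_assoc)
    then show "a \<odot>\<^bsub>?P\<^esub> p \<in> carrier ?P" using a b by (simp add: P(1))
  qed (simp_all add: P(2-4) sub A.l_distr A.r_distr A.m_assoc)
qed

end

definition standard_module ::
    "('k, 'o, 'm) lincat \<Rightarrow> ('o \<Rightarrow> 'm set) \<Rightarrow> (('o \<times> 'm) \<times> ('o \<times> 'm)) set \<Rightarrow> 'o \<times> 'm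
      \<Rightarrow> ('o \<times> 'o \<Rightarrow> 'm, ('o \<times> 'o \<Rightarrow> 'm) set) module" where
  "standard_module C E pre l =
     quotient_module (idem_projective C l)
       (generated_submodule (category_algebra C) (idem_projective C l)
         (\<Union>m \<in> {m \<in> idem_index C E. (m, l) \<notin> pre}.
            trace_submodule (category_algebra C) (idem_projective C m) (idem_projective C l)))"

definition has_standard_filtration ::
    "('k, 'o, 'm) lincat \<Rightarrow> ('o \<Rightarrow> 'm set) \<Rightarrow> (('o \<times> 'm) \<times> ('o \<times> 'm)) set
      \<Rightarrow> ('o \<times> 'o \<Rightarrow> 'm, 'o \<times> 'o \<Rightarrow> 'm) module \<Rightarrow> bool" where
  "has_standard_filtration C E pre P \<longleftrightarrow>
     (\<exists>(n :: nat) F. F 0 = {\<zero>\<^bsub>P\<^esub>} \<and> F n = carrier P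
        \<and> (\<forall>i\<le>n. submodule (F i) (category_algebra C) P)
        \<and> (\<forall>i<n. F i \<subseteq> F (Suc i) \<and>
              (\<exists>m \<in> idem_index C E. left_module_iso (category_algebra C)
                 (quotient_module (P\<lparr>carrier := F (Suc i)\<rparr>) (F i))
                 (standard_module C E pre m))))"

definition standardly_stratified ::
    "('k, 'o, 'm) lincat \<Rightarrow> ('o \<Rightarrow> 'm set) \<Rightarrow> (('o \<times> 'm) \<times> ('o \<times> 'm)) set \<Rightarrow> bool" where
  "standardly_stratified C E pre \<longleftrightarrow>
     (\<forall>l \<in> idem_index C E. has_standard_filtration C E pre (idem_projective C l))"

end

theory Submission
  imports Defs
begin

text \<open>Because the category is directed, the sum of traces defining the standard module of \<open>(x, e)\<close>
  consists of the elements of \<open>C e\<close> that vanish at \<open>x\<close>; hence the standard module is \<open>C(x,x) e\<close>,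
  concentrated at \<open>x\<close>.

  Evaluating a standard filtration of \<open>C e\<close> at an object \<open>z\<close> therefore filters \<open>C(x,z) e\<close> by
  \<open>C(z,z)\<close>-modules whose factors are zero or of the form \<open>C(z,z) f\<close>. These are projective, so
  \<open>C(x,z) e\<close> is projective, and \<open>C(x,z)\<close> is the direct sum of these modules over all \<open>e\<close>.

  Conversely, filter \<open>C e\<close> by the elements supported on up-closed sets of objects. The layer at
  \<open>z\<close> is the projective module \<open>C(x,z) e\<close>, and a finite-dimensional projective module over
  \<open>C(z,z)\<close> is filtered by modules \<open>C(z,z) f\<close> with \<open>f\<close> primitive, by a Fitting argument.\<close>

section \<open>Submodules, quotients and homomorphisms\<close>

text \<open>The factors of a standard filtration are sets of cosets. An isomorphism from a quotient
  \<open>W/U\<close> to a standard module is therefore traded for an epimorphism from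
  \<open>W\<close> onto \<open>C(z,z) f\<close> with kernel \<open>U\<close>, and both directions
  manipulate only such epimorphisms. A module concentrated at \<open>z\<close> makes sense because a
  composite \<open>z -> w -> z\<close> through another object has a zero factor, so that
  \<open>a -> a (z, z)\<close> is multiplicative. Finite dimension enters as a function to the
  natural numbers that grows along strict inclusions of subspaces. It provides the maximal submodule
  and the induction for projective modules, and it makes the chains \<open>R u^n\<close> and
  \<open>u^n R\<close> stationary. The last fact gives what is wanted from locality of
  \<open>e R e\<close>: if \<open>e\<close> is primitive and \<open>u = e u = u e\<close> is not
  nilpotent, then \<open>t u = e\<close> for some \<open>t\<close>. This turns a map from a
  projective module to \<open>R e\<close> into a split epimorphism, and one summand is removed at a
  time.\<close>

context left_module
begin

lemma minus_one_smult:
  assumes "x \<in> carrier M" shows "(\<ominus>\<^bsub>R\<^esub> \<one>\<^bsub>R\<^esub>) \<odot>\<^bsub>M\<^esub> x = \<ominus>\<^bsub>M\<^esub> x"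
proof -
  have "(\<ominus>\<^bsub>R\<^esub> \<one>\<^bsub>R\<^esub>) \<odot>\<^bsub>M\<^esub> x \<oplus>\<^bsub>M\<^esub> x = (\<ominus>\<^bsub>R\<^esub> \<one>\<^bsub>R\<^esub> \<oplus>\<^bsub>R\<^esub> \<one>\<^bsub>R\<^esub>) \<odot>\<^bsub>M\<^esub> x"
    using assms by (simp add: smult_l_distr)
  also have "\<dots> = \<zero>\<^bsub>M\<^esub>" using assms by (simp add: R.l_neg)
  finally show ?thesis using assms by (simp add: M.minus_equality)
qed

lemma minus_eq_zero_iff:
  assumes "x \<in> carrier M" "y \<in> carrier M"
  shows "x \<ominus>\<^bsub>M\<^esub> y = \<zero>\<^bsub>M\<^esub> \<longleftrightarrow> x = y"
proof
  assume "x \<ominus>\<^bsub>M\<^esub> y = \<zero>\<^bsub>M\<^esub>"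
  then have "(x \<ominus>\<^bsub>M\<^esub> y) \<oplus>\<^bsub>M\<^esub> y = y" using assms by simp
  then show "x = y" using assms by (simp add: a_minus_def M.a_assoc M.l_neg)
qed (use assms in \<open>simp add: a_minus_def M.r_neg\<close>)

lemma submoduleI:
  assumes "H \<subseteq> carrier M" "\<zero>\<^bsub>M\<^esub> \<in> H" "\<And>a b. \<lbrakk>a \<in> H; b \<in> H\<rbrakk> \<Longrightarrow> a \<oplus>\<^bsub>M\<^esub> b \<in> H"
    "\<And>a x. \<lbrakk>a \<in> carrier R; x \<in> H\<rbrakk> \<Longrightarrow> a \<odot>\<^bsub>M\<^esub> x \<in> H"
  shows "submodule H R M"
proof -
  have "\<ominus>\<^bsub>M\<^esub> a \<in> H" if "a \<in> H" for a
    using assms(1) assms(4)[of "\<ominus>\<^bsub>R\<^esub> \<one>\<^bsub>R\<^esub>" a] that minus_one_smult[of a] by auto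
  then show ?thesis using assms
    by (intro submodule.intro subgroup.intro submodule_axioms.intro) (auto simp: a_inv_def)
qed

lemma submoduleD:
  assumes "submodule H R M"
  shows "H \<subseteq> carrier M" "\<zero>\<^bsub>M\<^esub> \<in> H" "\<And>a b. \<lbrakk>a \<in> H; b \<in> H\<rbrakk> \<Longrightarrow> a \<oplus>\<^bsub>M\<^esub> b \<in> H"
    "\<And>a x. \<lbrakk>a \<in> carrier R; x \<in> H\<rbrakk> \<Longrightarrow> a \<odot>\<^bsub>M\<^esub> x \<in> H" "\<And>a. a \<in> H \<Longrightarrow> \<ominus>\<^bsub>M\<^esub> a \<in> H"
    "\<And>a b. \<lbrakk>a \<in> H; b \<in> H\<rbrakk> \<Longrightarrow> a \<ominus>\<^bsub>M\<^esub> b \<in> H"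
proof -
  interpret submodule H R M by fact
  show "H \<subseteq> carrier M" using subset by simp
  show "\<zero>\<^bsub>M\<^esub> \<in> H" using one_closed by simp
  show add: "\<And>a b. \<lbrakk>a \<in> H; b \<in> H\<rbrakk> \<Longrightarrow> a \<oplus>\<^bsub>M\<^esub> b \<in> H" using m_closed by simp
  show "\<And>a x. \<lbrakk>a \<in> carrier R; x \<in> H\<rbrakk> \<Longrightarrow> a \<odot>\<^bsub>M\<^esub> x \<in> H" by (rule smult_closed)
  show inv: "\<And>a. a \<in> H \<Longrightarrow> \<ominus>\<^bsub>M\<^esub> a \<in> H" using m_inv_closed by (simp add: a_inv_def)
  show "\<And>a b. \<lbrakk>a \<in> H; b \<in> H\<rbrakk> \<Longrightarrow> a \<ominus>\<^bsub>M\<^esub> b \<in> H" using add inv by (simp add: a_minus_def)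
qed

lemma carrier_submodule: "submodule (carrier M) R M"
  by (rule submoduleI) auto

lemma submodule_left_module:
  assumes "submodule H R M" shows "left_module R (M\<lparr>carrier := H\<rparr>)"
proof -
  note D = submoduleD[OF assms]
  have "abelian_group (M\<lparr>carrier := H\<rparr>)"
  proof (rule abelian_groupI)
    fix x assume "x \<in> carrier (M\<lparr>carrier := H\<rparr>)"
    then show "\<exists>y\<in>carrier (M\<lparr>carrier := H\<rparr>). y \<oplus>\<^bsub>M\<lparr>carrier := H\<rparr>\<^esub> x = \<zero>\<^bsub>M\<lparr>carrier := H\<rparr>\<^esub>"
      using D by (intro bexI[of _ "\<ominus>\<^bsub>M\<^esub> x"]) (auto simp: M.l_neg subset_iff)
  qed (use D in \<open>auto simp: subset_iff M.a_ac\<close>)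
  then show ?thesis
    using D by (intro left_module.intro left_module_axioms.intro R.ring_axioms)
      (auto simp: subset_iff smult_l_distr smult_r_distr smult_assoc)
qed

end

lemma left_module_homD:
  assumes "h \<in> left_module_hom R M N"
  shows "x \<in> carrier M \<Longrightarrow> h x \<in> carrier N"
    "\<lbrakk>x \<in> carrier M; y \<in> carrier M\<rbrakk> \<Longrightarrow> h (x \<oplus>\<^bsub>M\<^esub> y) = h x \<oplus>\<^bsub>N\<^esub> h y"
    "\<lbrakk>r \<in> carrier R; x \<in> carrier M\<rbrakk> \<Longrightarrow> h (r \<odot>\<^bsub>M\<^esub> x) = r \<odot>\<^bsub>N\<^esub> h x"
  using assms by (auto simp: left_module_hom_def)

lemma left_module_homI:
  assumes "\<And>x. x \<in> carrier M \<Longrightarrow> h x \<in> carrier N"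
    "\<And>x y. \<lbrakk>x \<in> carrier M; y \<in> carrier M\<rbrakk> \<Longrightarrow> h (x \<oplus>\<^bsub>M\<^esub> y) = h x \<oplus>\<^bsub>N\<^esub> h y"
    "\<And>r x. \<lbrakk>r \<in> carrier R; x \<in> carrier M\<rbrakk> \<Longrightarrow> h (r \<odot>\<^bsub>M\<^esub> x) = r \<odot>\<^bsub>N\<^esub> h x"
  shows "h \<in> left_module_hom R M N"
  using assms by (auto simp: left_module_hom_def)

lemma left_module_hom_zero_minus:
  assumes "left_module R M" "left_module R N" and h: "h \<in> left_module_hom R M N"
  shows "h \<zero>\<^bsub>M\<^esub> = \<zero>\<^bsub>N\<^esub>"
    "\<lbrakk>x \<in> carrier M; y \<in> carrier M\<rbrakk> \<Longrightarrow> h (x \<ominus>\<^bsub>M\<^esub> y) = h x \<ominus>\<^bsub>N\<^esub> h y"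
proof -
  interpret M: left_module R M by fact
  interpret N: left_module R N by fact
  note H = left_module_homD[OF h]
  show "h \<zero>\<^bsub>M\<^esub> = \<zero>\<^bsub>N\<^esub>" using H(3)[of "\<zero>\<^bsub>R\<^esub>" "\<zero>\<^bsub>M\<^esub>"] H(1)[of "\<zero>\<^bsub>M\<^esub>"] by simp
  assume xy: "x \<in> carrier M" "y \<in> carrier M"
  have "h (\<ominus>\<^bsub>M\<^esub> y) = \<ominus>\<^bsub>N\<^esub> h y"
    using H(3)[of "\<ominus>\<^bsub>R\<^esub> \<one>\<^bsub>R\<^esub>" y] xy H(1)[of y] M.minus_one_smult[of y] N.minus_one_smult[of "h y"]
    by simp
  then show "h (x \<ominus>\<^bsub>M\<^esub> y) = h x \<ominus>\<^bsub>N\<^esub> h y" using xy H(2) by (simp add: a_minus_def)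
qed

lemma left_module_hom_finsum:
  assumes "left_module R M" "left_module R N" and h: "h \<in> left_module_hom R M N"
    and "finite I" "f \<in> I \<rightarrow> carrier M"
  shows "h (\<Oplus>\<^bsub>M\<^esub>i\<in>I. f i) = (\<Oplus>\<^bsub>N\<^esub>i\<in>I. h (f i))"
proof -
  interpret M: left_module R M by fact
  interpret N: left_module R N by fact
  note H = left_module_homD[OF h]
  show ?thesis using assms(4,5)
  proof (induction I rule: finite_induct)
    case empty then show ?case by (simp add: left_module_hom_zero_minus(1)[OF assms(1-3)])
  next
    case (insert i I)
    then have "f \<in> I \<rightarrow> carrier M" "f i \<in> carrier M" "(\<lambda>i. h (f i)) \<in> I \<rightarrow> carrier N"
      using H(1) by auto
    then show ?case using insert H by simp
  qed
qed

lemma left_module_hom_comp: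
  assumes "f \<in> left_module_hom R M N" "g \<in> left_module_hom R N L"
  shows "(\<lambda>x. g (f x)) \<in> left_module_hom R M L"
  using left_module_homD[OF assms(1)] left_module_homD[OF assms(2)] by (intro left_module_homI) auto

lemma left_module_iso_trans:
  assumes "left_module_iso R M N" "left_module_iso R N L" shows "left_module_iso R M L"
proof -
  obtain f g where fg: "f \<in> left_module_hom R M N" "bij_betw f (carrier M) (carrier N)"
    "g \<in> left_module_hom R N L" "bij_betw g (carrier N) (carrier L)"
    using assms by (auto simp: left_module_iso_def)
  have "bij_betw (\<lambda>x. g (f x)) (carrier M) (carrier L)"
    using bij_betw_trans[OF fg(2,4)] by (simp add: comp_def)
  then show ?thesis using left_module_hom_comp[OF fg(1,3)] by (auto simp: left_module_iso_def)
qed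

text \<open>The operations of \<open>N\<close> are pulled back through the bijection, which only
  asks that \<open>M\<close> be closed under its own. \<open>M\<close> will be a quotient module,
  for which exactly this closure is proved.\<close>

lemma left_module_iso_sym:
  assumes iso: "left_module_iso R M N"
    and add: "\<And>x y. \<lbrakk>x \<in> carrier M; y \<in> carrier M\<rbrakk> \<Longrightarrow> x \<oplus>\<^bsub>M\<^esub> y \<in> carrier M"
    and smult: "\<And>r x. \<lbrakk>r \<in> carrier R; x \<in> carrier M\<rbrakk> \<Longrightarrow> r \<odot>\<^bsub>M\<^esub> x \<in> carrier M"
  shows "left_module_iso R N M"
proof -
  obtain h where h: "h \<in> left_module_hom R M N" and b: "bij_betw h (carrier M) (carrier N)"
    using iso by (auto simp: left_module_iso_def)
  note H = left_module_homD[OF h]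
  let ?g = "inv_into (carrier M) h"
  have g: "?g y \<in> carrier M" "h (?g y) = y" if "y \<in> carrier N" for y
    using b that by (auto simp: bij_betw_def inv_into_into f_inv_into_f)
  have gh: "?g (h x) = x" if "x \<in> carrier M" for x
    using b that by (auto simp: bij_betw_def)
  have "?g \<in> left_module_hom R N M"
  proof (rule left_module_homI)
    fix x y assume "x \<in> carrier N" "y \<in> carrier N"
    then show "?g (x \<oplus>\<^bsub>N\<^esub> y) = ?g x \<oplus>\<^bsub>M\<^esub> ?g y"
      using gh[of "?g x \<oplus>\<^bsub>M\<^esub> ?g y"] by (simp add: g H add)
  next
    fix r x assume "r \<in> carrier R" "x \<in> carrier N"
    then show "?g (r \<odot>\<^bsub>N\<^esub> x) = r \<odot>\<^bsub>M\<^esub> ?g x"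
      using gh[of "r \<odot>\<^bsub>M\<^esub> ?g x"] by (simp add: g H smult)
  qed (simp add: g)
  moreover have "bij_betw ?g (carrier N) (carrier M)" using b by (rule bij_betw_inv_into)
  ultimately show ?thesis by (auto simp: left_module_iso_def)
qed

section \<open>Cosets, quotient modules and the isomorphism theorem\<close>

context left_module
begin

lemma coset_eq_iff:
  assumes "submodule N R M" "x \<in> carrier M" "y \<in> carrier M"
  shows "N +>\<^bsub>M\<^esub> x = N +>\<^bsub>M\<^esub> y \<longleftrightarrow> x \<ominus>\<^bsub>M\<^esub> y \<in> N"
proof -
  note D = submoduleD[OF assms(1)]
  have car: "\<And>n. n \<in> N \<Longrightarrow> n \<in> carrier M" using D by auto
  have mem: "w \<in> N +>\<^bsub>M\<^esub> z \<longleftrightarrow> w \<ominus>\<^bsub>M\<^esub> z \<in> N" if "z \<in> carrier M" "w \<in> carrier M" for w z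
  proof
    assume "w \<in> N +>\<^bsub>M\<^esub> z"
    then obtain n where "n \<in> N" "w = n \<oplus>\<^bsub>M\<^esub> z" by (auto simp: a_r_coset_def')
    then show "w \<ominus>\<^bsub>M\<^esub> z \<in> N" using that car
      by (simp add: a_minus_def M.a_assoc M.r_neg)
  next
    assume "w \<ominus>\<^bsub>M\<^esub> z \<in> N"
    moreover have "w = (w \<ominus>\<^bsub>M\<^esub> z) \<oplus>\<^bsub>M\<^esub> z"
      using that by (simp add: a_minus_def M.a_assoc M.l_neg)
    ultimately show "w \<in> N +>\<^bsub>M\<^esub> z" by (auto simp: a_r_coset_def')
  qed
  have sub: "N +>\<^bsub>M\<^esub> z \<subseteq> carrier M" if "z \<in> carrier M" for z
    using that car by (auto simp: a_r_coset_def')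
  have self: "z \<in> N +>\<^bsub>M\<^esub> z" if "z \<in> carrier M" for z
    using that mem[of z z] D(2) by (simp add: a_minus_def M.r_neg)
  show ?thesis
  proof
    assume "N +>\<^bsub>M\<^esub> x = N +>\<^bsub>M\<^esub> y"
    then show "x \<ominus>\<^bsub>M\<^esub> y \<in> N" using self[of x] mem[of y x] assms by simp
  next
    assume xy: "x \<ominus>\<^bsub>M\<^esub> y \<in> N"
    have "w \<ominus>\<^bsub>M\<^esub> x \<in> N \<longleftrightarrow> w \<ominus>\<^bsub>M\<^esub> y \<in> N" if w: "w \<in> carrier M" for w
    proof -
      have 1: "w \<ominus>\<^bsub>M\<^esub> y = (w \<ominus>\<^bsub>M\<^esub> x) \<oplus>\<^bsub>M\<^esub> (x \<ominus>\<^bsub>M\<^esub> y)"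
        using w assms by (simp add: a_minus_def M.a_assoc M.r_neg1)
      have 2: "w \<ominus>\<^bsub>M\<^esub> x = (w \<ominus>\<^bsub>M\<^esub> y) \<oplus>\<^bsub>M\<^esub> (y \<ominus>\<^bsub>M\<^esub> x)"
        using w assms by (simp add: a_minus_def M.a_assoc M.r_neg1)
      have "y \<ominus>\<^bsub>M\<^esub> x = \<ominus>\<^bsub>M\<^esub> (x \<ominus>\<^bsub>M\<^esub> y)"
        using assms by (simp add: a_minus_def M.minus_add M.a_comm)
      then have "y \<ominus>\<^bsub>M\<^esub> x \<in> N" using D(5)[OF xy] by simp
      then show ?thesis using 1 2 xy D(3)[of "w \<ominus>\<^bsub>M\<^esub> x" "x \<ominus>\<^bsub>M\<^esub> y"]
          D(3)[of "w \<ominus>\<^bsub>M\<^esub> y" "y \<ominus>\<^bsub>M\<^esub> x"] by auto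
    qed
    then show "N +>\<^bsub>M\<^esub> x = N +>\<^bsub>M\<^esub> y"
      using mem sub assms by blast
  qed
qed

end

context
  fixes R :: "('a, 'r) ring_scheme" and M :: "('a, 'm) module"
  assumes M: "left_module R M"
begin

interpretation left_module R M by (rule M)

lemma quotient_map_hom:
  assumes "submodule N R M"
  shows "(\<lambda>m. N +>\<^bsub>M\<^esub> m) \<in> left_module_hom R M (quotient_module M N)"
    and "(\<lambda>m. N +>\<^bsub>M\<^esub> m) ` carrier M = carrier (quotient_module M N)"
proof -
  note D = submoduleD[OF assms]
  have car: "\<And>n. n \<in> N \<Longrightarrow> n \<in> carrier M" using D by auto
  show "(\<lambda>m. N +>\<^bsub>M\<^esub> m) ` carrier M = carrier (quotient_module M N)"
    by (auto simp: quotient_module_def A_RCOSETS_def')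
  have "abelian_subgroup N M"
    using assms M.abelian_group_axioms
    by (intro abelian_subgroupI3 additive_subgroup.intro) (auto dest: submodule.axioms(1))
  then interpret N: abelian_subgroup N M .
  show "(\<lambda>m. N +>\<^bsub>M\<^esub> m) \<in> left_module_hom R M (quotient_module M N)"
  proof (rule left_module_homI)
    fix r x assume rx: "r \<in> carrier R" "x \<in> carrier M"
    \<comment> \<open>The scalar action is a union over the members of a coset; it is the expected
      coset because all members contribute the same one.\<close>
    have "N +>\<^bsub>M\<^esub> (r \<odot>\<^bsub>M\<^esub> m) = N +>\<^bsub>M\<^esub> (r \<odot>\<^bsub>M\<^esub> x)" if m: "m \<in> N +>\<^bsub>M\<^esub> x" for m
    proof -
      obtain n where n: "n \<in> N" "m = n \<oplus>\<^bsub>M\<^esub> x" using m by (auto simp: a_r_coset_def')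
      then have "r \<odot>\<^bsub>M\<^esub> m \<ominus>\<^bsub>M\<^esub> r \<odot>\<^bsub>M\<^esub> x = r \<odot>\<^bsub>M\<^esub> n"
        using rx car by (simp add: smult_r_distr a_minus_def M.a_assoc M.r_neg)
      then show ?thesis using rx n car D by (subst coset_eq_iff[OF assms]) auto
    qed
    moreover have "x \<in> N +>\<^bsub>M\<^esub> x" using rx D(2) by (force simp: a_r_coset_def')
    ultimately have "(\<Union>m\<in>N +>\<^bsub>M\<^esub> x. N +>\<^bsub>M\<^esub> (r \<odot>\<^bsub>M\<^esub> m)) = N +>\<^bsub>M\<^esub> (r \<odot>\<^bsub>M\<^esub> x)" by blast
    then show "N +>\<^bsub>M\<^esub> (r \<odot>\<^bsub>M\<^esub> x) = r \<odot>\<^bsub>quotient_module M N\<^esub> (N +>\<^bsub>M\<^esub> x)"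
      by (simp add: quotient_module_def)
  qed (auto simp: quotient_module_def A_RCOSETS_def' N.a_rcos_sum)
qed

lemma quotient_module_closed:
  assumes "submodule N R M"
  shows "\<lbrakk>x \<in> carrier (quotient_module M N); y \<in> carrier (quotient_module M N)\<rbrakk> \<Longrightarrow>
      x \<oplus>\<^bsub>quotient_module M N\<^esub> y \<in> carrier (quotient_module M N)"
    and "\<lbrakk>r \<in> carrier R; x \<in> carrier (quotient_module M N)\<rbrakk> \<Longrightarrow>
      r \<odot>\<^bsub>quotient_module M N\<^esub> x \<in> carrier (quotient_module M N)"
proof -
  note P = left_module_homD[OF quotient_map_hom(1)[OF assms]]
  have surj: "\<exists>m \<in> carrier M. S = N +>\<^bsub>M\<^esub> m" if "S \<in> carrier (quotient_module M N)" for S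
    using that quotient_map_hom(2)[OF assms] by auto
  {
    assume "x \<in> carrier (quotient_module M N)" "y \<in> carrier (quotient_module M N)"
    then obtain m m' where "m \<in> carrier M" "x = N +>\<^bsub>M\<^esub> m" "m' \<in> carrier M" "y = N +>\<^bsub>M\<^esub> m'"
      using surj by meson
    then show "x \<oplus>\<^bsub>quotient_module M N\<^esub> y \<in> carrier (quotient_module M N)"
      using P(1)[of "m \<oplus>\<^bsub>M\<^esub> m'"] by (simp add: P(2))
  }
  {
    assume r: "r \<in> carrier R" and "x \<in> carrier (quotient_module M N)"
    then obtain m where "m \<in> carrier M" "x = N +>\<^bsub>M\<^esub> m" using surj by meson
    then show "r \<odot>\<^bsub>quotient_module M N\<^esub> x \<in> carrier (quotient_module M N)"
      using P(1)[of "r \<odot>\<^bsub>M\<^esub> m"] r by (simp add: P(3))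
  }
qed

text \<open>Composing with the coset map turns an isomorphism from the quotient into an epimorphism
  with kernel \<open>N\<close>, and conversely such an epimorphism factors bijectively through the
  cosets. This is the way out of coset types.\<close>

lemma quotient_module_iso_iff:
  assumes N: "submodule N R M" and L: "left_module R L"
  shows "left_module_iso R (quotient_module M N) L \<longleftrightarrow>
    (\<exists>h \<in> left_module_hom R M L. h ` carrier M = carrier L \<and> {m \<in> carrier M. h m = \<zero>\<^bsub>L\<^esub>} = N)"
proof
  let ?Q = "quotient_module M N" and ?\<pi> = "\<lambda>m. N +>\<^bsub>M\<^esub> m"
  interpret L: left_module R L by fact
  note P = quotient_map_hom[OF N]
  note PD = left_module_homD[OF P(1)]
  note D = submoduleD[OF N]
  {
    assume "left_module_iso R ?Q L"
    then obtain g where g: "g \<in> left_module_hom R ?Q L" and b: "bij_betw g (carrier ?Q) (carrier L)"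
      by (auto simp: left_module_iso_def)
    have h: "(\<lambda>m. g (?\<pi> m)) \<in> left_module_hom R M L" by (rule left_module_hom_comp[OF P(1) g])
    have "g ` ?\<pi> ` carrier M = carrier L" using b P(2) by (simp add: bij_betw_def)
    then have "(\<lambda>m. g (?\<pi> m)) ` carrier M = carrier L" by (simp add: image_image)
    moreover have "g (?\<pi> m) = \<zero>\<^bsub>L\<^esub> \<longleftrightarrow> m \<in> N" if m: "m \<in> carrier M" for m
    proof -
      have "g (?\<pi> \<zero>\<^bsub>M\<^esub>) = \<zero>\<^bsub>L\<^esub>" using left_module_hom_zero_minus(1)[OF M L h] .
      then have "g (?\<pi> m) = \<zero>\<^bsub>L\<^esub> \<longleftrightarrow> ?\<pi> m = ?\<pi> \<zero>\<^bsub>M\<^esub>"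
        using inj_on_eq_iff[OF bij_betw_imp_inj_on[OF b] PD(1)[OF m] PD(1)[OF M.zero_closed]] by simp
      also have "\<dots> \<longleftrightarrow> m \<ominus>\<^bsub>M\<^esub> \<zero>\<^bsub>M\<^esub> \<in> N" by (rule coset_eq_iff[OF N m M.zero_closed])
      also have "m \<ominus>\<^bsub>M\<^esub> \<zero>\<^bsub>M\<^esub> = m" using m by (simp add: a_minus_def)
      finally show ?thesis .
    qed
    ultimately show "\<exists>h \<in> left_module_hom R M L.
        h ` carrier M = carrier L \<and> {m \<in> carrier M. h m = \<zero>\<^bsub>L\<^esub>} = N"
      using D(1) by (intro bexI[OF _ h]) auto
  }
  {
    assume "\<exists>h \<in> left_module_hom R M L.
        h ` carrier M = carrier L \<and> {m \<in> carrier M. h m = \<zero>\<^bsub>L\<^esub>} = N"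
    then obtain h where h: "h \<in> left_module_hom R M L" and sur: "h ` carrier M = carrier L"
      and ker: "{m \<in> carrier M. h m = \<zero>\<^bsub>L\<^esub>} = N" by auto
    note H = left_module_homD[OF h]
    have eq: "?\<pi> x = ?\<pi> y \<longleftrightarrow> h x = h y" if xy: "x \<in> carrier M" "y \<in> carrier M" for x y
    proof -
      have "x \<ominus>\<^bsub>M\<^esub> y \<in> N \<longleftrightarrow> h x \<ominus>\<^bsub>L\<^esub> h y = \<zero>\<^bsub>L\<^esub>"
        using M.minus_closed[OF xy] left_module_hom_zero_minus(2)[OF M L h xy] ker by force
      also have "\<dots> \<longleftrightarrow> h x = h y" by (rule L.minus_eq_zero_iff) (use xy H(1) in auto)
      finally have "x \<ominus>\<^bsub>M\<^esub> y \<in> N \<longleftrightarrow> h x = h y" .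
      with coset_eq_iff[OF N xy] show ?thesis by (rule trans)
    qed
    \<comment> \<open>By \<open>eq\<close>, \<open>h\<close> is constant on cosets, so the chosen
      representative does not matter.\<close>
    define g where "g S = h (SOME m. m \<in> carrier M \<and> S = ?\<pi> m)" for S
    have g: "g (?\<pi> m) = h m" if "m \<in> carrier M" for m
    proof -
      have "\<exists>m'. m' \<in> carrier M \<and> ?\<pi> m = ?\<pi> m'" using that by auto
      from someI_ex[OF this] obtain m' where m': "m' = (SOME m'. m' \<in> carrier M \<and> ?\<pi> m = ?\<pi> m')"
        "m' \<in> carrier M" "?\<pi> m = ?\<pi> m'" by blast
      have "g (?\<pi> m) = h m'" unfolding g_def m'(1) ..
      also have "\<dots> = h m" using eq[OF that m'(2)] m'(3) by simp
      finally show ?thesis .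
    qed
    have surj: "\<exists>m \<in> carrier M. S = ?\<pi> m" if "S \<in> carrier ?Q" for S
      using that P(2) by auto
    have "g \<in> left_module_hom R ?Q L"
    proof (rule left_module_homI)
      fix x assume "x \<in> carrier ?Q"
      then obtain m where "m \<in> carrier M" "x = ?\<pi> m" using surj by meson
      then show "g x \<in> carrier L" using g H(1) by simp
    next
      fix x y assume "x \<in> carrier ?Q" "y \<in> carrier ?Q"
      then obtain m m' where m: "m \<in> carrier M" "x = ?\<pi> m" "m' \<in> carrier M" "y = ?\<pi> m'"
        using surj by meson
      then show "g (x \<oplus>\<^bsub>?Q\<^esub> y) = g x \<oplus>\<^bsub>L\<^esub> g y"
        using g[of "m \<oplus>\<^bsub>M\<^esub> m'"] by (simp add: PD(2) g H(2))
    next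
      fix r x assume "r \<in> carrier R" "x \<in> carrier ?Q"
      moreover then obtain m where m: "m \<in> carrier M" "x = ?\<pi> m" using surj by meson
      ultimately show "g (r \<odot>\<^bsub>?Q\<^esub> x) = r \<odot>\<^bsub>L\<^esub> g x"
        using g[of "r \<odot>\<^bsub>M\<^esub> m"] by (simp add: PD(3)[symmetric] g H(3))
    qed
    moreover have "bij_betw g (carrier ?Q) (carrier L)"
    proof (intro bij_betwI')
      fix x y assume "x \<in> carrier ?Q" "y \<in> carrier ?Q"
      then obtain m m' where "m \<in> carrier M" "x = ?\<pi> m" "m' \<in> carrier M" "y = ?\<pi> m'"
        using surj by meson
      then show "(g x = g y) = (x = y)" using g eq by simp
    next
      fix x assume "x \<in> carrier ?Q"
      then obtain m where "m \<in> carrier M" "x = ?\<pi> m" using surj by meson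
      then show "g x \<in> carrier L" using g H(1) by simp
    next
      fix y assume "y \<in> carrier L"
      then obtain m where "m \<in> carrier M" "y = h m" using sur by auto
      then show "\<exists>x\<in>carrier ?Q. y = g x" using g PD(1) by (intro bexI[of _ "?\<pi> m"]) auto
    qed
    ultimately show "left_module_iso R ?Q L" by (auto simp: left_module_iso_def)
  }
qed

end


section \<open>Projective modules and primitive idempotents\<close>

lemma projective_moduleI:
  fixes M :: "('a, 'm) module"
  assumes "left_module R M"
    and "\<And>(N :: ('a, 'm \<Rightarrow> 'a) module) (L :: ('a, 'm) module) g f.
      \<lbrakk>left_module R N; left_module R L; g \<in> left_module_hom R N L; f \<in> left_module_hom R M L;
       g ` carrier N = carrier L\<rbrakk> \<Longrightarrow> \<exists>h \<in> left_module_hom R M N. \<forall>x\<in>carrier M. g (h x) = f x"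
  shows "projective_module R M"
  unfolding projective_module_def by (intro conjI allI ballI impI assms)

text \<open>Lift \<open>f r\<close> along \<open>g\<close> to \<open>h\<close>; then
  \<open>h i\<close> lifts \<open>f\<close>. The carriers of the two modules may have different
  types, hence the appeal to \<open>projective_module_lift\<close>.\<close>

lemma projective_retract:
  fixes M' :: "('a, 'n) module" and M :: "('a, 'm) module"
  assumes M: "projective_module R M" and M': "left_module R M'"
    and i: "i \<in> left_module_hom R M' M" and r: "r \<in> left_module_hom R M M'"
    and ri: "\<And>x. x \<in> carrier M' \<Longrightarrow> r (i x) = x"
  shows "projective_module R M'"
proof (rule projective_moduleI[OF M'])
  fix N :: "('a, 'n \<Rightarrow> 'a) module" and L :: "('a, 'n) module" and g f
  assume *: "left_module R N" "left_module R L" "g \<in> left_module_hom R N L"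
    "f \<in> left_module_hom R M' L" "g ` carrier N = carrier L"
  from projective_module_lift[OF M *(1-3) left_module_hom_comp[OF r *(4)] *(5)]
  obtain h where h: "h \<in> left_module_hom R M N" "\<And>x. x \<in> carrier M \<Longrightarrow> g (h x) = f (r x)" by blast
  show "\<exists>h \<in> left_module_hom R M' N. \<forall>x\<in>carrier M'. g (h x) = f x"
    using left_module_hom_comp[OF i h(1)] h(2) left_module_homD(1)[OF i] ri by (intro bexI) auto
qed

text \<open>A section \<open>s\<close> of \<open>\<psi>\<close> splits each \<open>m\<close> as
  \<open>p m + s (\<psi> m)\<close> with \<open>p m\<close> in \<open>N\<close>. Lifting
  \<open>f\<close> on \<open>N\<close> and \<open>f s\<close> on \<open>L\<close> separately and
  adding the results gives a lift on \<open>M\<close>.\<close>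

lemma projective_extension:
  fixes M :: "('a, 'm) module" and L :: "('a, 'l) module"
  assumes M: "left_module R M" and L: "projective_module R L"
    and N: "submodule N R M" and projN: "projective_module R (M\<lparr>carrier := N\<rparr>)"
    and \<psi>: "\<psi> \<in> left_module_hom R M L" and surj: "\<psi> ` carrier M = carrier L"
    and ker: "{m \<in> carrier M. \<psi> m = \<zero>\<^bsub>L\<^esub>} = N"
  shows "projective_module R M"
proof (rule projective_moduleI[OF M])
  fix Q :: "('a, 'm \<Rightarrow> 'a) module" and S :: "('a, 'm) module" and g f
  assume *: "left_module R Q" "left_module R S" "g \<in> left_module_hom R Q S"
    "f \<in> left_module_hom R M S" "g ` carrier Q = carrier S"
  interpret M: left_module R M by fact
  have L': "left_module R L" using L by (simp add: projective_module_def)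
  interpret L: left_module R L by fact
  interpret Q: left_module R Q by fact
  interpret S: left_module R S by fact
  note \<psi>D = left_module_homD[OF \<psi>]
  note fD = left_module_homD[OF *(4)]
  note gD = left_module_homD[OF *(3)]
  have "(\<lambda>x. x) \<in> left_module_hom R L L" by (rule left_module_homI) auto
  from projective_module_lift[OF L M L' \<psi> this surj]
  obtain s where s: "s \<in> left_module_hom R L M" and \<psi>s: "\<And>x. x \<in> carrier L \<Longrightarrow> \<psi> (s x) = x" by blast
  note sD = left_module_homD[OF s]
  have NM: "(\<lambda>x. x) \<in> left_module_hom R (M\<lparr>carrier := N\<rparr>) M"
    using M.submoduleD(1)[OF N] by (intro left_module_homI) auto
  from projective_module_lift[OF projN *(1-3) left_module_hom_comp[OF NM *(4)] *(5)]
  obtain h1 where h1: "h1 \<in> left_module_hom R (M\<lparr>carrier := N\<rparr>) Q" and gh1: "\<And>x. x \<in> N \<Longrightarrow> g (h1 x) = f x"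
    by auto
  from projective_module_lift[OF L *(1-3) left_module_hom_comp[OF s *(4)] *(5)]
  obtain h2 where h2: "h2 \<in> left_module_hom R L Q" and gh2: "\<And>x. x \<in> carrier L \<Longrightarrow> g (h2 x) = f (s x)"
    by auto
  note h1D = left_module_homD[OF h1, simplified]
  note h2D = left_module_homD[OF h2]
  define p where "p m = m \<ominus>\<^bsub>M\<^esub> s (\<psi> m)" for m
  have pN: "p m \<in> N" if "m \<in> carrier M" for m
  proof -
    have "\<psi> (p m) = \<psi> m \<ominus>\<^bsub>L\<^esub> \<psi> (s (\<psi> m))"
      unfolding p_def using that by (intro left_module_hom_zero_minus[OF M L' \<psi>]) (auto simp: \<psi>D sD)
    also have "\<dots> = \<zero>\<^bsub>L\<^esub>" using that by (simp add: \<psi>s \<psi>D L.minus_eq_zero_iff)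
    finally have "\<psi> (p m) = \<zero>\<^bsub>L\<^esub>" .
    moreover have "p m \<in> carrier M" unfolding p_def using that by (simp add: sD \<psi>D)
    ultimately show ?thesis using ker by auto
  qed
  have p_add: "p (x \<oplus>\<^bsub>M\<^esub> y) = p x \<oplus>\<^bsub>M\<^esub> p y" if "x \<in> carrier M" "y \<in> carrier M" for x y
    using that unfolding p_def by (simp add: \<psi>D sD a_minus_def M.M.minus_add M.M.a_ac)
  have p_smult: "p (r \<odot>\<^bsub>M\<^esub> x) = r \<odot>\<^bsub>M\<^esub> p x" if "r \<in> carrier R" "x \<in> carrier M" for r x
  proof -
    have h: "r \<odot>\<^bsub>M\<^esub> a \<ominus>\<^bsub>M\<^esub> r \<odot>\<^bsub>M\<^esub> b = r \<odot>\<^bsub>M\<^esub> (a \<ominus>\<^bsub>M\<^esub> b)"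
      if "a \<in> carrier M" "b \<in> carrier M" for a b
    proof -
      have "r \<odot>\<^bsub>M\<^esub> (a \<ominus>\<^bsub>M\<^esub> b) \<oplus>\<^bsub>M\<^esub> r \<odot>\<^bsub>M\<^esub> b = r \<odot>\<^bsub>M\<^esub> a"
        using that \<open>r \<in> carrier R\<close>
        by (simp add: M.smult_r_distr[symmetric] a_minus_def M.M.a_assoc M.M.l_neg)
      then have "r \<odot>\<^bsub>M\<^esub> a \<ominus>\<^bsub>M\<^esub> r \<odot>\<^bsub>M\<^esub> b = r \<odot>\<^bsub>M\<^esub> (a \<ominus>\<^bsub>M\<^esub> b) \<oplus>\<^bsub>M\<^esub> r \<odot>\<^bsub>M\<^esub> b \<ominus>\<^bsub>M\<^esub> r \<odot>\<^bsub>M\<^esub> b"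
        by simp
      then show ?thesis using that \<open>r \<in> carrier R\<close> by (simp add: a_minus_def M.M.a_assoc M.M.r_neg)
    qed
    show ?thesis using that h[of x "s (\<psi> x)"] by (simp add: p_def \<psi>D sD)
  qed
  let ?h = "\<lambda>m. h1 (p m) \<oplus>\<^bsub>Q\<^esub> h2 (\<psi> m)"
  have "?h \<in> left_module_hom R M Q"
    by (rule left_module_homI)
       (simp_all add: p_add p_smult pN h1D h2D \<psi>D Q.M.a_ac Q.smult_r_distr)
  moreover have "g (?h m) = f m" if m: "m \<in> carrier M" for m
  proof -
    have "g (?h m) = f (p m) \<oplus>\<^bsub>S\<^esub> f (s (\<psi> m))" using m by (simp add: gD h1D h2D pN \<psi>D gh1 gh2)
    also have "\<dots> = f (p m \<oplus>\<^bsub>M\<^esub> s (\<psi> m))"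
      using m pN[OF m] M.submoduleD(1)[OF N] by (subst fD(2)) (auto simp: \<psi>D sD)
    also have "p m \<oplus>\<^bsub>M\<^esub> s (\<psi> m) = m" using m by (simp add: p_def \<psi>D sD a_minus_def M.M.a_assoc M.M.l_neg)
    finally show ?thesis .
  qed
  ultimately show "\<exists>h \<in> left_module_hom R M Q. \<forall>x\<in>carrier M. g (h x) = f x"
    by (intro bexI[of _ ?h]) auto
qed

section \<open>Left ideals \<open>R e\<close> and primitive idempotents\<close>

definition idem_left_ideal :: "('a, 'r) ring_scheme \<Rightarrow> 'a \<Rightarrow> ('a, 'a) module" where
  "idem_left_ideal R e = \<lparr>carrier = (\<lambda>r. r \<otimes>\<^bsub>R\<^esub> e) ` carrier R, monoid.mult = undefined, one = undefined,
     zero = \<zero>\<^bsub>R\<^esub>, add = add R, smult = monoid.mult R\<rparr>"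

lemma idem_left_ideal_simps [simp]:
  "zero (idem_left_ideal R e) = zero R" "add (idem_left_ideal R e) = add R"
  "smult (idem_left_ideal R e) = monoid.mult R"
  by (simp_all add: idem_left_ideal_def)

context ring
begin

lemma idem_left_ideal_carrier:
  assumes "ring_idempotent R e"
  shows "carrier (idem_left_ideal R e) = {r \<in> carrier R. r \<otimes> e = r}"
proof -
  have "e \<in> carrier R" "e \<otimes> e = e" using assms by (simp_all add: ring_idempotent_def)
  then show ?thesis
    by (auto simp: idem_left_ideal_def m_assoc intro: image_eqI[OF sym])
qed

lemma idem_left_ideal_is_left_module:
  assumes e: "ring_idempotent R e" shows "left_module R (idem_left_ideal R e)"
proof -
  have e': "e \<in> carrier R" using e by (simp add: ring_idempotent_def)
  have "abelian_group (idem_left_ideal R e)"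
  proof (rule abelian_groupI)
    fix x assume "x \<in> carrier (idem_left_ideal R e)"
    then show "\<exists>y\<in>carrier (idem_left_ideal R e). y \<oplus>\<^bsub>idem_left_ideal R e\<^esub> x = \<zero>\<^bsub>idem_left_ideal R e\<^esub>"
      using e' by (intro bexI[of _ "\<ominus> x"]) (auto simp: idem_left_ideal_carrier[OF e] l_minus l_neg)
  qed (use e' in \<open>auto simp: idem_left_ideal_carrier[OF e] l_distr a_ac\<close>)
  then show ?thesis using e'
    by (intro left_module.intro left_module_axioms.intro ring_axioms)
       (auto simp: idem_left_ideal_carrier[OF e] l_distr r_distr m_assoc)
qed

text \<open>A homomorphism out of \<open>R e\<close> is determined by the image of \<open>e\<close>, which can be lifted freely.\<close>

lemma idem_left_ideal_projective:
  assumes e: "ring_idempotent R e" shows "projective_module R (idem_left_ideal R e)"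
proof (rule projective_moduleI[OF idem_left_ideal_is_left_module[OF e]])
  fix N :: "('a, 'a \<Rightarrow> 'a) module" and L :: "('a, 'a) module" and g f
  assume *: "left_module R N" "left_module R L" "g \<in> left_module_hom R N L"
    "f \<in> left_module_hom R (idem_left_ideal R e) L" "g ` carrier N = carrier L"
  interpret N: left_module R N by fact
  have e': "e \<in> carrier R" "e \<otimes> e = e" using e by (simp_all add: ring_idempotent_def)
  note gD = left_module_homD[OF *(3)]
  note fD = left_module_homD[OF *(4)]
  have eI: "e \<in> carrier (idem_left_ideal R e)" using e' by (simp add: idem_left_ideal_carrier[OF e])
  then have "f e \<in> g ` carrier N" using fD(1) *(5) by simp
  then obtain x where x: "x \<in> carrier N" "g x = f e" by auto
  have "(\<lambda>r. r \<odot>\<^bsub>N\<^esub> x) \<in> left_module_hom R (idem_left_ideal R e) N"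
    by (rule left_module_homI) (use x in \<open>auto simp: idem_left_ideal_carrier[OF e] N.smult_l_distr N.smult_assoc\<close>)
  moreover have "g (r \<odot>\<^bsub>N\<^esub> x) = f r" if "r \<in> carrier (idem_left_ideal R e)" for r
    using that x fD(3)[of r e] eI by (simp add: idem_left_ideal_carrier[OF e] gD)
  ultimately show "\<exists>h \<in> left_module_hom R (idem_left_ideal R e) N.
      \<forall>x\<in>carrier (idem_left_ideal R e). g (h x) = f x"
    by (intro bexI[of _ "\<lambda>r. r \<odot>\<^bsub>N\<^esub> x"]) auto
qed

text \<open>The common value \<open>v \<otimes> x = x \<otimes> w\<close> is a nonzero idempotent below \<open>e\<close>.\<close>

lemma primitive_idempotent_strongly_regular:
  assumes e: "primitive_idempotent R e" and c: "x \<in> carrier R" "v \<in> carrier R" "w \<in> carrier R"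
    and ex: "e \<otimes> x = x" "x \<otimes> e = x" and nz: "x \<noteq> \<zero>"
    and v: "v \<otimes> (x \<otimes> x) = x" and w: "x \<otimes> x \<otimes> w = x"
  shows "v \<otimes> x = e"
proof -
  have e': "e \<in> carrier R" "e \<otimes> e = e" using e by (simp_all add: primitive_idempotent_def ring_idempotent_def)
  define g where "g = v \<otimes> x"
  have gc: "g \<in> carrier R" using c by (simp add: g_def)
  have gw: "g = x \<otimes> w"
  proof -
    have "g = v \<otimes> (x \<otimes> x \<otimes> w)" by (simp add: w g_def)
    also have "\<dots> = (v \<otimes> (x \<otimes> x)) \<otimes> w" using c by (simp add: m_assoc)
    finally show ?thesis by (simp add: v)
  qed
  have gx: "g \<otimes> x = x" using c v by (simp add: g_def m_assoc)
  have gg: "g \<otimes> g = g"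
  proof -
    have "g \<otimes> g = g \<otimes> x \<otimes> w" using gw gc c by (simp add: m_assoc)
    then show ?thesis by (simp add: gx gw[symmetric])
  qed
  have eg: "e \<otimes> g = g" using e' c ex by (simp add: gw m_assoc[symmetric])
  have ge: "g \<otimes> e = g" using e' c ex by (simp add: g_def m_assoc)
  \<comment> \<open>\<open>g\<close> and \<open>k\<close> are orthogonal idempotents with sum
    \<open>e\<close>. Primitivity forces one of them to vanish, and it is not \<open>g\<close>,
    since \<open>g x = x\<close> is nonzero.\<close>
  define k where "k = e \<ominus> g"
  have kc: "k \<in> carrier R" using e' gc by (simp add: k_def)
  have gk: "g \<otimes> k = \<zero>" "k \<otimes> g = \<zero>"
    using e' gc by (simp_all add: k_def a_minus_def r_distr l_distr r_minus l_minus gg eg ge r_neg)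
  have kk: "k \<otimes> k = k"
  proof -
    have "k \<otimes> k = e \<otimes> k \<ominus> g \<otimes> k" using e' gc kc by (simp add: k_def a_minus_def l_distr l_minus)
    also have "\<dots> = e \<otimes> k" using gk e' kc by (simp add: a_minus_def)
    also have "\<dots> = k" using e' gc by (simp add: k_def a_minus_def r_distr r_minus eg)
    finally show ?thesis .
  qed
  have "e = g \<oplus> k" using e' gc by (simp add: k_def a_minus_def a_lcomm r_neg)
  moreover have "g \<noteq> \<zero>" using gx nz c by auto
  ultimately have "k = \<zero>"
    using e gc kc gg kk gk unfolding primitive_idempotent_def ring_idempotent_def orthogonal_def by blast
  then have "e = g" using e' gc by (simp add: k_def)
  then show ?thesis by (simp add: g_def)
qed

end

section \<open>Stationary chains and the Fitting argument\<close>

lemma decreasing_chain_stable: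
  fixes d :: "'a set \<Rightarrow> nat" and S :: "nat \<Rightarrow> 'a set"
  assumes "\<And>n. S (Suc n) \<subseteq> S n" and "\<And>n. S (Suc n) \<subset> S n \<Longrightarrow> d (S (Suc n)) < d (S n)"
  shows "\<exists>N. \<forall>n\<ge>N. S n = S N"
proof -
  \<comment> \<open>\<open>S N\<close> has least measure among all members, so no later step can be
    strict.\<close>
  obtain N where N: "\<And>n. d (S N) \<le> d (S n)"
    using ex_has_least_nat[of "\<lambda>_. True" 0 "\<lambda>n. d (S n)"] by auto
  have "S n = S N" if "n \<ge> N" for n using that
  proof (induction n rule: dec_induct)
    case (step n)
    then have "\<not> d (S (Suc n)) < d (S n)" using N[of "Suc n"] by simp
    then show ?case using assms step by blast
  qed simp
  then show ?thesis by blast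
qed

text \<open>The chains \<open>R u^n\<close> and \<open>u^n R\<close> become stationary, so a high
  power \<open>x\<close> of \<open>u\<close> lies in both \<open>R x^2\<close> and
  \<open>x^2 R\<close>. Then \<open>primitive_idempotent_strongly_regular\<close> gives
  \<open>v x = e\<close>, and splitting off the last factor \<open>u\<close> of \<open>x\<close>
  yields the left inverse. Finite dimension enters through the measure \<open>d\<close>.\<close>

lemma (in ring) primitive_idempotent_left_inverse:
  fixes d :: "'a set \<Rightarrow> nat"
  assumes e: "primitive_idempotent R e" and u: "u \<in> carrier R" "e \<otimes> u = u" "u \<otimes> e = u"
    and nil: "\<And>n::nat. u [^] n \<noteq> \<zero>"
    and dl: "\<And>a b. \<lbrakk>a \<in> carrier R; b \<in> carrier R; (\<lambda>r. r \<otimes> a) ` carrier R \<subset> (\<lambda>r. r \<otimes> b) ` carrier R\<rbrakk>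
      \<Longrightarrow> d ((\<lambda>r. r \<otimes> a) ` carrier R) < d ((\<lambda>r. r \<otimes> b) ` carrier R)"
    and dr: "\<And>a b. \<lbrakk>a \<in> carrier R; b \<in> carrier R; (\<lambda>r. a \<otimes> r) ` carrier R \<subset> (\<lambda>r. b \<otimes> r) ` carrier R\<rbrakk>
      \<Longrightarrow> d ((\<lambda>r. a \<otimes> r) ` carrier R) < d ((\<lambda>r. b \<otimes> r) ` carrier R)"
  shows "\<exists>t\<in>carrier R. t \<otimes> u = e"
proof -
  define SL where "SL n = (\<lambda>r. r \<otimes> u [^] n) ` carrier R" for n :: nat
  define SR where "SR n = (\<lambda>r. u [^] n \<otimes> r) ` carrier R" for n :: nat
  have uc: "u [^] n \<in> carrier R" for n :: nat using u by simp
  have L1: "SL (Suc n) \<subseteq> SL n" for n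
  proof
    fix x assume "x \<in> SL (Suc n)"
    then obtain r where r: "r \<in> carrier R" "x = r \<otimes> u [^] Suc n" by (auto simp: SL_def)
    then have "x = (r \<otimes> u) \<otimes> u [^] n" using u nat_pow_Suc2[OF u(1), of n] by (simp add: m_assoc)
    then show "x \<in> SL n" using r u by (auto simp: SL_def)
  qed
  have R1: "SR (Suc n) \<subseteq> SR n" for n
  proof
    fix x assume "x \<in> SR (Suc n)"
    then obtain r where r: "r \<in> carrier R" "x = u [^] Suc n \<otimes> r" by (auto simp: SR_def)
    then have "x = u [^] n \<otimes> (u \<otimes> r)" using u by (simp add: m_assoc)
    then show "x \<in> SR n" using r u by (auto simp: SR_def)
  qed
  have L2: "d (SL (Suc n)) < d (SL n)" if "SL (Suc n) \<subset> SL n" for n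
    using dl[OF uc uc] that unfolding SL_def by blast
  have R2: "d (SR (Suc n)) < d (SR n)" if "SR (Suc n) \<subset> SR n" for n
    using dr[OF uc uc] that unfolding SR_def by blast
  obtain N where N: "\<forall>n\<ge>N. SL n = SL N" using decreasing_chain_stable[of SL, OF L1 L2] by blast
  obtain N' where N': "\<forall>n\<ge>N'. SR n = SR N'" using decreasing_chain_stable[of SR, OF R1 R2] by blast
  \<comment> \<open>\<open>N + N'\<close> lies beyond both stationary points, so the exponents
    \<open>k + 1\<close> and \<open>2 (k + 1)\<close> give the same ideals. The successor guarantees
    that \<open>x\<close> contains a factor \<open>u\<close>.\<close>
  define k where "k = N + N'"
  define x where "x = u [^] Suc k"
  have xc: "x \<in> carrier R" using u by (simp add: x_def)
  have xx: "u [^] (Suc k + Suc k) = x \<otimes> x" unfolding x_def by (rule nat_pow_mult[OF u(1), symmetric])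
  have "SL (Suc k) = SL (Suc k + Suc k)"
    using N[rule_format, of "Suc k"] N[rule_format, of "Suc k + Suc k"] by (simp add: k_def)
  moreover have "SR (Suc k) = SR (Suc k + Suc k)"
    using N'[rule_format, of "Suc k"] N'[rule_format, of "Suc k + Suc k"] by (simp add: k_def)
  moreover have "x \<in> SL (Suc k)" unfolding SL_def x_def[symmetric] using xc by (intro image_eqI[of _ _ \<one>]) auto
  moreover have "x \<in> SR (Suc k)" unfolding SR_def x_def[symmetric] using xc by (intro image_eqI[of _ _ \<one>]) auto
  ultimately have "x \<in> SL (Suc k + Suc k)" "x \<in> SR (Suc k + Suc k)" by simp_all
  then obtain v w where v: "v \<in> carrier R" "v \<otimes> (x \<otimes> x) = x" and w: "w \<in> carrier R" "x \<otimes> x \<otimes> w = x"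
    unfolding SL_def SR_def xx by (metis (no_types, lifting) imageE)
  have e': "e \<in> carrier R" using e by (simp add: primitive_idempotent_def ring_idempotent_def)
  have "x = u \<otimes> u [^] k" unfolding x_def using nat_pow_Suc2[OF u(1)] by blast
  then have ex: "e \<otimes> x = x" using u e' by (simp add: m_assoc[symmetric])
  have x': "x = u [^] k \<otimes> u" unfolding x_def by simp
  then have xe: "x \<otimes> e = x" using u e' by (simp add: m_assoc)
  have "x \<noteq> \<zero>" unfolding x_def by (rule nil)
  then have "v \<otimes> x = e"
    by (intro primitive_idempotent_strongly_regular[OF e xc v(1) w(1) ex xe _ v(2) w(2)])
  then have "(v \<otimes> u [^] k) \<otimes> u = e" using x' u v by (simp add: m_assoc)
  then show ?thesis using u v by (intro bexI[of _ "v \<otimes> u [^] k"]) auto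
qed


section \<open>Finite-dimensional projective modules\<close>

text \<open>The flag adjoins one vector at a time, so that a measure can be built by induction on
  its steps. A vector may already lie in \<open>S\<close>, and then the step adds nothing.\<close>

inductive spanned_subspace :: "('k, 'r) ring_scheme \<Rightarrow> ('k, 'm) module \<Rightarrow> 'm set \<Rightarrow> bool"
  for K V where
  zero: "spanned_subspace K V {\<zero>\<^bsub>V\<^esub>}"
| extend: "\<lbrakk>spanned_subspace K V S; b \<in> carrier V\<rbrakk> \<Longrightarrow>
    spanned_subspace K V {c \<odot>\<^bsub>V\<^esub> b \<oplus>\<^bsub>V\<^esub> s | c s. c \<in> carrier K \<and> s \<in> S}"

lemma module_is_left_module:
  assumes "module K V" shows "left_module K V"
proof -
  interpret module K V by fact
  show ?thesis
    by (intro left_module.intro left_module_axioms.intro ring_axioms M.abelian_group_axioms)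
       (simp_all add: smult_l_distr smult_r_distr smult_assoc1)
qed

lemma spanned_subspace_submodule:
  assumes V: "module K V" and "spanned_subspace K V S"
  shows "submodule S K V"
  using assms(2)
proof induction
  interpret V: module K V by fact
  interpret L: left_module K V by (rule module_is_left_module[OF V])
  {
    case zero
    show ?case by (rule L.submoduleI) auto
  next
    case (extend S b)
    note D = L.submoduleD[OF extend.IH]
    show ?case
    proof (rule L.submoduleI)
      show "{c \<odot>\<^bsub>V\<^esub> b \<oplus>\<^bsub>V\<^esub> s | c s. c \<in> carrier K \<and> s \<in> S} \<subseteq> carrier V"
        using D extend by auto
      show "\<zero>\<^bsub>V\<^esub> \<in> {c \<odot>\<^bsub>V\<^esub> b \<oplus>\<^bsub>V\<^esub> s | c s. c \<in> carrier K \<and> s \<in> S}"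
        using D extend by (intro CollectI exI[of _ "\<zero>\<^bsub>K\<^esub>"] exI[of _ "\<zero>\<^bsub>V\<^esub>"]) auto
    next
      fix x y
      assume "x \<in> {c \<odot>\<^bsub>V\<^esub> b \<oplus>\<^bsub>V\<^esub> s | c s. c \<in> carrier K \<and> s \<in> S}"
        "y \<in> {c \<odot>\<^bsub>V\<^esub> b \<oplus>\<^bsub>V\<^esub> s | c s. c \<in> carrier K \<and> s \<in> S}"
      then obtain c s c' s' where *: "c \<in> carrier K" "s \<in> S" "c' \<in> carrier K" "s' \<in> S"
        "x = c \<odot>\<^bsub>V\<^esub> b \<oplus>\<^bsub>V\<^esub> s" "y = c' \<odot>\<^bsub>V\<^esub> b \<oplus>\<^bsub>V\<^esub> s'" by auto
      then have "s \<in> carrier V" "s' \<in> carrier V" using D(1) by auto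
      then have "x \<oplus>\<^bsub>V\<^esub> y = (c \<oplus>\<^bsub>K\<^esub> c') \<odot>\<^bsub>V\<^esub> b \<oplus>\<^bsub>V\<^esub> (s \<oplus>\<^bsub>V\<^esub> s')"
        using * extend by (simp add: L.smult_l_distr V.M.a_ac)
      then show "x \<oplus>\<^bsub>V\<^esub> y \<in> {c \<odot>\<^bsub>V\<^esub> b \<oplus>\<^bsub>V\<^esub> s | c s. c \<in> carrier K \<and> s \<in> S}"
        using * D(3) by auto
    next
      fix a x
      assume a: "a \<in> carrier K" and "x \<in> {c \<odot>\<^bsub>V\<^esub> b \<oplus>\<^bsub>V\<^esub> s | c s. c \<in> carrier K \<and> s \<in> S}"
      then obtain c s where *: "c \<in> carrier K" "s \<in> S" "x = c \<odot>\<^bsub>V\<^esub> b \<oplus>\<^bsub>V\<^esub> s" by auto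
      then have "s \<in> carrier V" using D(1) by auto
      then have "a \<odot>\<^bsub>V\<^esub> x = (a \<otimes>\<^bsub>K\<^esub> c) \<odot>\<^bsub>V\<^esub> b \<oplus>\<^bsub>V\<^esub> a \<odot>\<^bsub>V\<^esub> s"
        using * a extend by (simp add: L.smult_r_distr L.smult_assoc)
      then show "a \<odot>\<^bsub>V\<^esub> x \<in> {c \<odot>\<^bsub>V\<^esub> b \<oplus>\<^bsub>V\<^esub> s | c s. c \<in> carrier K \<and> s \<in> S}"
        using * D(4) a by auto
    qed
  }
qed

text \<open>The measure of \<open>W\<close> counts the steps of a flag of spanned subspaces at which the intersection
  with \<open>W\<close> grows.\<close>

lemma spanned_subspace_measure:
  fixes V :: "('k, 'm) module"
  assumes K: "field K" and V: "module K V" and S: "spanned_subspace K V S"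
  shows "\<exists>d :: 'm set \<Rightarrow> nat. \<forall>U W. submodule U K V \<longrightarrow> submodule W K V \<longrightarrow> U \<subseteq> W \<longrightarrow>
    d U \<le> d W \<and> (d U = d W \<longrightarrow> W \<inter> S \<subseteq> U)"
  using S
proof induction
  interpret K: field K by fact
  interpret V: module K V by fact
  interpret L: left_module K V by (rule module_is_left_module[OF V])
  {
    case zero
    show ?case using L.submoduleD(2) by (intro exI[of _ "\<lambda>_. 0"]) auto
  next
    case (extend S b)
    obtain d :: "'m set \<Rightarrow> nat" where
      "\<forall>U W. submodule U K V \<longrightarrow> submodule W K V \<longrightarrow> U \<subseteq> W \<longrightarrow> d U \<le> d W \<and> (d U = d W \<longrightarrow> W \<inter> S \<subseteq> U)"
      using extend.IH by blast
    then have d: "d U \<le> d W" "d U = d W \<Longrightarrow> W \<inter> S \<subseteq> U"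
      if "submodule U K V" "submodule W K V" "U \<subseteq> W" for U W using that by blast+
    note SD = L.submoduleD[OF spanned_subspace_submodule[OF V extend.hyps(1)]]
    define T where "T = {c \<odot>\<^bsub>V\<^esub> b \<oplus>\<^bsub>V\<^esub> s | c s. c \<in> carrier K \<and> s \<in> S}"
    \<comment> \<open>\<open>J W\<close> asks whether \<open>W\<close> meets the part of
      \<open>T\<close> that this step adds; if so, it contributes one to the new measure.\<close>
    define J where "J W \<longleftrightarrow> \<not> W \<inter> T \<subseteq> S" for W
    define d' where "d' W = d W + (if J W then 1 else 0)" for W
    have "d' U \<le> d' W \<and> (d' U = d' W \<longrightarrow> W \<inter> T \<subseteq> U)"
      if U: "submodule U K V" and W: "submodule W K V" and UW: "U \<subseteq> W" for U W
    proof -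
      note UD = L.submoduleD[OF U] and WD = L.submoduleD[OF W]
      have J: "J U \<Longrightarrow> J W" using UW by (auto simp: J_def)
      have le: "d U \<le> d W" using d(1) U W UW .
      have "w \<in> U" if eq: "d' U = d' W" and w: "w \<in> W" "w \<in> T" for w
      proof -
        have dd: "d U = d W" and JJ: "J W \<Longrightarrow> J U" using eq le J by (auto simp: d'_def split: if_splits)
        note WS = d(2)[OF U W UW dd]
        show ?thesis
        proof (cases "w \<in> S")
          case True then show ?thesis using WS w by auto
        next
          case False
          then have "J W" using w by (auto simp: J_def)
          then obtain u where u: "u \<in> U" "u \<in> T" "u \<notin> S" using JJ by (auto simp: J_def)
          obtain c s where cs: "c \<in> carrier K" "s \<in> S" "w = c \<odot>\<^bsub>V\<^esub> b \<oplus>\<^bsub>V\<^esub> s" using w by (auto simp: T_def)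
          obtain c' s' where cs': "c' \<in> carrier K" "s' \<in> S" "u = c' \<odot>\<^bsub>V\<^esub> b \<oplus>\<^bsub>V\<^esub> s'"
            using u by (auto simp: T_def)
          have sc: "s \<in> carrier V" "s' \<in> carrier V" using cs cs' SD(1) by auto
          have "c' \<noteq> \<zero>\<^bsub>K\<^esub>" using u cs' sc extend.hyps by auto
          then have inv: "inv\<^bsub>K\<^esub> c' \<in> carrier K" "inv\<^bsub>K\<^esub> c' \<otimes>\<^bsub>K\<^esub> c' = \<one>\<^bsub>K\<^esub>"
            using cs' K.field_Units by auto
          \<comment> \<open>Since \<open>u\<close> is in \<open>T\<close> but not in
            \<open>S\<close>, its \<open>b\<close>-coefficient \<open>c'\<close> is invertible. The
            multiple \<open>a u\<close> matches the \<open>b\<close>-coefficient of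
            \<open>w\<close>, so \<open>w - a u\<close> lies in \<open>W\<close> and in
            \<open>S\<close>, hence in \<open>U\<close>.\<close>
          define a where "a = c \<otimes>\<^bsub>K\<^esub> inv\<^bsub>K\<^esub> c'"
          have a: "a \<in> carrier K" "a \<otimes>\<^bsub>K\<^esub> c' = c"
            using inv cs cs' by (auto simp: a_def K.m_assoc)
          have "a \<odot>\<^bsub>V\<^esub> u = c \<odot>\<^bsub>V\<^esub> b \<oplus>\<^bsub>V\<^esub> a \<odot>\<^bsub>V\<^esub> s'"
            using a cs' sc extend.hyps by (simp add: L.smult_r_distr L.smult_assoc[symmetric])
          then have "w \<ominus>\<^bsub>V\<^esub> a \<odot>\<^bsub>V\<^esub> u = (c \<odot>\<^bsub>V\<^esub> b \<oplus>\<^bsub>V\<^esub> s) \<ominus>\<^bsub>V\<^esub> (c \<odot>\<^bsub>V\<^esub> b \<oplus>\<^bsub>V\<^esub> a \<odot>\<^bsub>V\<^esub> s')"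
            using cs by simp
          also have "\<dots> = s \<ominus>\<^bsub>V\<^esub> a \<odot>\<^bsub>V\<^esub> s'"
          proof -
            have "p \<oplus>\<^bsub>V\<^esub> q \<ominus>\<^bsub>V\<^esub> (p \<oplus>\<^bsub>V\<^esub> r) = q \<ominus>\<^bsub>V\<^esub> r"
              if "p \<in> carrier V" "q \<in> carrier V" "r \<in> carrier V" for p q r
            proof -
              have "p \<oplus>\<^bsub>V\<^esub> q \<ominus>\<^bsub>V\<^esub> (p \<oplus>\<^bsub>V\<^esub> r) = (q \<oplus>\<^bsub>V\<^esub> p) \<oplus>\<^bsub>V\<^esub> (\<ominus>\<^bsub>V\<^esub> p \<oplus>\<^bsub>V\<^esub> \<ominus>\<^bsub>V\<^esub> r)"
                using that by (simp add: a_minus_def V.M.minus_add V.M.a_comm[of p q])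
              also have "\<dots> = q \<oplus>\<^bsub>V\<^esub> \<ominus>\<^bsub>V\<^esub> r" using that by (simp add: V.M.a_assoc V.M.r_neg2)
              finally show ?thesis by (simp add: a_minus_def)
            qed
            then show ?thesis using cs a sc extend.hyps by simp
          qed
          finally have eq': "w \<ominus>\<^bsub>V\<^esub> a \<odot>\<^bsub>V\<^esub> u = s \<ominus>\<^bsub>V\<^esub> a \<odot>\<^bsub>V\<^esub> s'" .
          have uU: "a \<odot>\<^bsub>V\<^esub> u \<in> U" using UD(4) a u by simp
          have "w \<ominus>\<^bsub>V\<^esub> a \<odot>\<^bsub>V\<^esub> u \<in> W" using WD(6) w uU UW by blast
          moreover have "w \<ominus>\<^bsub>V\<^esub> a \<odot>\<^bsub>V\<^esub> u \<in> S" unfolding eq' using SD(4,6) a cs cs' by simp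
          ultimately have "w \<ominus>\<^bsub>V\<^esub> a \<odot>\<^bsub>V\<^esub> u \<in> U" using WS by auto
          then have "(w \<ominus>\<^bsub>V\<^esub> a \<odot>\<^bsub>V\<^esub> u) \<oplus>\<^bsub>V\<^esub> a \<odot>\<^bsub>V\<^esub> u \<in> U" using UD(3) uU by simp
          moreover have "w \<in> carrier V" "a \<odot>\<^bsub>V\<^esub> u \<in> carrier V" using WD(1) UD(1) w uU by auto
          ultimately show ?thesis by (simp add: a_minus_def V.M.a_assoc V.M.l_neg)
        qed
      qed
      moreover have "d' U \<le> d' W" using J le by (auto simp: d'_def)
      ultimately show ?thesis by blast
    qed
    then show ?case unfolding T_def by blast
  }
qed

text \<open>A flag through a finite spanning set exhausts \<open>V\<close>, and at its end nested
  subspaces of equal measure coincide. The measure plays the part of dimension.\<close>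

lemma finite_dimensional_measure:
  fixes V :: "('k, 'm) module"
  assumes K: "field K" and V: "module K V" and fd: "finite_dimensional K V"
  shows "\<exists>d :: 'm set \<Rightarrow> nat. \<forall>U W. submodule U K V \<longrightarrow> submodule W K V \<longrightarrow> U \<subset> W \<longrightarrow> d U < d W"
proof -
  interpret V: module K V by fact
  interpret L: left_module K V by (rule module_is_left_module[OF V])
  obtain B where B: "finite B" "B \<subseteq> carrier V"
    "\<And>v. v \<in> carrier V \<Longrightarrow> \<exists>c \<in> B \<rightarrow> carrier K. v = (\<Oplus>\<^bsub>V\<^esub>b\<in>B. c b \<odot>\<^bsub>V\<^esub> b)"
    using fd unfolding finite_dimensional_def by metis
  have "\<exists>S. spanned_subspace K V S \<and> (\<forall>c \<in> B \<rightarrow> carrier K. (\<Oplus>\<^bsub>V\<^esub>b\<in>B. c b \<odot>\<^bsub>V\<^esub> b) \<in> S)"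
    using B(1,2)
  proof (induction B rule: finite_induct)
    case empty
    show ?case by (intro exI[of _ "{\<zero>\<^bsub>V\<^esub>}"]) (simp add: spanned_subspace.zero)
  next
    case (insert b B)
    then obtain S where S: "spanned_subspace K V S"
      "\<And>c. c \<in> B \<rightarrow> carrier K \<Longrightarrow> (\<Oplus>\<^bsub>V\<^esub>b\<in>B. c b \<odot>\<^bsub>V\<^esub> b) \<in> S" by auto
    have "(\<Oplus>\<^bsub>V\<^esub>b\<in>insert b B. c b \<odot>\<^bsub>V\<^esub> b) \<in> {c \<odot>\<^bsub>V\<^esub> b \<oplus>\<^bsub>V\<^esub> s | c s. c \<in> carrier K \<and> s \<in> S}"
      if "c \<in> insert b B \<rightarrow> carrier K" for c
    proof -
      have "(\<Oplus>\<^bsub>V\<^esub>b\<in>insert b B. c b \<odot>\<^bsub>V\<^esub> b) = c b \<odot>\<^bsub>V\<^esub> b \<oplus>\<^bsub>V\<^esub> (\<Oplus>\<^bsub>V\<^esub>b\<in>B. c b \<odot>\<^bsub>V\<^esub> b)"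
        using that insert by (intro V.M.finsum_insert) auto
      then show ?thesis using that S(2)[of c] by auto
    qed
    then show ?case using spanned_subspace.extend[OF S(1), of b] insert by (intro exI conjI) auto
  qed
  then obtain S where S: "spanned_subspace K V S" "carrier V \<subseteq> S" using B(3) by blast
  obtain d :: "'m set \<Rightarrow> nat" where
    d: "\<forall>U W. submodule U K V \<longrightarrow> submodule W K V \<longrightarrow> U \<subseteq> W \<longrightarrow>
      d U \<le> d W \<and> (d U = d W \<longrightarrow> W \<inter> S \<subseteq> U)"
    using spanned_subspace_measure[OF K V S(1)] by blast
  have "d U < d W" if U: "submodule U K V" and W: "submodule W K V" and UW: "U \<subset> W" for U W
  proof -
    have *: "d U \<le> d W" "d U = d W \<Longrightarrow> W \<inter> S \<subseteq> U" using d U W UW by blast+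
    have "W \<subseteq> S" using L.submoduleD(1)[OF W] S(2) by auto
    then show ?thesis using * UW by (cases "d U = d W") auto
  qed
  then show ?thesis by blast
qed

section \<open>Splitting projective modules into left ideals \<open>R e\<close>\<close>

definition product_module :: "('a, 'm) module \<Rightarrow> ('a, 'n) module \<Rightarrow> ('a, 'm \<times> 'n) module" where
  "product_module M N = \<lparr>carrier = carrier M \<times> carrier N, monoid.mult = undefined, one = undefined,
     zero = (\<zero>\<^bsub>M\<^esub>, \<zero>\<^bsub>N\<^esub>), add = (\<lambda>p q. (fst p \<oplus>\<^bsub>M\<^esub> fst q, snd p \<oplus>\<^bsub>N\<^esub> snd q)),
     smult = (\<lambda>r p. (r \<odot>\<^bsub>M\<^esub> fst p, r \<odot>\<^bsub>N\<^esub> snd p))\<rparr>"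

lemma product_module_is_left_module:
  assumes "left_module R M" "left_module R N" shows "left_module R (product_module M N)"
proof -
  interpret M: left_module R M by fact
  interpret N: left_module R N by fact
  have "abelian_group (product_module M N)"
  proof (rule abelian_groupI)
    fix p assume "p \<in> carrier (product_module M N)"
    then show "\<exists>q\<in>carrier (product_module M N). q \<oplus>\<^bsub>product_module M N\<^esub> p = \<zero>\<^bsub>product_module M N\<^esub>"
      by (intro bexI[of _ "(\<ominus>\<^bsub>M\<^esub> fst p, \<ominus>\<^bsub>N\<^esub> snd p)"])
         (auto simp: product_module_def M.M.l_neg N.M.l_neg)
  qed (auto simp: product_module_def M.M.a_ac N.M.a_ac)
  then show ?thesis
    by (intro left_module.intro left_module_axioms.intro M.R.ring_axioms)
       (auto simp: product_module_def M.smult_l_distr N.smult_l_distr M.smult_r_distr N.smult_r_distr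
         M.smult_assoc N.smult_assoc)
qed

text \<open>A step says that \<open>W/U\<close> is isomorphic to \<open>R e\<close>, expressed by an
  epimorphism with kernel \<open>U\<close>. All stages stay subsets of one carrier, and no quotient
  types arise.\<close>

inductive idem_filtered ::
    "('a, 'r) ring_scheme \<Rightarrow> 'a set \<Rightarrow> ('a, 'm) module \<Rightarrow> 'm set \<Rightarrow> bool" for R E M where
  zero: "idem_filtered R E M {\<zero>\<^bsub>M\<^esub>}"
| step: "\<lbrakk>idem_filtered R E M U; submodule W R M; e \<in> E;
    h \<in> left_module_hom R (M\<lparr>carrier := W\<rparr>) (idem_left_ideal R e);
    h ` W = carrier (idem_left_ideal R e); {w \<in> W. h w = \<zero>\<^bsub>R\<^esub>} = U\<rbrakk> \<Longrightarrow> idem_filtered R E M W"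

text \<open>The idempotents add up to one, so \<open>m\<close> is the sum of all \<open>e m\<close>;
  not all of these summands can lie in \<open>N\<close>.\<close>

lemma complete_idempotents_cover:
  assumes M: "left_module R M" and E: "complete_primitive_idempotents R E"
    and N: "submodule N R M" and m: "m \<in> carrier M" "m \<notin> N"
  shows "\<exists>e\<in>E. e \<odot>\<^bsub>M\<^esub> m \<notin> N"
proof (rule ccontr)
  interpret M: left_module R M by fact
  assume "\<not> ?thesis"
  then have all: "\<And>e. e \<in> E \<Longrightarrow> e \<odot>\<^bsub>M\<^esub> m \<in> N" by auto
  have fin: "finite E" and one: "(\<Oplus>\<^bsub>R\<^esub>e\<in>E. e) = \<one>\<^bsub>R\<^esub>" and car: "E \<subseteq> carrier R"
    using E by (auto simp: complete_primitive_idempotents_def primitive_idempotent_def ring_idempotent_def)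
  have "(\<Oplus>\<^bsub>R\<^esub>e\<in>D. e) \<odot>\<^bsub>M\<^esub> m \<in> N" if "D \<subseteq> E" for D
    using finite_subset[OF that fin] that
  proof (induction D rule: finite_induct)
    case empty then show ?case using M.submoduleD(2)[OF N] m by simp
  next
    case (insert e D)
    have "(\<Oplus>\<^bsub>R\<^esub>e\<in>insert e D. e) = e \<oplus>\<^bsub>R\<^esub> (\<Oplus>\<^bsub>R\<^esub>e\<in>D. e)"
      using insert car by (intro M.R.finsum_insert) auto
    moreover have "(\<Oplus>\<^bsub>R\<^esub>e\<in>D. e) \<in> carrier R" using insert car by (intro M.R.finsum_closed) auto
    ultimately show ?case
      using insert car m all M.submoduleD(3)[OF N] by (auto simp: M.smult_l_distr)
  qed
  from this[OF subset_refl] show False using one m by simp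
qed

text \<open>Let \<open>N\<close> be a maximal submodule of \<open>W\<close> and let \<open>m = e m\<close> be outside \<open>N\<close>. Splitting the
  epimorphism \<open>(b, n) \<mapsto> b m + n\<close> from \<open>R e \<oplus> N\<close> onto \<open>W\<close> gives a map \<open>\<beta> : W \<rightarrow> R e\<close> with
  \<open>w - \<beta> w m \<in> N\<close>. Hence \<open>m - u^k m \<in> N\<close> for \<open>u = \<beta> m\<close>, so \<open>u\<close> is not nilpotent, and a left
  inverse of \<open>u\<close> exhibits \<open>R e\<close> as a direct summand of \<open>W\<close>.\<close>

lemma projective_idem_filtered:
  fixes M :: "('a, 'm) module" and d :: "'m set \<Rightarrow> nat"
  assumes M: "left_module R M" and E: "complete_primitive_idempotents R E"
    and inv: "\<And>e u. \<lbrakk>e \<in> E; u \<in> carrier R; e \<otimes>\<^bsub>R\<^esub> u = u; u \<otimes>\<^bsub>R\<^esub> e = u; \<And>n::nat. u [^]\<^bsub>R\<^esub> n \<noteq> \<zero>\<^bsub>R\<^esub>\<rbrakk>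
      \<Longrightarrow> \<exists>t\<in>carrier R. t \<otimes>\<^bsub>R\<^esub> u = e"
    and d: "\<And>U W. \<lbrakk>submodule U R M; submodule W R M; U \<subset> W\<rbrakk> \<Longrightarrow> d U < d W"
    and W: "submodule W R M" "projective_module R (M\<lparr>carrier := W\<rparr>)"
  shows "idem_filtered R E M W"
  using W
proof (induction "d W" arbitrary: W rule: less_induct)
  case less
  interpret M: left_module R M by fact
  note WD = M.submoduleD[OF less.prems(1)]
  have LW: "left_module R (M\<lparr>carrier := W\<rparr>)" by (rule M.submodule_left_module[OF less.prems(1)])
  have WM: "\<And>w. w \<in> W \<Longrightarrow> w \<in> carrier M" using WD(1) by auto
  show ?case
  proof (cases "W = {\<zero>\<^bsub>M\<^esub>}")
    case True then show ?thesis by (simp add: idem_filtered.zero)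
  next
    case False
    have zero: "submodule {\<zero>\<^bsub>M\<^esub>} R M" by (rule M.submoduleI) auto
    \<comment> \<open>A proper submodule of largest measure is maximal among the proper ones; the
      measures are bounded by \<open>d W\<close>.\<close>
    have "\<exists>N. (submodule N R M \<and> N \<subset> W) \<and> (\<forall>U. submodule U R M \<and> U \<subset> W \<longrightarrow> d U \<le> d N)"
      by (rule ex_has_greatest_nat[of "\<lambda>U. submodule U R M \<and> U \<subset> W" "{\<zero>\<^bsub>M\<^esub>}" d "d W"])
         (use zero False WD(2) d less.prems(1) in \<open>auto intro: less_imp_le\<close>)
    then obtain N where N: "submodule N R M" "N \<subset> W"
      and max: "\<And>U. \<lbrakk>submodule U R M; U \<subset> W\<rbrakk> \<Longrightarrow> d U \<le> d N" by blast
    note ND = M.submoduleD[OF N(1)]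
    obtain m0 where m0: "m0 \<in> W" "m0 \<notin> N" using N(2) by auto
    obtain e where e: "e \<in> E" "e \<odot>\<^bsub>M\<^esub> m0 \<notin> N"
      using complete_idempotents_cover[OF M E N(1) WM[OF m0(1)] m0(2)] by auto
    have idem: "ring_idempotent R e"
      using E e by (auto simp: complete_primitive_idempotents_def primitive_idempotent_def)
    then have ec: "e \<in> carrier R" "e \<otimes>\<^bsub>R\<^esub> e = e" by (auto simp: ring_idempotent_def)
    let ?I = "idem_left_ideal R e"
    have LI: "left_module R ?I" by (rule M.R.idem_left_ideal_is_left_module[OF idem])
    have Ic: "carrier ?I = {r \<in> carrier R. r \<otimes>\<^bsub>R\<^esub> e = r}" by (rule M.R.idem_left_ideal_carrier[OF idem])
    interpret I: left_module R ?I by (rule LI)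
    define m where "m = e \<odot>\<^bsub>M\<^esub> m0"
    have m: "m \<in> W" "m \<notin> N" "m \<in> carrier M" using WD(4) ec m0 e WM by (auto simp: m_def)
    have em: "e \<odot>\<^bsub>M\<^esub> m = m" using ec WM[OF m0(1)] by (simp add: m_def M.smult_assoc[symmetric])
    have NM: "\<And>n. n \<in> N \<Longrightarrow> n \<in> carrier M" using ND(1) by auto
    let ?P = "product_module ?I (M\<lparr>carrier := N\<rparr>)"
    have LP: "left_module R ?P"
      by (rule product_module_is_left_module[OF LI M.submodule_left_module[OF N(1)]])
    define g where "g p = fst p \<odot>\<^bsub>M\<^esub> m \<oplus>\<^bsub>M\<^esub> snd p" for p
    have g: "g \<in> left_module_hom R ?P (M\<lparr>carrier := W\<rparr>)"
    proof (rule left_module_homI)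
      fix p assume "p \<in> carrier ?P"
      then show "g p \<in> carrier (M\<lparr>carrier := W\<rparr>)"
        using WD(3,4) m N(2) by (auto simp: product_module_def g_def Ic)
    next
      fix p q assume "p \<in> carrier ?P" "q \<in> carrier ?P"
      then show "g (p \<oplus>\<^bsub>?P\<^esub> q) = g p \<oplus>\<^bsub>M\<lparr>carrier := W\<rparr>\<^esub> g q"
        using m NM by (auto simp: product_module_def g_def Ic M.smult_l_distr M.M.a_ac)
    next
      fix r p assume "r \<in> carrier R" "p \<in> carrier ?P"
      then show "g (r \<odot>\<^bsub>?P\<^esub> p) = r \<odot>\<^bsub>M\<lparr>carrier := W\<rparr>\<^esub> g p"
        using m NM by (auto simp: product_module_def g_def Ic M.smult_r_distr M.smult_assoc)
    qed
    note gD = left_module_homD[OF g]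
    define S where "S = g ` carrier ?P"
    interpret P: left_module R ?P by (rule LP)
    have SW: "S \<subseteq> W" using gD(1) by (auto simp: S_def)
    have "submodule S R M"
    proof (rule M.submoduleI)
      show "S \<subseteq> carrier M" using SW WD(1) by auto
      show "\<zero>\<^bsub>M\<^esub> \<in> S" using left_module_hom_zero_minus(1)[OF LP LW g] P.M.zero_closed
        by (auto simp: S_def intro: image_eqI[OF sym])
    next
      fix a b assume "a \<in> S" "b \<in> S"
      then obtain p q where pq: "p \<in> carrier ?P" "a = g p" "q \<in> carrier ?P" "b = g q" by (auto simp: S_def)
      then have "a \<oplus>\<^bsub>M\<^esub> b = g (p \<oplus>\<^bsub>?P\<^esub> q)" using gD(2) by simp
      then show "a \<oplus>\<^bsub>M\<^esub> b \<in> S" using pq by (simp add: S_def)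
    next
      fix r a assume r: "r \<in> carrier R" and "a \<in> S"
      then obtain p where p: "p \<in> carrier ?P" "a = g p" by (auto simp: S_def)
      then have "r \<odot>\<^bsub>M\<^esub> a = g (r \<odot>\<^bsub>?P\<^esub> p)" using gD(3) r by simp
      then show "r \<odot>\<^bsub>M\<^esub> a \<in> S" using p r by (simp add: S_def)
    qed
    moreover have "N \<subset> S"
    proof -
      have "n \<in> S" if "n \<in> N" for n
        unfolding S_def using that NM m
        by (intro image_eqI[of _ _ "(\<zero>\<^bsub>R\<^esub>, n)"]) (auto simp: g_def product_module_def Ic ec)
      moreover have "m \<in> S"
        unfolding S_def using ND(2) m em
        by (intro image_eqI[of _ _ "(e, \<zero>\<^bsub>M\<^esub>)"]) (auto simp: g_def product_module_def Ic ec)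
      ultimately show ?thesis using m by auto
    qed
    \<comment> \<open>If \<open>S\<close> were proper, its measure would be at most
      \<open>d N\<close>, although \<open>N\<close> is strictly contained in
      \<open>S\<close>.\<close>
    ultimately have "S = W" using d[OF N(1), of S] max[of S] SW by force
    then have surj: "g ` carrier ?P = carrier (M\<lparr>carrier := W\<rparr>)" by (simp add: S_def)
    have idW: "(\<lambda>x. x) \<in> left_module_hom R (M\<lparr>carrier := W\<rparr>) (M\<lparr>carrier := W\<rparr>)"
      using WD(3,4) by (intro left_module_homI) auto
    from projective_module_lift[OF less.prems(2) LP LW g idW surj]
    obtain s where s: "s \<in> left_module_hom R (M\<lparr>carrier := W\<rparr>) ?P" and gs: "\<And>w. w \<in> W \<Longrightarrow> g (s w) = w"
      by auto
    have sD: "s w \<in> carrier ?P" if "w \<in> W" for w using left_module_homD(1)[OF s] that by simp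
    define \<beta> where "\<beta> w = fst (s w)" for w
    have \<beta>: "\<beta> \<in> left_module_hom R (M\<lparr>carrier := W\<rparr>) ?I"
      using left_module_homD[OF s]
      by (intro left_module_homI) (auto simp: \<beta>_def product_module_def mem_Times_iff)
    note \<beta>D = left_module_homD[OF \<beta>, simplified]
    have \<beta>c: "\<beta> w \<in> carrier R" "\<beta> w \<otimes>\<^bsub>R\<^esub> e = \<beta> w" if "w \<in> W" for w using \<beta>D(1)[OF that] by (auto simp: Ic)
    have \<beta>N: "w \<ominus>\<^bsub>M\<^esub> \<beta> w \<odot>\<^bsub>M\<^esub> m \<in> N" if w: "w \<in> W" for w
    proof -
      define n where "n = snd (s w)"
      have n: "n \<in> N" using sD[OF w] by (auto simp: n_def product_module_def)
      have eq: "\<beta> w \<odot>\<^bsub>M\<^esub> m \<oplus>\<^bsub>M\<^esub> n = w" using gs[OF w] by (simp add: g_def \<beta>_def n_def)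
      have c: "\<beta> w \<odot>\<^bsub>M\<^esub> m \<in> carrier M" using \<beta>c[OF w] m by simp
      have "w \<ominus>\<^bsub>M\<^esub> \<beta> w \<odot>\<^bsub>M\<^esub> m = (n \<oplus>\<^bsub>M\<^esub> \<beta> w \<odot>\<^bsub>M\<^esub> m) \<ominus>\<^bsub>M\<^esub> \<beta> w \<odot>\<^bsub>M\<^esub> m"
        using c NM[OF n] M.M.a_comm eq by simp
      also have "\<dots> = n" using c NM[OF n] by (simp add: a_minus_def M.M.a_assoc M.M.r_neg)
      finally show ?thesis using n by simp
    qed
    define u where "u = \<beta> m"
    have u: "u \<in> carrier R" "u \<otimes>\<^bsub>R\<^esub> e = u" using \<beta>c[OF m(1)] by (auto simp: u_def)
    have eu: "e \<otimes>\<^bsub>R\<^esub> u = u" using \<beta>D(3)[OF ec(1) m(1)] em by (simp add: u_def)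
    \<comment> \<open>Telescoping: \<open>m - u^(n+1) m = (m - u^n m) + u^n (m - u m)\<close>, where
      \<open>m - u m\<close> is in \<open>N\<close> by \<open>\<beta>N\<close> at
      \<open>m\<close>.\<close>
    have pow: "m \<ominus>\<^bsub>M\<^esub> u [^]\<^bsub>R\<^esub> n \<odot>\<^bsub>M\<^esub> m \<in> N" for n :: nat
    proof (induction n)
      case 0 then show ?case using m ND(2) by (simp add: a_minus_def M.M.r_neg)
    next
      case (Suc n)
      let ?a = "u [^]\<^bsub>R\<^esub> n"
      have a: "?a \<in> carrier R" using u by simp
      have um: "u \<odot>\<^bsub>M\<^esub> m \<in> carrier M" using u m by simp
      have "?a \<odot>\<^bsub>M\<^esub> (m \<ominus>\<^bsub>M\<^esub> u \<odot>\<^bsub>M\<^esub> m) \<in> N" using \<beta>N[OF m(1)] ND(4) a by (simp add: u_def)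
      moreover have "(m \<ominus>\<^bsub>M\<^esub> ?a \<odot>\<^bsub>M\<^esub> m) \<oplus>\<^bsub>M\<^esub> ?a \<odot>\<^bsub>M\<^esub> (m \<ominus>\<^bsub>M\<^esub> u \<odot>\<^bsub>M\<^esub> m)
          = m \<ominus>\<^bsub>M\<^esub> u [^]\<^bsub>R\<^esub> Suc n \<odot>\<^bsub>M\<^esub> m"
      proof -
        have "\<ominus>\<^bsub>M\<^esub> (u \<odot>\<^bsub>M\<^esub> m) = (\<ominus>\<^bsub>R\<^esub> u) \<odot>\<^bsub>M\<^esub> m"
          using u m M.minus_one_smult[OF um] by (simp add: M.smult_assoc[symmetric] M.R.l_minus)
        moreover have "\<ominus>\<^bsub>M\<^esub> (?a \<odot>\<^bsub>M\<^esub> (u \<odot>\<^bsub>M\<^esub> m)) = ?a \<odot>\<^bsub>M\<^esub> ((\<ominus>\<^bsub>R\<^esub> u) \<odot>\<^bsub>M\<^esub> m)"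
          using u m a M.minus_one_smult[of "?a \<odot>\<^bsub>M\<^esub> (u \<odot>\<^bsub>M\<^esub> m)"]
          by (simp add: M.smult_assoc[symmetric] M.R.l_minus M.R.r_minus)
        ultimately have "?a \<odot>\<^bsub>M\<^esub> (m \<ominus>\<^bsub>M\<^esub> u \<odot>\<^bsub>M\<^esub> m) = ?a \<odot>\<^bsub>M\<^esub> m \<oplus>\<^bsub>M\<^esub> \<ominus>\<^bsub>M\<^esub> (?a \<odot>\<^bsub>M\<^esub> (u \<odot>\<^bsub>M\<^esub> m))"
          using a u m by (simp add: a_minus_def M.smult_r_distr)
        then show ?thesis using a u m um
          by (simp add: a_minus_def M.M.a_assoc M.M.r_neg1 M.smult_assoc)
      qed
      ultimately show ?case using Suc.IH ND(3) by metis
    qed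
    have nonnil: "u [^]\<^bsub>R\<^esub> n \<noteq> \<zero>\<^bsub>R\<^esub>" for n :: nat
    proof
      assume "u [^]\<^bsub>R\<^esub> n = \<zero>\<^bsub>R\<^esub>"
      then have "u [^]\<^bsub>R\<^esub> n \<odot>\<^bsub>M\<^esub> m = \<zero>\<^bsub>M\<^esub>" using m by simp
      moreover have "m \<ominus>\<^bsub>M\<^esub> \<zero>\<^bsub>M\<^esub> = m" using m by (simp add: a_minus_def)
      ultimately have "m \<in> N" using pow[of n] by metis
      then show False using m by simp
    qed
    obtain t where t: "t \<in> carrier R" "t \<otimes>\<^bsub>R\<^esub> u = e" using inv[OF e(1) u(1) eu u(2) nonnil] by blast
    define U where "U = {w \<in> W. \<beta> w = \<zero>\<^bsub>R\<^esub>}"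
    have U: "submodule U R M"
    proof (rule M.submoduleI)
      show "U \<subseteq> carrier M" using WD(1) by (auto simp: U_def)
      show "\<zero>\<^bsub>M\<^esub> \<in> U" using WD(2) left_module_hom_zero_minus(1)[OF LW LI \<beta>] by (simp add: U_def)
    qed (use WD(3,4) \<beta>D in \<open>auto simp: U_def\<close>)
    have um: "u \<noteq> \<zero>\<^bsub>R\<^esub>" using nonnil[of 1] u by simp
    then have "U \<subset> W" using m by (auto simp: U_def u_def)
    then have dU: "d U < d W" using d U less.prems(1) by blast
    have UW: "U \<subseteq> W" by (auto simp: U_def)
    \<comment> \<open>\<open>b -> b t m\<close> is a section of \<open>\<beta>\<close>, because
      \<open>\<beta> (b t m) = b t u = b e = b\<close> for \<open>b\<close> in \<open>R e\<close>.
      Subtracting it makes \<open>r\<close> a projection of \<open>W\<close> onto the kernel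
      \<open>U\<close>, so \<open>U\<close> is projective and of smaller measure.\<close>
    define r where "r w = w \<ominus>\<^bsub>M\<^esub> (\<beta> w \<otimes>\<^bsub>R\<^esub> t) \<odot>\<^bsub>M\<^esub> m" for w
    have r_alt: "r w = w \<oplus>\<^bsub>M\<^esub> (\<ominus>\<^bsub>R\<^esub> (\<beta> w \<otimes>\<^bsub>R\<^esub> t)) \<odot>\<^bsub>M\<^esub> m" if "w \<in> W" for w
    proof -
      have c: "\<beta> w \<otimes>\<^bsub>R\<^esub> t \<in> carrier R" using \<beta>c that t by simp
      have "\<ominus>\<^bsub>M\<^esub> ((\<beta> w \<otimes>\<^bsub>R\<^esub> t) \<odot>\<^bsub>M\<^esub> m) = (\<ominus>\<^bsub>R\<^esub> (\<beta> w \<otimes>\<^bsub>R\<^esub> t)) \<odot>\<^bsub>M\<^esub> m"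
        using c m M.minus_one_smult[of "(\<beta> w \<otimes>\<^bsub>R\<^esub> t) \<odot>\<^bsub>M\<^esub> m"]
        by (simp add: M.smult_assoc[symmetric] M.R.l_minus del: M.R.m_closed)
      then show ?thesis by (simp add: r_def a_minus_def)
    qed
    have \<beta>tm: "\<beta> (a \<odot>\<^bsub>M\<^esub> m) = a \<otimes>\<^bsub>R\<^esub> u" if "a \<in> carrier R" for a
      using \<beta>D(3)[OF that m(1)] by (simp add: u_def)
    have rU: "r w \<in> U" if w: "w \<in> W" for w
    proof -
      have c: "\<beta> w \<otimes>\<^bsub>R\<^esub> t \<in> carrier R" "\<ominus>\<^bsub>R\<^esub> (\<beta> w \<otimes>\<^bsub>R\<^esub> t) \<in> carrier R" using \<beta>c w t by auto
      then have cm: "(\<ominus>\<^bsub>R\<^esub> (\<beta> w \<otimes>\<^bsub>R\<^esub> t)) \<odot>\<^bsub>M\<^esub> m \<in> W" using WD(4) m by simp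
      have "\<beta> (r w) = \<beta> w \<oplus>\<^bsub>R\<^esub> (\<ominus>\<^bsub>R\<^esub> (\<beta> w \<otimes>\<^bsub>R\<^esub> t)) \<otimes>\<^bsub>R\<^esub> u"
        using w cm c by (simp add: r_alt \<beta>D(2) \<beta>tm)
      also have "\<dots> = \<beta> w \<oplus>\<^bsub>R\<^esub> \<ominus>\<^bsub>R\<^esub> (\<beta> w \<otimes>\<^bsub>R\<^esub> (t \<otimes>\<^bsub>R\<^esub> u))"
        using \<beta>c[OF w] t(1) u(1) by (simp add: M.R.l_minus M.R.m_assoc)
      also have "\<dots> = \<zero>\<^bsub>R\<^esub>" using \<beta>c[OF w] t by (simp add: M.R.r_neg)
      finally show ?thesis using w cm WD(3) by (simp add: U_def r_alt)
    qed
    have r: "r \<in> left_module_hom R (M\<lparr>carrier := W\<rparr>) (M\<lparr>carrier := U\<rparr>)"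
    proof (rule left_module_homI)
      fix x y assume "x \<in> carrier (M\<lparr>carrier := W\<rparr>)" "y \<in> carrier (M\<lparr>carrier := W\<rparr>)"
      then have xy: "x \<in> W" "y \<in> W" by auto
      then have c: "\<beta> x \<otimes>\<^bsub>R\<^esub> t \<in> carrier R" "\<beta> y \<otimes>\<^bsub>R\<^esub> t \<in> carrier R" using \<beta>c t by auto
      have "\<beta> (x \<oplus>\<^bsub>M\<^esub> y) \<otimes>\<^bsub>R\<^esub> t = \<beta> x \<otimes>\<^bsub>R\<^esub> t \<oplus>\<^bsub>R\<^esub> \<beta> y \<otimes>\<^bsub>R\<^esub> t"
        using xy \<beta>c t by (simp add: \<beta>D(2) M.R.l_distr)
      then have "r (x \<oplus>\<^bsub>M\<^esub> y) = r x \<oplus>\<^bsub>M\<^esub> r y"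
        using xy WM c m WD(3)
        by (simp add: r_def a_minus_def M.smult_l_distr M.M.minus_add M.M.a_ac del: M.R.m_closed)
      then show "r (x \<oplus>\<^bsub>M\<lparr>carrier := W\<rparr>\<^esub> y) = r x \<oplus>\<^bsub>M\<lparr>carrier := U\<rparr>\<^esub> r y" by simp
    next
      fix a x assume a: "a \<in> carrier R" and "x \<in> carrier (M\<lparr>carrier := W\<rparr>)"
      then have x: "x \<in> W" by auto
      have c: "\<beta> x \<in> carrier R" "\<beta> x \<otimes>\<^bsub>R\<^esub> t \<in> carrier R" using \<beta>c x t by auto
      have "\<ominus>\<^bsub>R\<^esub> (\<beta> (a \<odot>\<^bsub>M\<^esub> x) \<otimes>\<^bsub>R\<^esub> t) = a \<otimes>\<^bsub>R\<^esub> (\<ominus>\<^bsub>R\<^esub> (\<beta> x \<otimes>\<^bsub>R\<^esub> t))"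
        using a x c t by (simp add: \<beta>D(3) M.R.m_assoc M.R.r_minus)
      then have "r (a \<odot>\<^bsub>M\<^esub> x) = a \<odot>\<^bsub>M\<^esub> r x"
        using a x c m WM[OF x] WD(4)
        by (simp add: r_alt M.smult_r_distr M.smult_assoc)
      then show "r (a \<odot>\<^bsub>M\<lparr>carrier := W\<rparr>\<^esub> x) = a \<odot>\<^bsub>M\<lparr>carrier := U\<rparr>\<^esub> r x" by simp
    qed (simp add: rU)
    have incl: "(\<lambda>x. x) \<in> left_module_hom R (M\<lparr>carrier := U\<rparr>) (M\<lparr>carrier := W\<rparr>)"
      using UW by (intro left_module_homI) auto
    have "r x = x" if "x \<in> U" for x
      using that WM m t by (auto simp: U_def r_def a_minus_def)
    then have "projective_module R (M\<lparr>carrier := U\<rparr>)"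
      by (intro projective_retract[OF less.prems(2) M.submodule_left_module[OF U] incl r]) auto
    then have "idem_filtered R E M U" by (rule less.hyps[OF dU U])
    moreover have "\<beta> ` W = carrier ?I"
    proof
      show "\<beta> ` W \<subseteq> carrier ?I" using \<beta>D(1) by auto
      show "carrier ?I \<subseteq> \<beta> ` W"
      proof
        fix b assume "b \<in> carrier ?I"
        then have b: "b \<in> carrier R" "b \<otimes>\<^bsub>R\<^esub> e = b" by (auto simp: Ic)
        then have "\<beta> ((b \<otimes>\<^bsub>R\<^esub> t) \<odot>\<^bsub>M\<^esub> m) = b" using t u by (simp add: \<beta>tm M.R.m_assoc)
        moreover have "(b \<otimes>\<^bsub>R\<^esub> t) \<odot>\<^bsub>M\<^esub> m \<in> W" using b t m WD(4) by simp
        ultimately show "b \<in> \<beta> ` W" by (metis image_eqI)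
      qed
    qed
    ultimately show ?thesis
      by (rule idem_filtered.step[OF _ less.prems(1) e(1) \<beta>]) (simp add: U_def)
  qed
qed


section \<open>Standard modules of a directed category\<close>

lemma kernel_submodule:
  fixes M :: "('a, 'm) module"
  assumes M: "left_module R M" and L: "left_module R L" and h: "h \<in> left_module_hom R M L"
  shows "submodule {m \<in> carrier M. h m = \<zero>\<^bsub>L\<^esub>} R M"
proof -
  interpret M: left_module R M by fact
  interpret L: left_module R L by fact
  show ?thesis
    by (rule M.submoduleI)
       (use left_module_homD[OF h] left_module_hom_zero_minus(1)[OF M L h] in auto)
qed

lemma generated_submodule_least:
  "\<lbrakk>submodule N R M; S \<subseteq> N\<rbrakk> \<Longrightarrow> generated_submodule R M S \<subseteq> N"
  by (auto simp: generated_submodule_def)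

lemma generated_submodule_superset: "S \<subseteq> generated_submodule R M S"
  by (auto simp: generated_submodule_def)

locale directed_linear_category = linear_category K C
  for K :: "('k, 'r) ring_scheme" and C :: "('k, 'o, 'm) lincat" +
  fixes leq :: "('o \<times> 'o) set" and E :: "'o \<Rightarrow> 'm set"
  assumes finite_Ob: "finite (Ob C)"
    and directed: "directed_category C leq"
    and idempotents: "x \<in> Ob C \<Longrightarrow> complete_primitive_idempotents (end_ring C x) (E x)"
begin

section \<open>Componentwise calculus in the category algebra\<close>

abbreviation "A \<equiv> category_algebra C"

lemma A_ring: "ring A"
  by (rule category_algebra_is_ring[OF finite_Ob])

lemma Mor_zero_closed [simp]: "\<lbrakk>x \<in> Ob C; y \<in> Ob C\<rbrakk> \<Longrightarrow> \<zero>\<^bsub>Mor C x y\<^esub> \<in> carrier (Mor C x y)"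
  using abelian_monoid.zero_closed[OF abelian_group.axioms(1)[OF Mor_abelian_group]] .

lemma Mor_add_zero [simp]:
  assumes "x \<in> Ob C" "y \<in> Ob C" "f \<in> carrier (Mor C x y)"
  shows "f \<oplus>\<^bsub>Mor C x y\<^esub> \<zero>\<^bsub>Mor C x y\<^esub> = f" "\<zero>\<^bsub>Mor C x y\<^esub> \<oplus>\<^bsub>Mor C x y\<^esub> f = f"
proof -
  interpret V: abelian_group "Mor C x y" by (rule Mor_abelian_group) (rule assms)+
  show "f \<oplus>\<^bsub>Mor C x y\<^esub> \<zero>\<^bsub>Mor C x y\<^esub> = f" "\<zero>\<^bsub>Mor C x y\<^esub> \<oplus>\<^bsub>Mor C x y\<^esub> f = f" using assms by auto
qed

lemma A_at [simp]: "\<lbrakk>a \<in> carrier A; x \<in> Ob C; y \<in> Ob C\<rbrakk> \<Longrightarrow> a (x, y) \<in> carrier (Mor C x y)"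
  by (auto simp: category_algebra_def PiE_iff)

lemma A_eqI:
  assumes "a \<in> carrier A" "b \<in> carrier A" "\<And>x y. \<lbrakk>x \<in> Ob C; y \<in> Ob C\<rbrakk> \<Longrightarrow> a (x, y) = b (x, y)"
  shows "a = b"
  by (rule PiE_ext[where k = "Ob C \<times> Ob C" and s = "\<lambda>(x, y). carrier (Mor C x y)"])
     (use assms in \<open>auto simp: category_algebra_def\<close>)

lemma A_add_at [simp]:
  "\<lbrakk>x \<in> Ob C; y \<in> Ob C\<rbrakk> \<Longrightarrow> (a \<oplus>\<^bsub>A\<^esub> b) (x, y) = a (x, y) \<oplus>\<^bsub>Mor C x y\<^esub> b (x, y)"
  by (simp add: category_algebra_def)

lemma A_zero_at [simp]: "\<lbrakk>x \<in> Ob C; y \<in> Ob C\<rbrakk> \<Longrightarrow> \<zero>\<^bsub>A\<^esub> (x, y) = \<zero>\<^bsub>Mor C x y\<^esub>"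
  by (simp add: category_algebra_def)

text \<open>The sum over intermediate objects has a single term that can be nonzero, the one through
  \<open>v\<close>. The later product formulas are instances of this collapse.\<close>

lemma A_mult_at:
  assumes "a \<in> carrier A" "b \<in> carrier A" "x \<in> Ob C" "v \<in> Ob C" "z \<in> Ob C"
    and "\<And>w. \<lbrakk>w \<in> Ob C; w \<noteq> v\<rbrakk> \<Longrightarrow> b (w, z) = \<zero>\<^bsub>Mor C w z\<^esub> \<or> a (x, w) = \<zero>\<^bsub>Mor C x w\<^esub>"
  shows "(b \<otimes>\<^bsub>A\<^esub> a) (x, z) = Comp C x v z (b (v, z)) (a (x, v))"
proof -
  interpret V: abelian_group "Mor C x z" by (rule Mor_abelian_group) (rule assms)+
  have cl: "Comp C x w z (b (w, z)) (a (x, w)) \<in> carrier (Mor C x z)" if "w \<in> Ob C" for w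
    using that assms by (simp add: Comp_closed)
  have z: "Comp C x w z (b (w, z)) (a (x, w)) = \<zero>\<^bsub>Mor C x z\<^esub>" if "w \<in> Ob C" "w \<noteq> v" for w
    using assms(6)[OF that] that assms(1-5) by (auto simp: Comp_zero_left Comp_zero_right)
  have "(b \<otimes>\<^bsub>A\<^esub> a) (x, z) = (\<Oplus>\<^bsub>Mor C x z\<^esub>w\<in>Ob C. Comp C x w z (b (w, z)) (a (x, w)))"
    using assms by (simp add: category_algebra_def)
  also have "\<dots> = (\<Oplus>\<^bsub>Mor C x z\<^esub>w\<in>Ob C. if v = w then Comp C x v z (b (v, z)) (a (x, v)) else \<zero>\<^bsub>Mor C x z\<^esub>)"
    by (rule V.finsum_cong') (use cl z assms in auto)
  also have "\<dots> = Comp C x v z (b (v, z)) (a (x, v))"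
    by (rule V.add.finprod_singleton) (use finite_Ob cl assms in auto)
  finally show ?thesis .
qed

lemma mor_embed_closed [simp]:
  "\<lbrakk>x \<in> Ob C; y \<in> Ob C; f \<in> carrier (Mor C x y)\<rbrakk> \<Longrightarrow> mor_embed C x y f \<in> carrier A"
  by (auto simp: mor_embed_def category_algebra_def)

lemma mor_embed_at [simp]:
  "\<lbrakk>u \<in> Ob C; v \<in> Ob C\<rbrakk> \<Longrightarrow> mor_embed C x y f (u, v) = (if u = x \<and> v = y then f else \<zero>\<^bsub>Mor C u v\<^esub>)"
  by (simp add: mor_embed_def)

lemma mor_embed_add:
  assumes "x \<in> Ob C" "y \<in> Ob C" "f \<in> carrier (Mor C x y)" "g \<in> carrier (Mor C x y)"
  shows "mor_embed C x y (f \<oplus>\<^bsub>Mor C x y\<^esub> g) = mor_embed C x y f \<oplus>\<^bsub>A\<^esub> mor_embed C x y g"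
proof -
  interpret A: ring A by (rule A_ring)
  interpret V: abelian_group "Mor C x y" by (rule Mor_abelian_group) (rule assms)+
  show ?thesis by (rule A_eqI) (use assms in auto)
qed

lemma mult_mor_embed_at:
  assumes "b \<in> carrier A" "x \<in> Ob C" "v \<in> Ob C" "f \<in> carrier (Mor C x v)" "w \<in> Ob C" "z \<in> Ob C"
  shows "(b \<otimes>\<^bsub>A\<^esub> mor_embed C x v f) (w, z) = (if w = x then Comp C x v z (b (v, z)) f else \<zero>\<^bsub>Mor C w z\<^esub>)"
  using A_mult_at[of "mor_embed C x v f" b w v z] assms by (auto simp: Comp_zero_right)

lemma mor_embed_mult_at:
  assumes "a \<in> carrier A" "v \<in> Ob C" "z \<in> Ob C" "g \<in> carrier (Mor C v z)" "x \<in> Ob C" "y \<in> Ob C"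
  shows "(mor_embed C v z g \<otimes>\<^bsub>A\<^esub> a) (x, y) = (if y = z then Comp C x v z g (a (x, v)) else \<zero>\<^bsub>Mor C x y\<^esub>)"
  using A_mult_at[of a "mor_embed C v z g" x v y] assms by (auto simp: Comp_zero_left)

lemma leq_antisym: "\<lbrakk>(x, y) \<in> leq; (y, x) \<in> leq\<rbrakk> \<Longrightarrow> x = y"
  using directed unfolding directed_category_def partial_order_on_def by (meson antisymD)

lemma Mor_not_leq: "\<lbrakk>x \<in> Ob C; y \<in> Ob C; (x, y) \<notin> leq; f \<in> carrier (Mor C x y)\<rbrakk> \<Longrightarrow> f = \<zero>\<^bsub>Mor C x y\<^esub>"
  using directed unfolding directed_category_def by blast

text \<open>A path \<open>x -> w -> x\<close> with both factors nonzero would give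
  \<open>x <= w <= x\<close>, hence \<open>w = x\<close>. So the diagonal component is a ring
  homomorphism to the endomorphism ring of \<open>x\<close>, through which \<open>A\<close> acts on
  \<open>object_module\<close>.\<close>

lemma A_mult_diag:
  assumes "a \<in> carrier A" "b \<in> carrier A" "x \<in> Ob C"
  shows "(b \<otimes>\<^bsub>A\<^esub> a) (x, x) = Comp C x x x (b (x, x)) (a (x, x))"
proof (rule A_mult_at[OF assms(1,2,3,3,3)])
  fix w assume w: "w \<in> Ob C" "w \<noteq> x"
  show "b (w, x) = \<zero>\<^bsub>Mor C w x\<^esub> \<or> a (x, w) = \<zero>\<^bsub>Mor C x w\<^esub>"
  proof (cases "(w, x) \<in> leq")
    case True
    then have "(x, w) \<notin> leq" using leq_antisym w by blast
    then show ?thesis using Mor_not_leq[of x w "a (x, w)"] assms w by simp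
  next
    case False
    then show ?thesis using Mor_not_leq[of w x "b (w, x)"] assms w by simp
  qed
qed

lemma A_one_at [simp]: "x \<in> Ob C \<Longrightarrow> \<one>\<^bsub>A\<^esub> (x, x) = Ident C x"
  by (simp add: category_algebra_def)

text \<open>The functor concentrated at the object \<open>z\<close> with value \<open>M\<close>.\<close>

definition object_module :: "'o \<Rightarrow> ('m, 'n) module \<Rightarrow> ('o \<times> 'o \<Rightarrow> 'm, 'n) module" where
  "object_module z M = \<lparr>carrier = carrier M, monoid.mult = undefined, one = undefined,
     zero = \<zero>\<^bsub>M\<^esub>, add = add M, smult = (\<lambda>a m. a (z, z) \<odot>\<^bsub>M\<^esub> m)\<rparr>"

lemma object_module_simps [simp]:
  "carrier (object_module z M) = carrier M" "zero (object_module z M) = zero M"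
  "add (object_module z M) = add M" "a \<odot>\<^bsub>object_module z M\<^esub> m = a (z, z) \<odot>\<^bsub>M\<^esub> m"
  by (simp_all add: object_module_def)

lemma end_ring_simps [simp]:
  "carrier (end_ring C z) = carrier (Mor C z z)" "zero (end_ring C z) = zero (Mor C z z)"
  "add (end_ring C z) = add (Mor C z z)" "monoid.mult (end_ring C z) = Comp C z z z"
  "one (end_ring C z) = Ident C z"
  by (simp_all add: end_ring_def)

lemma object_module_is_left_module:
  assumes z: "z \<in> Ob C" and M: "left_module (end_ring C z) M"
  shows "left_module A (object_module z M)"
proof -
  interpret M: left_module "end_ring C z" M by fact
  have "abelian_group (object_module z M)"
  proof (rule abelian_groupI)
    fix x assume "x \<in> carrier (object_module z M)"
    then show "\<exists>y\<in>carrier (object_module z M). y \<oplus>\<^bsub>object_module z M\<^esub> x = \<zero>\<^bsub>object_module z M\<^esub>"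
      by (intro bexI[of _ "\<ominus>\<^bsub>M\<^esub> x"]) (auto simp: M.M.l_neg)
  qed (auto simp: M.M.a_ac)
  then show ?thesis
    using z M.smult_closed M.smult_l_distr M.smult_r_distr M.smult_assoc M.smult_one
    by (intro left_module.intro left_module_axioms.intro A_ring) (auto simp: A_mult_diag)
qed

lemma idem_in:
  assumes "x \<in> Ob C" "e \<in> E x"
  shows "ring_idempotent (end_ring C x) e" "e \<in> carrier (Mor C x x)" "Comp C x x x e e = e"
  using idempotents[OF assms(1)] assms(2)
  by (auto simp: complete_primitive_idempotents_def primitive_idempotent_def ring_idempotent_def)

lemma idem_projective_simps [simp]:
  "zero (idem_projective C l) = zero A" "add (idem_projective C l) = add A"
  "smult (idem_projective C l) = monoid.mult A"
  by (simp_all add: idem_projective_def Let_def)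

text \<open>Right multiplication by the idempotent \<open>mor_embed C x x e\<close> is a projection,
  so its image consists of its fixed points; these are described one component at a time.\<close>

lemma idem_projective_carrier:
  assumes "x \<in> Ob C" "e \<in> E x"
  shows "carrier (idem_projective C (x, e)) = {p \<in> carrier A.
    (\<forall>y\<in>Ob C. \<forall>z\<in>Ob C. y \<noteq> x \<longrightarrow> p (y, z) = \<zero>\<^bsub>Mor C y z\<^esub>) \<and> (\<forall>z\<in>Ob C. Comp C x x z (p (x, z)) e = p (x, z))}"
    (is "_ = ?S")
proof -
  interpret A: ring A by (rule A_ring)
  note e = idem_in[OF assms]
  let ?e = "mor_embed C x x e"
  have P: "carrier (idem_projective C (x, e)) = {a \<otimes>\<^bsub>A\<^esub> ?e | a. a \<in> carrier A}"
    by (simp add: idem_projective_def Let_def)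
  have "a \<otimes>\<^bsub>A\<^esub> ?e \<in> ?S" if "a \<in> carrier A" for a
    using that e assms by (auto simp: mult_mor_embed_at Comp_assoc)
  moreover have "\<exists>a. p = a \<otimes>\<^bsub>A\<^esub> ?e \<and> a \<in> carrier A" if "p \<in> ?S" for p
  proof (intro exI conjI)
    show "p = p \<otimes>\<^bsub>A\<^esub> ?e"
      by (rule A_eqI) (use that e assms in \<open>auto simp: mult_mor_embed_at\<close>)
  qed (use that in auto)
  ultimately show ?thesis unfolding P by blast
qed

lemma idem_projective_left_module:
  assumes "x \<in> Ob C" "e \<in> E x" shows "left_module A (idem_projective C (x, e))"
  using idem_projective_is_left_module[OF finite_Ob assms(1)] idem_in[OF assms] by simp

lemma mor_embed_idem_projective:
  assumes "x \<in> Ob C" "e \<in> E x" "z \<in> Ob C" "f \<in> carrier (Mor C x z)" "Comp C x x z f e = f"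
  shows "mor_embed C x z f \<in> carrier (idem_projective C (x, e))"
  using assms idem_in[OF assms(1,2)] by (auto simp: idem_projective_carrier Comp_zero_left)

section \<open>Identification of the standard modules\<close>

abbreviation "standard_ideal x e \<equiv> object_module x (idem_left_ideal (end_ring C x) e)"

lemma standard_ideal_left_module:
  assumes "x \<in> Ob C" "e \<in> E x" shows "left_module A (standard_ideal x e)"
  using object_module_is_left_module[OF assms(1)] idem_in(1)[OF assms]
    ring.idem_left_ideal_is_left_module[OF end_ring_is_ring[OF assms(1)]] by blast

lemma standard_ideal_carrier:
  assumes "x \<in> Ob C" "e \<in> E x"
  shows "carrier (idem_left_ideal (end_ring C x) e) = {b \<in> carrier (Mor C x x). Comp C x x x b e = b}"
  using ring.idem_left_ideal_carrier[OF end_ring_is_ring[OF assms(1)] idem_in(1)[OF assms]] by simp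

text \<open>Linearity is \<open>A_mult_diag\<close>; a preimage of \<open>b\<close> is
  \<open>b\<close> itself placed at \<open>(x, x)\<close>. Once its kernel is known to be the sum of
  traces, this map identifies the standard module.\<close>

lemma diagonal_hom:
  assumes "x \<in> Ob C" "e \<in> E x"
  shows "(\<lambda>p. p (x, x)) \<in> left_module_hom A (idem_projective C (x, e)) (standard_ideal x e)"
    and "(\<lambda>p. p (x, x)) ` carrier (idem_projective C (x, e)) = carrier (standard_ideal x e)"
proof -
  note P = idem_projective_carrier[OF assms] and I = standard_ideal_carrier[OF assms]
  show "(\<lambda>p. p (x, x)) \<in> left_module_hom A (idem_projective C (x, e)) (standard_ideal x e)"
    by (rule left_module_homI) (use assms in \<open>auto simp: P I A_mult_diag\<close>)
  have "b \<in> (\<lambda>p. p (x, x)) ` carrier (idem_projective C (x, e))"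
    if "b \<in> carrier (Mor C x x)" "Comp C x x x b e = b" for b
    using mor_embed_idem_projective[OF assms assms(1) that] assms
    by (intro image_eqI[of _ _ "mor_embed C x x b"]) auto
  then show "(\<lambda>p. p (x, x)) ` carrier (idem_projective C (x, e)) = carrier (standard_ideal x e)"
    using assms by (auto simp: I P)
qed

abbreviation "pre \<equiv> canonical_preorder C E leq"

lemma not_pre_iff:
  assumes "x \<in> Ob C" "e \<in> E x" "y \<in> Ob C" "f \<in> E y"
  shows "((y, f), (x, e)) \<notin> pre \<longleftrightarrow> (y, x) \<notin> leq"
  using assms by (auto simp: canonical_preorder_def idem_index_def)

text \<open>\<open>q = q f\<close> gives \<open>h q = q (h f)\<close>. As \<open>q\<close> has
  components out of \<open>y\<close> only, its product with \<open>h f\<close> at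
  \<open>(x, x)\<close> passes through \<open>q (y, x)\<close>, an element of the zero space
  \<open>C(y,x)\<close>.\<close>

lemma trace_diagonal:
  assumes x: "x \<in> Ob C" "e \<in> E x" and y: "y \<in> Ob C" "f \<in> E y" and yx: "(y, x) \<notin> leq"
    and h: "h \<in> left_module_hom A (idem_projective C (y, f)) (idem_projective C (x, e))"
    and q: "q \<in> carrier (idem_projective C (y, f))"
  shows "h q (x, x) = \<zero>\<^bsub>Mor C x x\<^esub>"
proof -
  interpret A: ring A by (rule A_ring)
  let ?f = "mor_embed C y y f"
  note f = idem_in[OF y]
  note P = idem_projective_carrier[OF x] and Q = idem_projective_carrier[OF y]
  have q': "q \<in> carrier A" using q by (simp add: Q)
  have fQ: "?f \<in> carrier (idem_projective C (y, f))" using mor_embed_idem_projective[OF y y(1) f(2,3)] .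
  have "q = q \<otimes>\<^bsub>A\<^esub> ?f" by (rule A_eqI) (use q f y in \<open>auto simp: Q mult_mor_embed_at\<close>)
  then have "h q = q \<otimes>\<^bsub>A\<^esub> h ?f" using left_module_homD(3)[OF h, of q ?f] fQ q' by simp
  moreover have hf: "h ?f \<in> carrier A" using left_module_homD(1)[OF h fQ] by (simp add: P)
  moreover have "(q \<otimes>\<^bsub>A\<^esub> h ?f) (x, x) = Comp C x y x (q (y, x)) (h ?f (x, y))"
    by (rule A_mult_at) (use q x y hf in \<open>auto simp: Q\<close>)
  moreover have "q (y, x) = \<zero>\<^bsub>Mor C y x\<^esub>" using Mor_not_leq[OF y(1) x(1) yx] q' x y by simp
  ultimately show ?thesis using x y by (simp add: Comp_zero_left)
qed

text \<open>\<open>g\<close> is the sum of the composites \<open>f g\<close> over \<open>f\<close>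
  in \<open>E z\<close>, and \<open>f g\<close> is the image of \<open>f\<close> under right
  multiplication by \<open>g\<close>, a homomorphism from the projective module of
  \<open>(z, f)\<close>.\<close>

lemma mor_embed_in_submodule:
  assumes x: "x \<in> Ob C" "e \<in> E x" and z: "z \<in> Ob C" "(z, x) \<notin> leq"
    and N: "submodule N A (idem_projective C (x, e))"
    and tr: "\<And>f. f \<in> E z \<Longrightarrow> trace_submodule A (idem_projective C (z, f)) (idem_projective C (x, e)) \<subseteq> N"
    and g: "g \<in> carrier (Mor C x z)" "Comp C x x z g e = g"
  shows "mor_embed C x z g \<in> N"
proof -
  interpret A: ring A by (rule A_ring)
  interpret P: left_module A "idem_projective C (x, e)" by (rule idem_projective_left_module[OF x])
  note P = idem_projective_carrier[OF x]
  note ND = P.submoduleD[OF N, simplified]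
  interpret R: ring "end_ring C z" by (rule end_ring_is_ring[OF z(1)])
  have fin: "finite (E z)" and one: "(\<Oplus>\<^bsub>end_ring C z\<^esub>f\<in>E z. f) = Ident C z"
    using idempotents[OF z(1)] by (auto simp: complete_primitive_idempotents_def)
  note Ez = idem_in[OF z(1)]
  have gP: "mor_embed C x z g \<in> carrier (idem_projective C (x, e))"
    using mor_embed_idem_projective[OF x z(1) g] .
  have sub: "mor_embed C x z (Comp C x z z f g) \<in> N" if f: "f \<in> E z" for f
  proof -
    let ?h = "\<lambda>q. q \<otimes>\<^bsub>A\<^esub> mor_embed C x z g"
    have gA: "mor_embed C x z g \<in> carrier A" using gP by (simp add: P)
    have "?h \<in> left_module_hom A (idem_projective C (z, f)) (idem_projective C (x, e))"
    proof (rule left_module_homI)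
      fix q assume "q \<in> carrier (idem_projective C (z, f))"
      then have "q \<in> carrier A" by (simp add: idem_projective_carrier[OF z(1) f])
      then show "?h q \<in> carrier (idem_projective C (x, e))" using P.smult_closed[OF _ gP] by simp
    qed (use gA in \<open>auto simp: idem_projective_carrier[OF z(1) f] A.l_distr A.m_assoc\<close>)
    moreover have "mor_embed C z z f \<in> carrier (idem_projective C (z, f))"
      using mor_embed_idem_projective[OF z(1) f z(1)] Ez[OF f] by simp
    ultimately have "?h (mor_embed C z z f) \<in> trace_submodule A (idem_projective C (z, f)) (idem_projective C (x, e))"
      unfolding trace_submodule_def by (intro subsetD[OF generated_submodule_superset]) blast
    moreover have "?h (mor_embed C z z f) = mor_embed C x z (Comp C x z z f g)"
      by (rule A_eqI) (use x z g Ez[OF f] gA in \<open>auto simp: mult_mor_embed_at Comp_closed Comp_zero_left\<close>)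
    ultimately show ?thesis using tr[OF f] by auto
  qed
  have "mor_embed C x z (Comp C x z z (\<Oplus>\<^bsub>end_ring C z\<^esub>f\<in>D. f) g) \<in> N" if "D \<subseteq> E z" for D
    using finite_subset[OF that fin] that
  proof (induction D rule: finite_induct)
    case empty
    have "mor_embed C x z \<zero>\<^bsub>Mor C x z\<^esub> = \<zero>\<^bsub>A\<^esub>"
      by (rule A_eqI) (use x z in auto)
    then show ?case using ND(2) x z g by (simp add: Comp_zero_left)
  next
    case (insert f D)
    have c: "(\<Oplus>\<^bsub>end_ring C z\<^esub>f\<in>D. f) \<in> carrier (Mor C z z)" "f \<in> carrier (Mor C z z)"
      using insert Ez R.finsum_closed[of "\<lambda>f. f" D] by auto
    have "(\<Oplus>\<^bsub>end_ring C z\<^esub>f\<in>insert f D. f) = f \<oplus>\<^bsub>Mor C z z\<^esub> (\<Oplus>\<^bsub>end_ring C z\<^esub>f\<in>D. f)"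
      using R.finsum_insert[OF insert(1,2), of "\<lambda>f. f"] insert.prems Ez(2) by (simp add: subset_iff)
    then show ?case
      using insert c x z g sub[of f] ND(3) by (simp add: Comp_add_left mor_embed_add Comp_closed)
  qed
  from this[OF subset_refl] show ?thesis using one x z g by (simp add: Comp_Ident_left)
qed

text \<open>One inclusion is \<open>trace_diagonal\<close>. Conversely, an element vanishing at
  \<open>x\<close> is the sum of its components at objects \<open>z\<close> other than
  \<open>x\<close>. Such a component is zero unless \<open>x <= z\<close>; in that case antisymmetry
  excludes \<open>z <= x\<close>, and \<open>mor_embed_in_submodule\<close> places it in the
  traces.\<close>

lemma standard_kernel:
  assumes x: "x \<in> Ob C" "e \<in> E x"
  shows "generated_submodule A (idem_projective C (x, e))
         (\<Union>m \<in> {m \<in> idem_index C E. (m, (x, e)) \<notin> pre}.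
            trace_submodule A (idem_projective C m) (idem_projective C (x, e)))
       = {p \<in> carrier (idem_projective C (x, e)). p (x, x) = \<zero>\<^bsub>Mor C x x\<^esub>}" (is "generated_submodule _ ?P ?T = ?K")
proof
  interpret A: ring A by (rule A_ring)
  interpret P: left_module A ?P by (rule idem_projective_left_module[OF x])
  note P = idem_projective_carrier[OF x]
  have K: "submodule ?K A ?P"
    using kernel_submodule[OF P.left_module_axioms standard_ideal_left_module[OF x] diagonal_hom(1)[OF x]] by simp
  show "generated_submodule A ?P ?T \<subseteq> ?K"
  proof (rule generated_submodule_least[OF K UN_least])
    fix m assume m: "m \<in> {m \<in> idem_index C E. (m, (x, e)) \<notin> pre}"
    obtain y f where yf: "m = (y, f)" by (cases m)
    with m have y: "y \<in> Ob C" "f \<in> E y" by (auto simp: idem_index_def)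
    then have yx: "(y, x) \<notin> leq" using m yf not_pre_iff[OF x] by auto
    show "trace_submodule A (idem_projective C m) ?P \<subseteq> ?K"
      unfolding trace_submodule_def
    proof (rule generated_submodule_least[OF K], safe)
      fix h q assume h: "h \<in> left_module_hom A (idem_projective C m) ?P"
        and q: "q \<in> carrier (idem_projective C m)"
      show "h q \<in> carrier ?P" using left_module_homD(1)[OF h q] .
      show "h q (x, x) = \<zero>\<^bsub>Mor C x x\<^esub>" using trace_diagonal[OF x y yx] h q yf by simp
    qed
  qed
  show "?K \<subseteq> generated_submodule A ?P ?T"
    unfolding generated_submodule_def
  proof (intro Inter_greatest)
    fix N assume "N \<in> {N. submodule N A ?P \<and> ?T \<subseteq> N}"
    then have N: "submodule N A ?P" and TN: "?T \<subseteq> N" by auto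
    note ND = P.submoduleD[OF N, simplified]
    have emb: "mor_embed C x z g \<in> N"
      if z: "z \<in> Ob C" "z \<noteq> x" and g: "g \<in> carrier (Mor C x z)" "Comp C x x z g e = g" for z g
    proof (cases "(x, z) \<in> leq")
      case True
      then have zx: "(z, x) \<notin> leq" using leq_antisym z by blast
      have "trace_submodule A (idem_projective C (z, f)) ?P \<subseteq> N" if "f \<in> E z" for f
        using TN z that zx not_pre_iff[OF x z(1) that] by (force simp: idem_index_def)
      then show ?thesis using mor_embed_in_submodule[OF x z(1) zx N _ g] by blast
    next
      case False
      then have "g = \<zero>\<^bsub>Mor C x z\<^esub>" using Mor_not_leq x z g by blast
      then have "mor_embed C x z g = \<zero>\<^bsub>A\<^esub>" using x z by (intro A_eqI) auto
      then show ?thesis using ND(2) by simp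
    qed
    \<comment> \<open>Induction on a set \<open>T\<close> outside which \<open>p\<close> vanishes,
      splitting off the component of \<open>p\<close> at one object per step; for
      \<open>T = Ob C\<close> the condition is void.\<close>
    have "p \<in> N" if "T \<subseteq> Ob C" "p \<in> ?K" "\<And>z. \<lbrakk>z \<in> Ob C; z \<notin> T\<rbrakk> \<Longrightarrow> p (x, z) = \<zero>\<^bsub>Mor C x z\<^esub>" for T p
      using finite_subset[OF that(1) finite_Ob] that
    proof (induction T arbitrary: p rule: finite_induct)
      case empty
      have "p = \<zero>\<^bsub>A\<^esub>"
      proof (rule A_eqI)
        fix u v assume uv: "u \<in> Ob C" "v \<in> Ob C"
        then show "p (u, v) = \<zero>\<^bsub>A\<^esub> (u, v)" using empty by (cases "u = x") (auto simp: P)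
      qed (use empty in \<open>auto simp: P\<close>)
      then show ?case using ND(2) by simp
    next
      case (insert z T)
      have z: "z \<in> Ob C" using insert by auto
      have p: "p \<in> carrier A" "p (x, x) = \<zero>\<^bsub>Mor C x x\<^esub>" "Comp C x x z (p (x, z)) e = p (x, z)"
        "\<And>y w. \<lbrakk>y \<in> Ob C; w \<in> Ob C; y \<noteq> x\<rbrakk> \<Longrightarrow> p (y, w) = \<zero>\<^bsub>Mor C y w\<^esub>"
        "\<And>w. w \<in> Ob C \<Longrightarrow> Comp C x x w (p (x, w)) e = p (x, w)"
        using insert.prems(2) z by (auto simp: P)
      let ?q = "mor_embed C x z (p (x, z))"
      have qN: "?q \<in> N"
      proof (cases "z = x")
        case True
        have "?q = \<zero>\<^bsub>A\<^esub>" using True p x by (intro A_eqI) auto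
        then show ?thesis using ND(2) by simp
      next
        case False
        then show ?thesis using emb[OF z False] p x z by simp
      qed
      define r where "r = (\<lambda>(u, v) \<in> Ob C \<times> Ob C. if v = z then \<zero>\<^bsub>Mor C u v\<^esub> else p (u, v))"
      have rA: "r \<in> carrier A" using p by (auto simp: r_def category_algebra_def)
      have r_at: "r (u, v) = (if v = z then \<zero>\<^bsub>Mor C u v\<^esub> else p (u, v))" if "u \<in> Ob C" "v \<in> Ob C" for u v
        using that by (simp add: r_def)
      have rK: "r \<in> ?K" using rA p x z idem_in[OF x] by (auto simp: P r_at Comp_zero_left)
      have "r \<in> N"
      proof (rule insert.IH)
        fix w assume "w \<in> Ob C" "w \<notin> T"
        then show "r (x, w) = \<zero>\<^bsub>Mor C x w\<^esub>" using insert.prems(3)[of w] x by (auto simp: r_at)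
      qed (use insert rK in auto)
      moreover have "p = r \<oplus>\<^bsub>A\<^esub> ?q"
      proof (rule A_eqI)
        show "r \<oplus>\<^bsub>A\<^esub> ?q \<in> carrier A" using rA p x z by simp
        fix u v assume uv: "u \<in> Ob C" "v \<in> Ob C"
        show "p (u, v) = (r \<oplus>\<^bsub>A\<^esub> ?q) (u, v)" using uv p x z by (auto simp: r_at)
      qed (use p in simp)
      ultimately show ?case using ND(3)[OF _ qN] by metis
    qed
    then show "?K \<subseteq> N" by blast
  qed
qed

text \<open>Evaluation at \<open>z\<close> identifies the standard module with
  \<open>standard_ideal z f\<close>, and \<open>quotient_module_iso_iff\<close> replaces an
  isomorphism onto the latter by an epimorphism. Both directions of the theorem use the standard
  modules in this form.\<close>

lemma iso_standard_module_iff: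
  fixes M :: "('o \<times> 'o \<Rightarrow> 'm, 'n) module"
  assumes M: "left_module A M" and N: "submodule N A M" and z: "z \<in> Ob C" "f \<in> E z"
  shows "left_module_iso A (quotient_module M N) (standard_module C E pre (z, f)) \<longleftrightarrow>
    (\<exists>h \<in> left_module_hom A M (standard_ideal z f).
      h ` carrier M = carrier (standard_ideal z f) \<and> {m \<in> carrier M. h m = \<zero>\<^bsub>Mor C z z\<^esub>} = N)"
proof -
  let ?P = "idem_projective C (z, f)" and ?K = "{p \<in> carrier (idem_projective C (z, f)). p (z, z) = \<zero>\<^bsub>Mor C z z\<^esub>}"
  have P: "left_module A ?P" by (rule idem_projective_left_module[OF z])
  have I: "left_module A (standard_ideal z f)" by (rule standard_ideal_left_module[OF z])
  have K: "submodule ?K A ?P" using kernel_submodule[OF P I diagonal_hom(1)[OF z]] by simp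
  have std: "standard_module C E pre (z, f) = quotient_module ?P ?K"
    unfolding standard_module_def standard_kernel[OF z] ..
  have 1: "left_module_iso A (quotient_module ?P ?K) (standard_ideal z f)"
    using quotient_module_iso_iff[OF P K I] diagonal_hom[OF z] by auto
  have 2: "left_module_iso A (standard_ideal z f) (quotient_module ?P ?K)"
    by (rule left_module_iso_sym[OF 1 quotient_module_closed[OF P K]])
  have "left_module_iso A (quotient_module M N) (standard_module C E pre (z, f)) \<longleftrightarrow>
      left_module_iso A (quotient_module M N) (standard_ideal z f)"
    unfolding std using left_module_iso_trans[OF _ 1] left_module_iso_trans[OF _ 2] by (intro iffI)
  then show ?thesis using quotient_module_iso_iff[OF M N I] by simp
qed

end


section \<open>From filtrations to projectivity\<close>

lemma zero_module_projective:
  fixes M :: "('a, 'm) module"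
  assumes M: "left_module R M" and z: "carrier M = {\<zero>\<^bsub>M\<^esub>}"
  shows "projective_module R M"
proof (rule projective_moduleI[OF M])
  fix N :: "('a, 'm \<Rightarrow> 'a) module" and L :: "('a, 'm) module" and g f
  assume *: "left_module R N" "left_module R L" "g \<in> left_module_hom R N L" "f \<in> left_module_hom R M L"
  interpret N: left_module R N by fact
  have "(\<lambda>_. \<zero>\<^bsub>N\<^esub>) \<in> left_module_hom R M N" by (rule left_module_homI) auto
  moreover have "g \<zero>\<^bsub>N\<^esub> = \<zero>\<^bsub>L\<^esub>" "f \<zero>\<^bsub>M\<^esub> = \<zero>\<^bsub>L\<^esub>"
    using left_module_hom_zero_minus(1) * M by blast+
  ultimately show "\<exists>h \<in> left_module_hom R M N. \<forall>x\<in>carrier M. g (h x) = f x"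
    using z by (intro bexI[of _ "\<lambda>_. \<zero>\<^bsub>N\<^esub>"]) auto
qed

text \<open>Inductive counterpart of \<open>has_standard_filtration\<close>: a filtration grows at
  the top without index arithmetic, so that the layers of different objects can be stacked.\<close>

inductive standard_filtered ::
    "('k, 'o, 'm) lincat \<Rightarrow> ('o \<Rightarrow> 'm set) \<Rightarrow> (('o \<times> 'm) \<times> ('o \<times> 'm)) set
      \<Rightarrow> ('o \<times> 'o \<Rightarrow> 'm, 'o \<times> 'o \<Rightarrow> 'm) module \<Rightarrow> ('o \<times> 'o \<Rightarrow> 'm) set \<Rightarrow> bool"
  for C E pre P where
  zero: "standard_filtered C E pre P {\<zero>\<^bsub>P\<^esub>}"
| step: "\<lbrakk>standard_filtered C E pre P U; submodule W (category_algebra C) P; U \<subseteq> W; m \<in> idem_index C E;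
    left_module_iso (category_algebra C) (quotient_module (P\<lparr>carrier := W\<rparr>) U) (standard_module C E pre m)\<rbrakk>
    \<Longrightarrow> standard_filtered C E pre P W"

lemma standard_filtered_imp_filtration:
  assumes P: "left_module (category_algebra C) P" and "standard_filtered C E pre P (carrier P)"
  shows "has_standard_filtration C E pre P"
proof -
  interpret P: left_module "category_algebra C" P by fact
  have "\<exists>(n :: nat) F. F 0 = {\<zero>\<^bsub>P\<^esub>} \<and> F n = W
        \<and> (\<forall>i\<le>n. submodule (F i) (category_algebra C) P)
        \<and> (\<forall>i<n. F i \<subseteq> F (Suc i) \<and>
              (\<exists>m \<in> idem_index C E. left_module_iso (category_algebra C)
                 (quotient_module (P\<lparr>carrier := F (Suc i)\<rparr>) (F i)) (standard_module C E pre m)))"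
    if "standard_filtered C E pre P W" for W
    using that
  proof induction
    case zero
    have "submodule {\<zero>\<^bsub>P\<^esub>} (category_algebra C) P" by (rule P.submoduleI) auto
    then show ?case by (intro exI[of _ 0] exI[of _ "\<lambda>_. {\<zero>\<^bsub>P\<^esub>}"]) auto
  next
    case (step U W m)
    then obtain n :: nat and F where F: "F 0 = {\<zero>\<^bsub>P\<^esub>}" "F n = U"
      "\<forall>i\<le>n. submodule (F i) (category_algebra C) P"
      "\<forall>i<n. F i \<subseteq> F (Suc i) \<and>
         (\<exists>m \<in> idem_index C E. left_module_iso (category_algebra C)
            (quotient_module (P\<lparr>carrier := F (Suc i)\<rparr>) (F i)) (standard_module C E pre m))" by blast
    then show ?case using step
      by (intro exI[of _ "Suc n"] exI[of _ "F(Suc n := W)"]) (auto simp: le_Suc_eq less_Suc_eq)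
  qed
  from this[OF assms(2)] show ?thesis unfolding has_standard_filtration_def .
qed

context directed_linear_category
begin

section \<open>Values of submodules of \<open>C e\<close> at an object\<close>

lemma mor_left_module_simps [simp]:
  "carrier (mor_left_module C x y) = carrier (Mor C x y)" "zero (mor_left_module C x y) = zero (Mor C x y)"
  "add (mor_left_module C x y) = add (Mor C x y)" "smult (mor_left_module C x y) = Comp C x y y"
  by (simp_all add: mor_left_module_def)

text \<open>This is \<open>C(x,z) e\<close>, both a direct summand of \<open>C(x,z)\<close> and the
  value at \<open>z\<close> of the functor \<open>C e\<close>.\<close>

definition summand :: "'o \<Rightarrow> 'm \<Rightarrow> 'o \<Rightarrow> 'm set" where
  "summand x e z = {f \<in> carrier (Mor C x z). Comp C x x z f e = f}"

lemma summand_submodule: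
  assumes x: "x \<in> Ob C" "e \<in> E x" and z: "z \<in> Ob C"
  shows "submodule (summand x e z) (end_ring C z) (mor_left_module C x z)"
proof -
  interpret V: left_module "end_ring C z" "mor_left_module C x z"
    by (rule mor_left_module_is_left_module[OF x(1) z])
  show ?thesis
    by (rule V.submoduleI)
       (use x z idem_in[OF x] V.M.add.m_closed in
         \<open>auto simp: summand_def Comp_zero_left Comp_add_left Comp_closed Comp_assoc\<close>)
qed

lemma summand_retract:
  assumes x: "x \<in> Ob C" "e \<in> E x" and z: "z \<in> Ob C"
  shows "(\<lambda>f. Comp C x x z f e) \<in> left_module_hom (end_ring C z) (mor_left_module C x z)
      ((mor_left_module C x z)\<lparr>carrier := summand x e z\<rparr>)"
  by (rule left_module_homI)
     (use x z idem_in[OF x] in \<open>auto simp: summand_def Comp_closed Comp_add_left Comp_assoc\<close>)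

text \<open>Left multiplication by the identity of \<open>z\<close> cuts out the component at
  \<open>z\<close>, so a submodule contains the components of its elements.\<close>

lemma component_mem_iff:
  assumes x: "x \<in> Ob C" "e \<in> E x" and z: "z \<in> Ob C"
    and U: "submodule U A (idem_projective C (x, e))"
  shows "g \<in> (\<lambda>p. p (x, z)) ` U \<longleftrightarrow> g \<in> carrier (Mor C x z) \<and> mor_embed C x z g \<in> U"
proof -
  interpret P: left_module A "idem_projective C (x, e)" by (rule idem_projective_left_module[OF x])
  note P = idem_projective_carrier[OF x]
  note UD = P.submoduleD[OF U, simplified]
  interpret A: ring A by (rule A_ring)
  have "p (x, z) \<in> carrier (Mor C x z) \<and> mor_embed C x z (p (x, z)) \<in> U" if p: "p \<in> U" for p
  proof -
    have pA: "p \<in> carrier A" "\<And>y w. \<lbrakk>y \<in> Ob C; w \<in> Ob C; y \<noteq> x\<rbrakk> \<Longrightarrow> p (y, w) = \<zero>\<^bsub>Mor C y w\<^esub>"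
      using p UD(1) by (auto simp: P)
    have "mor_embed C x z (p (x, z)) = mor_embed C z z (Ident C z) \<otimes>\<^bsub>A\<^esub> p"
      by (rule A_eqI)
         (use pA x z Ident_closed in \<open>auto simp: mor_embed_mult_at Comp_Ident_left\<close>)
    then show ?thesis using UD(4)[of "mor_embed C z z (Ident C z)" p] p pA x z Ident_closed by simp
  qed
  moreover have "g = mor_embed C x z g (x, z)" using x z by simp
  ultimately show ?thesis by blast
qed

lemma component_submodule:
  assumes x: "x \<in> Ob C" "e \<in> E x" and z: "z \<in> Ob C"
    and U: "submodule U A (idem_projective C (x, e))"
  shows "submodule ((\<lambda>p. p (x, z)) ` U) (end_ring C z) (mor_left_module C x z)"
proof -
  interpret P: left_module A "idem_projective C (x, e)" by (rule idem_projective_left_module[OF x])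
  interpret V: left_module "end_ring C z" "mor_left_module C x z"
    by (rule mor_left_module_is_left_module[OF x(1) z])
  note UD = P.submoduleD[OF U, simplified]
  note mem = component_mem_iff[OF x z U]
  show ?thesis
  proof (rule V.submoduleI)
    show "(\<lambda>p. p (x, z)) ` U \<subseteq> carrier (mor_left_module C x z)" using mem by auto
    show "\<zero>\<^bsub>mor_left_module C x z\<^esub> \<in> (\<lambda>p. p (x, z)) ` U"
      using UD(2) x z by (intro image_eqI[of _ _ "\<zero>\<^bsub>A\<^esub>"]) auto
  next
    fix a b assume "a \<in> (\<lambda>p. p (x, z)) ` U" "b \<in> (\<lambda>p. p (x, z)) ` U"
    then show "a \<oplus>\<^bsub>mor_left_module C x z\<^esub> b \<in> (\<lambda>p. p (x, z)) ` U"
      unfolding mem using x z UD(3) V.M.add.m_closed[of a b] by (simp add: mor_embed_add)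
  next
    fix r a assume r: "r \<in> carrier (end_ring C z)" and a: "a \<in> (\<lambda>p. p (x, z)) ` U"
    have a': "a \<in> carrier (Mor C x z)" "mor_embed C x z a \<in> U" using a mem by auto
    have "(mor_embed C z z r \<otimes>\<^bsub>A\<^esub> mor_embed C x z a) (x, z) = Comp C x z z r a"
      using r a' x z by (simp add: mor_embed_mult_at)
    moreover have "mor_embed C z z r \<otimes>\<^bsub>A\<^esub> mor_embed C x z a \<in> U" using UD(4) a' r z by simp
    ultimately show "r \<odot>\<^bsub>mor_left_module C x z\<^esub> a \<in> (\<lambda>p. p (x, z)) ` U" by (auto intro: image_eqI[OF sym])
  qed
qed

text \<open>If \<open>w\<close> differs from \<open>z\<close>, the identity of \<open>z\<close>
  kills the module concentrated at \<open>w\<close> but fixes components at \<open>z\<close>; so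
  \<open>h\<close> vanishes on these, and \<open>U\<close> and \<open>W\<close> agree at
  \<open>z\<close>. If \<open>w = z\<close>, restricting \<open>h\<close> to components at
  \<open>z\<close> maps the value of \<open>W\<close> onto the projective module
  \<open>C(z,z) f\<close> with kernel the value of \<open>U\<close>, and
  \<open>projective_extension\<close> applies.\<close>

lemma component_projective_step:
  assumes x: "x \<in> Ob C" "e \<in> E x" and z: "z \<in> Ob C"
    and U: "submodule U A (idem_projective C (x, e))" and W: "submodule W A (idem_projective C (x, e))"
    and w: "w \<in> Ob C" "f \<in> E w"
    and h: "h \<in> left_module_hom A ((idem_projective C (x, e))\<lparr>carrier := W\<rparr>) (standard_ideal w f)"
    and surj: "h ` W = carrier (standard_ideal w f)"
    and ker: "{p \<in> W. h p = \<zero>\<^bsub>Mor C w w\<^esub>} = U"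
    and proj: "projective_module (end_ring C z) ((mor_left_module C x z)\<lparr>carrier := (\<lambda>p. p (x, z)) ` U\<rparr>)"
  shows "projective_module (end_ring C z) ((mor_left_module C x z)\<lparr>carrier := (\<lambda>p. p (x, z)) ` W\<rparr>)"
proof -
  interpret P: left_module A "idem_projective C (x, e)" by (rule idem_projective_left_module[OF x])
  interpret A: ring A by (rule A_ring)
  let ?V = "mor_left_module C x z" and ?R = "end_ring C z"
  interpret V: left_module ?R ?V by (rule mor_left_module_is_left_module[OF x(1) z])
  note P = idem_projective_carrier[OF x]
  note WD = P.submoduleD[OF W, simplified]
  note hD = left_module_homD[OF h, simplified]
  let ?G = "\<lambda>U. (\<lambda>p. p (x, z)) ` U"
  note memU = component_mem_iff[OF x z U] and memW = component_mem_iff[OF x z W]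
  note I = standard_ideal_carrier[OF w]
  have UW: "U \<subseteq> W" using ker by auto
  show ?thesis
  proof (cases "w = z")
    case False
    have "?G W \<subseteq> ?G U"
    proof
      fix g assume g: "g \<in> ?G W"
      then have g': "g \<in> carrier (Mor C x z)" "mor_embed C x z g \<in> W" using memW by auto
      have gA: "mor_embed C x z g \<in> carrier A" using g' x z by simp
      have id: "mor_embed C z z (Ident C z) \<in> carrier A" using z Ident_closed by simp
      have "mor_embed C z z (Ident C z) \<otimes>\<^bsub>A\<^esub> mor_embed C x z g = mor_embed C x z g"
        by (rule A_eqI) (use g' gA x z Ident_closed in \<open>auto simp: mor_embed_mult_at Comp_Ident_left Comp_zero_right\<close>)
      then have "h (mor_embed C x z g) = Comp C w w w (mor_embed C z z (Ident C z) (w, w)) (h (mor_embed C x z g))"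
        using hD(3)[OF id g'(2)] by simp
      also have "\<dots> = \<zero>\<^bsub>Mor C w w\<^esub>" using hD(1)[OF g'(2)] w False by (simp add: I Comp_zero_left)
      finally have "mor_embed C x z g \<in> U" using ker g' by auto
      then show "g \<in> ?G U" using memU g' by simp
    qed
    then have "?G W = ?G U" using UW by auto
    then show ?thesis using proj by simp
  next
    case True
    note R = end_ring_is_ring[OF z]
    let ?I = "idem_left_ideal ?R f"
    have idem: "ring_idempotent ?R f" using idem_in(1)[OF w] True by simp
    have PI: "projective_module ?R ?I" by (rule ring.idem_left_ideal_projective[OF R idem])
    define \<psi> where "\<psi> g = h (mor_embed C x z g)" for g
    have hz: "h \<zero>\<^bsub>A\<^esub> = \<zero>\<^bsub>Mor C w w\<^esub>"
      using left_module_hom_zero_minus(1)[OF P.submodule_left_module[OF W] standard_ideal_left_module[OF w] h] by simp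
    have GW: "submodule (?G W) ?R ?V" by (rule component_submodule[OF x z W])
    interpret GW: left_module ?R "?V\<lparr>carrier := ?G W\<rparr>" by (rule V.submodule_left_module[OF GW])
    have "submodule (?G U) ?R ?V" by (rule component_submodule[OF x z U])
    then have GU: "submodule (?G U) ?R (?V\<lparr>carrier := ?G W\<rparr>)"
      using V.submoduleD[OF \<open>submodule (?G U) ?R ?V\<close>] UW by (intro GW.submoduleI) auto
    have \<psi>: "\<psi> \<in> left_module_hom ?R (?V\<lparr>carrier := ?G W\<rparr>) ?I"
    proof (rule left_module_homI)
      fix g assume "g \<in> carrier (?V\<lparr>carrier := ?G W\<rparr>)"
      then have "mor_embed C x z g \<in> W" using memW by simp
      then show "\<psi> g \<in> carrier ?I" using hD(1) True by (simp add: \<psi>_def)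
    next
      fix g g' assume "g \<in> carrier (?V\<lparr>carrier := ?G W\<rparr>)" "g' \<in> carrier (?V\<lparr>carrier := ?G W\<rparr>)"
      then have "g \<in> carrier (Mor C x z)" "mor_embed C x z g \<in> W"
        "g' \<in> carrier (Mor C x z)" "mor_embed C x z g' \<in> W" using memW by auto
      then show "\<psi> (g \<oplus>\<^bsub>?V\<lparr>carrier := ?G W\<rparr>\<^esub> g') = \<psi> g \<oplus>\<^bsub>?I\<^esub> \<psi> g'"
        using x z True by (simp add: \<psi>_def mor_embed_add hD(2))
    next
      fix r g assume r: "r \<in> carrier ?R" and "g \<in> carrier (?V\<lparr>carrier := ?G W\<rparr>)"
      then have g: "g \<in> carrier (Mor C x z)" "mor_embed C x z g \<in> W" using memW by auto
      have "mor_embed C x z (Comp C x z z r g) = mor_embed C z z r \<otimes>\<^bsub>A\<^esub> mor_embed C x z g"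
        by (rule A_eqI) (use g r x z in \<open>auto simp: mor_embed_mult_at Comp_closed Comp_zero_right\<close>)
      then show "\<psi> (r \<odot>\<^bsub>?V\<lparr>carrier := ?G W\<rparr>\<^esub> g) = r \<odot>\<^bsub>?I\<^esub> \<psi> g"
        using g r x z True by (simp add: \<psi>_def hD(3))
    qed
    have "\<psi> ` ?G W = carrier ?I"
    proof
      show "\<psi> ` ?G W \<subseteq> carrier ?I" using left_module_homD(1)[OF \<psi>] by auto
      show "carrier ?I \<subseteq> \<psi> ` ?G W"
      proof
        fix b assume b: "b \<in> carrier ?I"
        then have "b \<in> h ` W" using surj True by simp
        then obtain p where p: "p \<in> W" "h p = b" by auto
        have pA: "p \<in> carrier A" "\<And>y w. \<lbrakk>y \<in> Ob C; w \<in> Ob C; y \<noteq> x\<rbrakk> \<Longrightarrow> p (y, w) = \<zero>\<^bsub>Mor C y w\<^esub>"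
          using p WD(1) by (auto simp: P)
        \<comment> \<open>The identity of \<open>z\<close> fixes \<open>b\<close>, so cutting
          \<open>p\<close> down to its component at \<open>z\<close> keeps the value
          \<open>b\<close>.\<close>
        have "mor_embed C x z (p (x, z)) = mor_embed C z z (Ident C z) \<otimes>\<^bsub>A\<^esub> p"
          by (rule A_eqI)
             (use pA x z Ident_closed in \<open>auto simp: mor_embed_mult_at Comp_Ident_left\<close>)
        then have "\<psi> (p (x, z)) = Comp C z z z (Ident C z) b"
          using p hD(3)[of "mor_embed C z z (Ident C z)" p] z Ident_closed True by (simp add: \<psi>_def)
        also have "\<dots> = b" using b True z by (simp add: I[unfolded True] Comp_Ident_left)
        finally show "b \<in> \<psi> ` ?G W" using p by (auto intro: image_eqI[OF sym])
      qed
    qed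
    moreover have "{g \<in> ?G W. \<psi> g = \<zero>\<^bsub>Mor C z z\<^esub>} = ?G U"
      using memU memW ker True by (auto simp: \<psi>_def)
    ultimately show ?thesis
      using projective_extension[OF GW.left_module_axioms PI GU _ \<psi>] proj by simp
  qed
qed

text \<open>Evaluated at \<open>z\<close>, the filtration starts at zero, stays projective by
  \<open>component_projective_step\<close>, and ends at the value of \<open>C e\<close>, which is
  \<open>summand x e z\<close>.\<close>

lemma filtration_imp_summand_projective:
  assumes x: "x \<in> Ob C" "e \<in> E x" and z: "z \<in> Ob C"
    and filt: "has_standard_filtration C E pre (idem_projective C (x, e))"
  shows "projective_module (end_ring C z) ((mor_left_module C x z)\<lparr>carrier := summand x e z\<rparr>)"
proof -
  let ?P = "idem_projective C (x, e)" and ?V = "mor_left_module C x z" and ?R = "end_ring C z"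
  let ?G = "\<lambda>U. (\<lambda>p. p (x, z)) ` U"
  interpret P: left_module A ?P by (rule idem_projective_left_module[OF x])
  interpret V: left_module ?R ?V by (rule mor_left_module_is_left_module[OF x(1) z])
  obtain n :: nat and F where F: "F 0 = {\<zero>\<^bsub>?P\<^esub>}" "F n = carrier ?P"
    and sub: "\<And>i. i \<le> n \<Longrightarrow> submodule (F i) A ?P"
    and step: "\<And>i. i < n \<Longrightarrow> F i \<subseteq> F (Suc i) \<and>
      (\<exists>m \<in> idem_index C E. left_module_iso A (quotient_module (?P\<lparr>carrier := F (Suc i)\<rparr>) (F i))
         (standard_module C E pre m))"
    using filt unfolding has_standard_filtration_def by blast
  have "projective_module ?R (?V\<lparr>carrier := ?G (F i)\<rparr>)" if "i \<le> n" for i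
    using that
  proof (induction i)
    case 0
    have "?G (F 0) = {\<zero>\<^bsub>Mor C x z\<^esub>}" using x z by (simp add: F)
    moreover have "submodule (?G (F 0)) ?R ?V" by (rule component_submodule[OF x z sub]) simp
    ultimately show ?case using V.submodule_left_module[of "?G (F 0)"]
      by (intro zero_module_projective) auto
  next
    case (Suc i)
    have U: "submodule (F i) A ?P" and W: "submodule (F (Suc i)) A ?P" using Suc.prems sub by auto
    have UW: "F i \<subseteq> F (Suc i)" using step Suc.prems by auto
    have LW: "left_module A (?P\<lparr>carrier := F (Suc i)\<rparr>)" by (rule P.submodule_left_module[OF W])
    interpret LW: left_module A "?P\<lparr>carrier := F (Suc i)\<rparr>" by (rule LW)
    have UinW: "submodule (F i) A (?P\<lparr>carrier := F (Suc i)\<rparr>)"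
      using P.submoduleD[OF U] UW by (intro LW.submoduleI) auto
    obtain w f where w: "w \<in> Ob C" "f \<in> E w" and
      "left_module_iso A (quotient_module (?P\<lparr>carrier := F (Suc i)\<rparr>) (F i)) (standard_module C E pre (w, f))"
      using step[of i] Suc.prems by (auto simp: idem_index_def)
    then obtain h where "h \<in> left_module_hom A (?P\<lparr>carrier := F (Suc i)\<rparr>) (standard_ideal w f)"
      "h ` F (Suc i) = carrier (standard_ideal w f)" "{p \<in> F (Suc i). h p = \<zero>\<^bsub>Mor C w w\<^esub>} = F i"
      using iso_standard_module_iff[OF LW UinW w] by auto
    then show ?case using component_projective_step[OF x z U W w] Suc by simp
  qed
  from this[of n] have "projective_module ?R (?V\<lparr>carrier := ?G (carrier ?P)\<rparr>)" by (simp add: F)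
  moreover have "?G (carrier ?P) = summand x e z"
    using component_mem_iff[OF x z P.carrier_submodule] mor_embed_idem_projective[OF x z] x z
    by (auto simp: summand_def idem_projective_carrier[OF x])
  ultimately show ?thesis by simp
qed

text \<open>The idempotents \<open>e\<close> add up to the identity of \<open>x\<close>, so
  \<open>m\<close> is the sum of the \<open>m e\<close>. A map out of \<open>C(x,z)\<close> is
  lifted on each \<open>C(x,z) e\<close>, and the lifts, preceded by \<open>m -> m e\<close>, are
  added.\<close>

lemma projective_from_summands:
  assumes x: "x \<in> Ob C" and z: "z \<in> Ob C"
    and proj: "\<And>e. e \<in> E x \<Longrightarrow>
      projective_module (end_ring C z) ((mor_left_module C x z)\<lparr>carrier := summand x e z\<rparr>)"
  shows "projective_module (end_ring C z) (mor_left_module C x z)"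
proof -
  let ?V = "mor_left_module C x z" and ?R = "end_ring C z"
  have V: "left_module ?R ?V" by (rule mor_left_module_is_left_module[OF x z])
  interpret V: left_module ?R ?V by (rule V)
  have fin: "finite (E x)" and one: "(\<Oplus>\<^bsub>end_ring C x\<^esub>e\<in>E x. e) = Ident C x"
    using idempotents[OF x] by (auto simp: complete_primitive_idempotents_def)
  show ?thesis
  proof (rule projective_moduleI[OF V])
    fix N :: "('m, 'm \<Rightarrow> 'm) module" and L :: "('m, 'm) module" and g f
    assume *: "left_module ?R N" "left_module ?R L" "g \<in> left_module_hom ?R N L"
      "f \<in> left_module_hom ?R ?V L" "g ` carrier N = carrier L"
    interpret N: left_module ?R N by fact
    interpret L: left_module ?R L by fact
    note fD = left_module_homD[OF *(4), simplified]
    have "\<exists>h \<in> left_module_hom ?R (?V\<lparr>carrier := summand x e z\<rparr>) N. \<forall>m\<in>summand x e z. g (h m) = f m"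
      if e: "e \<in> E x" for e
    proof -
      have "f \<in> left_module_hom ?R (?V\<lparr>carrier := summand x e z\<rparr>) L"
        by (rule left_module_homI) (use fD in \<open>auto simp: summand_def\<close>)
      from projective_module_lift[OF proj[OF e] *(1-3) this *(5)] show ?thesis by simp
    qed
    then obtain h where h: "\<And>e. e \<in> E x \<Longrightarrow> h e \<in> left_module_hom ?R (?V\<lparr>carrier := summand x e z\<rparr>) N"
      and gh: "\<And>e m. \<lbrakk>e \<in> E x; m \<in> summand x e z\<rbrakk> \<Longrightarrow> g (h e m) = f m"
      by metis
    define k where "k e m = h e (Comp C x x z m e)" for e m
    have k: "k e \<in> left_module_hom ?R ?V N" if e: "e \<in> E x" for e
      unfolding k_def using left_module_hom_comp[OF summand_retract[OF x e z] h[OF e]] .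
    note kD = left_module_homD[OF k, simplified]
    let ?H = "\<lambda>m. \<Oplus>\<^bsub>N\<^esub>e\<in>E x. k e m"
    have "?H \<in> left_module_hom ?R ?V N"
    proof (rule left_module_homI)
      fix m assume "m \<in> carrier ?V"
      then show "?H m \<in> carrier N" using kD(1) by (intro N.M.finsum_closed) auto
    next
      fix m m' assume m: "m \<in> carrier ?V" "m' \<in> carrier ?V"
      then have "?H (m \<oplus>\<^bsub>?V\<^esub> m') = (\<Oplus>\<^bsub>N\<^esub>e\<in>E x. k e m \<oplus>\<^bsub>N\<^esub> k e m')"
        using kD by (intro N.M.finsum_cong') auto
      also have "\<dots> = ?H m \<oplus>\<^bsub>N\<^esub> ?H m'" using m kD(1) by (intro N.M.finsum_addf) auto
      finally show "?H (m \<oplus>\<^bsub>?V\<^esub> m') = ?H m \<oplus>\<^bsub>N\<^esub> ?H m'" .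
    next
      fix r m assume r: "r \<in> carrier ?R" "m \<in> carrier ?V"
      then have "?H (r \<odot>\<^bsub>?V\<^esub> m) = (\<Oplus>\<^bsub>N\<^esub>e\<in>E x. r \<odot>\<^bsub>N\<^esub> k e m)"
        using kD by (intro N.M.finsum_cong') auto
      also have "\<dots> = r \<odot>\<^bsub>N\<^esub> ?H m" using r kD(1) fin by (intro N.smult_finsum[symmetric]) auto
      finally show "?H (r \<odot>\<^bsub>?V\<^esub> m) = r \<odot>\<^bsub>N\<^esub> ?H m" .
    qed
    moreover have "g (?H m) = f m" if m: "m \<in> carrier (Mor C x z)" for m
    proof -
      have me: "Comp C x x z m e \<in> summand x e z" "Comp C x x z m e \<in> carrier (Mor C x z)" if "e \<in> E x" for e
        using idem_in[OF x that] m x z by (auto simp: summand_def Comp_closed Comp_assoc)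
      have "g (?H m) = (\<Oplus>\<^bsub>L\<^esub>e\<in>E x. g (k e m))"
        using left_module_hom_finsum[OF *(1-3) fin] kD(1) m by auto
      also have "\<dots> = (\<Oplus>\<^bsub>L\<^esub>e\<in>E x. f (Comp C x x z m e))"
        using me fD(1) gh by (intro L.M.finsum_cong') (auto simp: k_def)
      also have "\<dots> = f (\<Oplus>\<^bsub>?V\<^esub>e\<in>E x. Comp C x x z m e)"
        using left_module_hom_finsum[OF V *(2,4) fin, of "\<lambda>e. Comp C x x z m e"] me by auto
      \<comment> \<open>A finite sum depends only on carrier, addition and zero, which the two
        records share.\<close>
      also have "(\<Oplus>\<^bsub>?V\<^esub>e\<in>E x. Comp C x x z m e) = (\<Oplus>\<^bsub>Mor C x z\<^esub>e\<in>E x. Comp C x x z m e)"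
        by (simp add: finsum_def finprod_def mor_left_module_def)
      also have "\<dots> = Comp C x x z m (\<Oplus>\<^bsub>Mor C x x\<^esub>e\<in>E x. e)"
        using Comp_finsum_right[OF x x z m fin, of "\<lambda>e. e"] idem_in(2)[OF x] by auto
      also have "(\<Oplus>\<^bsub>Mor C x x\<^esub>e\<in>E x. e) = (\<Oplus>\<^bsub>end_ring C x\<^esub>e\<in>E x. e)"
        by (simp add: finsum_def finprod_def end_ring_def)
      finally show ?thesis using one m x z by (simp add: Comp_Ident_right)
    qed
    ultimately show "\<exists>h \<in> left_module_hom ?R ?V N. \<forall>m\<in>carrier ?V. g (h m) = f m"
      by (intro bexI[of _ ?H]) auto
  qed
qed

end


section \<open>From projectivity to filtrations\<close>

context directed_linear_category
begin

text \<open>A scalar \<open>c\<close> acts as composition with \<open>c 1_z\<close>, so closure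
  under \<open>C(z,z)\<close> includes closure under \<open>K\<close>. The vector space measure thus
  applies to \<open>C(z,z)\<close>-submodules.\<close>

lemma end_submodule_subspace:
  assumes x: "x \<in> Ob C" and z: "z \<in> Ob C" and W: "submodule W (end_ring C z) (mor_left_module C x z)"
  shows "submodule W K (Mor C x z)"
proof -
  interpret V: left_module "end_ring C z" "mor_left_module C x z"
    by (rule mor_left_module_is_left_module[OF x z])
  interpret M: module K "Mor C x z" by (rule Mor_module[OF x z])
  interpret Z: module K "Mor C z z" by (rule Mor_module[OF z z])
  interpret L: left_module K "Mor C x z" by (rule module_is_left_module[OF Mor_module[OF x z]])
  note D = V.submoduleD[OF W, simplified]
  show ?thesis
  proof (rule L.submoduleI)
    fix c f assume c: "c \<in> carrier K" and f: "f \<in> W"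
    then have f': "f \<in> carrier (Mor C x z)" using D(1) by auto
    have "c \<odot>\<^bsub>Mor C x z\<^esub> f = Comp C x z z (c \<odot>\<^bsub>Mor C z z\<^esub> Ident C z) f"
      using c f' x z by (simp add: Comp_smult_left Ident_closed Comp_Ident_left)
    then show "c \<odot>\<^bsub>Mor C x z\<^esub> f \<in> W" using D(4) c f z by (simp add: Ident_closed)
  qed (use D in auto)
qed

text \<open>Composition is bilinear, so principal left and right ideals of \<open>C(z,z)\<close> are
  subspaces. One measure on \<open>C(z,z)\<close> therefore serves both chains of the Fitting
  argument.\<close>

lemma end_ring_left_inverse:
  assumes K: "field K" and fd: "locally_finite K C" and z: "z \<in> Ob C" and e: "e \<in> E z"
    and u: "u \<in> carrier (end_ring C z)" "e \<otimes>\<^bsub>end_ring C z\<^esub> u = u" "u \<otimes>\<^bsub>end_ring C z\<^esub> e = u"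
    and nil: "\<And>n::nat. u [^]\<^bsub>end_ring C z\<^esub> n \<noteq> \<zero>\<^bsub>end_ring C z\<^esub>"
  shows "\<exists>t\<in>carrier (end_ring C z). t \<otimes>\<^bsub>end_ring C z\<^esub> u = e"
proof -
  have V: "module K (Mor C z z)" by (rule Mor_module[OF z z])
  interpret V: module K "Mor C z z" by fact
  interpret L: left_module K "Mor C z z" by (rule module_is_left_module[OF V])
  obtain d :: "'m set \<Rightarrow> nat" where
    d: "\<And>U W. \<lbrakk>submodule U K (Mor C z z); submodule W K (Mor C z z); U \<subset> W\<rbrakk> \<Longrightarrow> d U < d W"
    using finite_dimensional_measure[OF K V] fd z unfolding locally_finite_def by blast
  have left: "submodule ((\<lambda>r. Comp C z z z r a) ` carrier (Mor C z z)) K (Mor C z z)"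
    if a: "a \<in> carrier (Mor C z z)" for a
  proof (rule L.submoduleI)
    show "\<zero>\<^bsub>Mor C z z\<^esub> \<in> (\<lambda>r. Comp C z z z r a) ` carrier (Mor C z z)"
      using a z by (intro image_eqI[of _ _ "\<zero>\<^bsub>Mor C z z\<^esub>"]) (auto simp: Comp_zero_left)
  qed (use a z in \<open>auto simp: Comp_closed Comp_add_left[symmetric] Comp_smult_left[symmetric]\<close>)
  have right: "submodule ((\<lambda>r. Comp C z z z a r) ` carrier (Mor C z z)) K (Mor C z z)"
    if a: "a \<in> carrier (Mor C z z)" for a
  proof (rule L.submoduleI)
    show "\<zero>\<^bsub>Mor C z z\<^esub> \<in> (\<lambda>r. Comp C z z z a r) ` carrier (Mor C z z)"
      using a z by (intro image_eqI[of _ _ "\<zero>\<^bsub>Mor C z z\<^esub>"]) (auto simp: Comp_zero_right)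
  qed (use a z in \<open>auto simp: Comp_closed Comp_add_right[symmetric] Comp_smult_right[symmetric]\<close>)
  have "primitive_idempotent (end_ring C z) e"
    using idempotents[OF z] e by (simp add: complete_primitive_idempotents_def)
  from ring.primitive_idempotent_left_inverse[OF end_ring_is_ring[OF z] this u nil, where d = d]
  show ?thesis using d left right by simp
qed

text \<open>\<open>m -> m e\<close> makes \<open>C(x,z) e\<close> a retract of
  \<open>C(x,z)\<close>, hence projective. Two measures are involved: one on \<open>C(x,z)\<close>
  for the induction, one on \<open>C(z,z)\<close> for the left inverses.\<close>

lemma summand_idem_filtered:
  assumes K: "field K" and fd: "locally_finite K C"
    and x: "x \<in> Ob C" "e \<in> E x" and z: "z \<in> Ob C"
    and proj: "projective_module (end_ring C z) (mor_left_module C x z)"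
  shows "idem_filtered (end_ring C z) (E z) (mor_left_module C x z) (summand x e z)"
proof -
  let ?V = "mor_left_module C x z" and ?R = "end_ring C z"
  have V: "left_module ?R ?V" by (rule mor_left_module_is_left_module[OF x(1) z])
  interpret V: left_module ?R ?V by (rule V)
  have S: "submodule (summand x e z) ?R ?V" by (rule summand_submodule[OF x z])
  have incl: "(\<lambda>f. f) \<in> left_module_hom ?R (?V\<lparr>carrier := summand x e z\<rparr>) ?V"
    by (rule left_module_homI) (auto simp: summand_def)
  have P: "projective_module ?R (?V\<lparr>carrier := summand x e z\<rparr>)"
    by (rule projective_retract[OF proj V.submodule_left_module[OF S] incl summand_retract[OF x z]])
       (simp add: summand_def)
  obtain d :: "'m set \<Rightarrow> nat" where
    d: "\<And>U W. \<lbrakk>submodule U K (Mor C x z); submodule W K (Mor C x z); U \<subset> W\<rbrakk> \<Longrightarrow> d U < d W"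
    using finite_dimensional_measure[OF K Mor_module[OF x(1) z]] fd x z unfolding locally_finite_def by blast
  show ?thesis
    by (rule projective_idem_filtered[OF V idempotents[OF z] end_ring_left_inverse[OF K fd z] _ S P, of d])
       (use d end_submodule_subspace[OF x(1) z] in auto)
qed

section \<open>Filtering \<open>C e\<close> by up-closed sets of objects\<close>

definition up_closed :: "'o set \<Rightarrow> bool" where
  "up_closed T \<longleftrightarrow> T \<subseteq> Ob C \<and> (\<forall>y\<in>T. \<forall>w\<in>Ob C. (y, w) \<in> leq \<longrightarrow> w \<in> T)"

text \<open>For \<open>z\<close> outside \<open>T\<close>, this interpolates between the elements
  supported on \<open>T\<close>, when \<open>W\<close> is zero, and those supported on
  \<open>insert z T\<close>, when \<open>W\<close> is \<open>summand x e z\<close>.\<close>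

definition layer :: "'o \<Rightarrow> 'm \<Rightarrow> 'o set \<Rightarrow> 'o \<Rightarrow> 'm set \<Rightarrow> ('o \<times> 'o \<Rightarrow> 'm) set" where
  "layer x e T z W = {p \<in> carrier (idem_projective C (x, e)).
     (\<forall>y\<in>Ob C. y \<notin> insert z T \<longrightarrow> p (x, y) = \<zero>\<^bsub>Mor C x y\<^esub>) \<and> p (x, z) \<in> W}"

text \<open>A nonzero contribution through an object \<open>w\<close> other than \<open>z\<close>
  needs \<open>w\<close> in \<open>T\<close> and \<open>w <= z\<close>; then \<open>z\<close> would
  lie in \<open>T\<close>. Hence evaluation at \<open>z\<close> is linear over \<open>A\<close> on
  elements supported on \<open>insert z T\<close>.\<close>

lemma up_closed_mult_at:
  assumes T: "up_closed T" and a: "a \<in> carrier A" and p: "p \<in> carrier A" and x: "x \<in> Ob C"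
    and z: "z \<in> Ob C" "z \<notin> T"
    and supp: "\<And>y. \<lbrakk>y \<in> Ob C; y \<notin> insert z T\<rbrakk> \<Longrightarrow> p (x, y) = \<zero>\<^bsub>Mor C x y\<^esub>"
  shows "(a \<otimes>\<^bsub>A\<^esub> p) (x, z) = Comp C x z z (a (z, z)) (p (x, z))"
proof (rule A_mult_at[OF p a x z(1) z(1)])
  fix w assume w: "w \<in> Ob C" "w \<noteq> z"
  show "a (w, z) = \<zero>\<^bsub>Mor C w z\<^esub> \<or> p (x, w) = \<zero>\<^bsub>Mor C x w\<^esub>"
  proof (cases "w \<in> T")
    case True
    then have "(w, z) \<notin> leq" using T z by (auto simp: up_closed_def)
    then show ?thesis using Mor_not_leq[OF w(1) z(1)] a w z by simp
  next
    case False then show ?thesis using supp w by simp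
  qed
qed

text \<open>\<open>up_closed (insert z T)\<close> keeps the support from growing under
  \<open>A\<close>; \<open>up_closed T\<close> ensures that \<open>A\<close> acts on the value at
  \<open>z\<close> only through \<open>C(z,z)\<close>, under which \<open>W\<close> is
  stable.\<close>

lemma layer_submodule:
  assumes x: "x \<in> Ob C" "e \<in> E x" and z: "z \<in> Ob C" "z \<notin> T"
    and T: "up_closed T" "up_closed (insert z T)"
    and W: "submodule W (end_ring C z) (mor_left_module C x z)"
  shows "submodule (layer x e T z W) A (idem_projective C (x, e))"
proof -
  interpret P: left_module A "idem_projective C (x, e)" by (rule idem_projective_left_module[OF x])
  interpret V: left_module "end_ring C z" "mor_left_module C x z"
    by (rule mor_left_module_is_left_module[OF x(1) z(1)])
  note D = V.submoduleD[OF W, simplified]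
  note P = idem_projective_carrier[OF x]
  show ?thesis
  proof (rule P.submoduleI)
    show "layer x e T z W \<subseteq> carrier (idem_projective C (x, e))" by (auto simp: layer_def)
    show "\<zero>\<^bsub>idem_projective C (x, e)\<^esub> \<in> layer x e T z W"
      using P.M.zero_closed D(2) x z by (simp add: layer_def)
  next
    fix p q assume "p \<in> layer x e T z W" "q \<in> layer x e T z W"
    then show "p \<oplus>\<^bsub>idem_projective C (x, e)\<^esub> q \<in> layer x e T z W"
      using P.M.add.m_closed[of p q] D(3) x z by (simp add: layer_def)
  next
    fix a p assume a: "a \<in> carrier A" and p: "p \<in> layer x e T z W"
    have pA: "p \<in> carrier A" and supp: "\<And>y. \<lbrakk>y \<in> Ob C; y \<notin> insert z T\<rbrakk> \<Longrightarrow> p (x, y) = \<zero>\<^bsub>Mor C x y\<^esub>"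
      and pW: "p (x, z) \<in> W" and pP: "p \<in> carrier (idem_projective C (x, e))"
      using p by (auto simp: layer_def P)
    have "(a \<otimes>\<^bsub>A\<^esub> p) (x, y) = \<zero>\<^bsub>Mor C x y\<^esub>" if y: "y \<in> Ob C" "y \<notin> insert z T" for y
    proof -
      \<comment> \<open>Here the up-closed set is \<open>insert z T\<close> and the object outside
        it is \<open>y\<close>.\<close>
      have "(a \<otimes>\<^bsub>A\<^esub> p) (x, y) = Comp C x y y (a (y, y)) (p (x, y))"
        by (rule up_closed_mult_at[OF T(2) a pA x(1) y]) (use supp in auto)
      then show ?thesis using supp[OF y] a x y by (simp add: Comp_zero_right)
    qed
    moreover have "(a \<otimes>\<^bsub>A\<^esub> p) (x, z) \<in> W"
      using up_closed_mult_at[OF T(1) a pA x(1) z supp] D(4)[OF _ pW] a z by simp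
    moreover have "a \<otimes>\<^bsub>A\<^esub> p \<in> carrier (idem_projective C (x, e))" using P.smult_closed[OF a pP] by simp
    ultimately show "a \<odot>\<^bsub>idem_projective C (x, e)\<^esub> p \<in> layer x e T z W" by (simp add: layer_def)
  qed
qed

text \<open>Evaluation at \<open>z\<close> followed by the map \<open>h\<close> of a step sends the
  layer of \<open>W\<close> onto \<open>C(z,z) f\<close> with kernel the layer of \<open>U\<close>.
  Each step of a filtration inside \<open>C(x,z) e\<close> thus becomes a step with a standard
  factor.\<close>

lemma layer_standard_filtered:
  assumes x: "x \<in> Ob C" "e \<in> E x" and z: "z \<in> Ob C" "z \<notin> T"
    and T: "up_closed T" "up_closed (insert z T)"
    and base: "standard_filtered C E pre (idem_projective C (x, e)) (layer x e T z {\<zero>\<^bsub>Mor C x z\<^esub>})"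
    and W: "idem_filtered (end_ring C z) (E z) (mor_left_module C x z) W" "W \<subseteq> summand x e z"
  shows "standard_filtered C E pre (idem_projective C (x, e)) (layer x e T z W)"
  using W
proof induction
  case zero
  then show ?case using base by simp
next
  case (step U W f h)
  let ?P = "idem_projective C (x, e)" and ?R = "end_ring C z" and ?V = "mor_left_module C x z"
  interpret P: left_module A ?P by (rule idem_projective_left_module[OF x])
  note P = idem_projective_carrier[OF x]
  have UW: "U \<subseteq> W" using step.hyps(6) by auto
  note hD = left_module_homD[OF step.hyps(4), simplified]
  \<comment> \<open>The step presents \<open>U\<close> only as a kernel inside \<open>W\<close>, so
    that it is a submodule of \<open>C(x,z)\<close> is derived from \<open>W\<close>.\<close>
  have U: "submodule U ?R ?V"
  proof -
    interpret V: left_module ?R ?V by (rule mor_left_module_is_left_module[OF x(1) z(1)])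
    have LW: "left_module ?R (?V\<lparr>carrier := W\<rparr>)" by (rule V.submodule_left_module[OF step.hyps(2)])
    have LI: "left_module ?R (idem_left_ideal ?R f)"
      by (rule ring.idem_left_ideal_is_left_module[OF end_ring_is_ring[OF z(1)] idem_in(1)[OF z(1) step.hyps(3)]])
    note D = V.submoduleD[OF step.hyps(2)]
    have "submodule {w \<in> W. h w = \<zero>\<^bsub>Mor C z z\<^esub>} ?R (?V\<lparr>carrier := W\<rparr>)"
      using kernel_submodule[OF LW LI step.hyps(4)] by simp
    then have "submodule U ?R (?V\<lparr>carrier := W\<rparr>)" using step.hyps(6) by simp
    note UD = left_module.submoduleD[OF LW this, simplified]
    have "U \<subseteq> carrier (Mor C x z)" using UW D(1) by auto
    then show ?thesis by (intro V.submoduleI) (use UD(2-4) in simp_all)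
  qed
  have SW: "submodule (layer x e T z W) A ?P" by (rule layer_submodule[OF x z T step.hyps(2)])
  have SU: "submodule (layer x e T z U) A ?P" by (rule layer_submodule[OF x z T U])
  let ?L = "?P\<lparr>carrier := layer x e T z W\<rparr>"
  have L: "left_module A ?L" by (rule P.submodule_left_module[OF SW])
  interpret L: left_module A ?L by (rule L)
  have sub: "layer x e T z U \<subseteq> layer x e T z W" using UW by (auto simp: layer_def)
  have SUW: "submodule (layer x e T z U) A ?L"
    using P.submoduleD[OF SU] sub by (intro L.submoduleI) auto
  have "(\<lambda>p. h (p (x, z))) \<in> left_module_hom A ?L (standard_ideal z f)"
  proof (rule left_module_homI)
    fix a p assume a: "a \<in> carrier A" and p: "p \<in> carrier ?L"
    then have "(a \<otimes>\<^bsub>A\<^esub> p) (x, z) = Comp C x z z (a (z, z)) (p (x, z))"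
      by (intro up_closed_mult_at[OF T(1) a _ x(1) z]) (auto simp: layer_def P)
    then show "h ((a \<odot>\<^bsub>?L\<^esub> p) (x, z)) = a \<odot>\<^bsub>standard_ideal z f\<^esub> h (p (x, z))"
      using a p z hD(3) by (auto simp: layer_def)
  qed (use hD x z in \<open>auto simp: layer_def\<close>)
  moreover have "(\<lambda>p. h (p (x, z))) ` carrier ?L = carrier (standard_ideal z f)"
  proof -
    have "w \<in> (\<lambda>p. p (x, z)) ` layer x e T z W" if w: "w \<in> W" for w
    proof -
      \<comment> \<open>\<open>w e = w\<close> puts the embedding of \<open>w\<close> into
        \<open>C e\<close>; it is supported at \<open>z\<close> alone and so is a preimage of
        \<open>w\<close> in the layer.\<close>
      have "w \<in> summand x e z" using w step.prems by auto
      then show ?thesis using w x z mor_embed_idem_projective[OF x z(1), of w]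
        by (intro image_eqI[of _ _ "mor_embed C x z w"]) (auto simp: layer_def summand_def)
    qed
    then have "(\<lambda>p. p (x, z)) ` layer x e T z W = W" by (auto simp: layer_def)
    then have "h ` (\<lambda>p. p (x, z)) ` layer x e T z W = carrier (standard_ideal z f)"
      using step.hyps(5) by simp
    then show ?thesis by (simp add: image_image)
  qed
  moreover have "{p \<in> carrier ?L. h (p (x, z)) = \<zero>\<^bsub>Mor C z z\<^esub>} = layer x e T z U"
    using step.hyps(6) by (auto simp: layer_def)
  ultimately have "left_module_iso A (quotient_module ?L (layer x e T z U)) (standard_module C E pre (z, f))"
    using iso_standard_module_iff[OF L SUW z(1) step.hyps(3)] by blast
  moreover have "standard_filtered C E pre ?P (layer x e T z U)" using step.IH UW step.prems by auto
  moreover have "(z, f) \<in> idem_index C E" using z step.hyps(3) by (simp add: idem_index_def)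
  ultimately show ?case using standard_filtered.step[OF _ SW sub] by blast
qed

text \<open>No other element of \<open>T\<close> lies below a minimal \<open>z\<close>, so nothing
  in \<open>T - {z}\<close> forces \<open>z\<close> back in.\<close>

lemma up_closed_remove_minimal:
  assumes T: "up_closed T" "T \<noteq> {}"
  shows "\<exists>z\<in>T. up_closed (T - {z})"
proof -
  have po: "trans leq" "antisym leq"
    using directed by (auto simp: directed_category_def partial_order_on_def preorder_on_def)
  have "finite T" using T finite_Ob by (auto simp: up_closed_def intro: finite_subset)
  moreover have "asymp_on T (\<lambda>a b. (a, b) \<in> leq \<and> a \<noteq> b)"
    using po(2) by (auto simp: asymp_on_def dest: antisymD)
  moreover have "transp_on T (\<lambda>a b. (a, b) \<in> leq \<and> a \<noteq> b)"
    using po by (auto simp: transp_on_def dest: antisymD transD)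
  ultimately obtain z where z: "z \<in> T" "\<And>y. \<lbrakk>y \<in> T; y \<noteq> z\<rbrakk> \<Longrightarrow> (y, z) \<notin> leq"
    using Finite_Set.bex_min_element[OF _ _ _ T(2)] by blast
  then show ?thesis using T by (intro bexI[of _ z]) (auto simp: up_closed_def)
qed

text \<open>Induction on \<open>T\<close>, removing a minimal object \<open>z\<close>: the
  hypothesis for \<open>T - {z}\<close> is the bottom of a layer, and the layer with
  \<open>W = summand x e z\<close> is the claim for \<open>T\<close>.\<close>

lemma up_closed_standard_filtered:
  assumes K: "field K" and fd: "locally_finite K C" and x: "x \<in> Ob C" "e \<in> E x"
    and proj: "\<And>z. z \<in> Ob C \<Longrightarrow> projective_module (end_ring C z) (mor_left_module C x z)"
    and T: "up_closed T"
  shows "standard_filtered C E pre (idem_projective C (x, e))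
    {p \<in> carrier (idem_projective C (x, e)). \<forall>y\<in>Ob C. y \<notin> T \<longrightarrow> p (x, y) = \<zero>\<^bsub>Mor C x y\<^esub>}"
proof -
  note P = idem_projective_carrier[OF x]
  interpret P: left_module A "idem_projective C (x, e)" by (rule idem_projective_left_module[OF x])
  have "finite T" using T finite_Ob by (auto simp: up_closed_def intro: finite_subset)
  then show ?thesis using T
  proof (induction T rule: finite_psubset_induct)
    case (psubset T)
    let ?S = "\<lambda>T. {p \<in> carrier (idem_projective C (x, e)). \<forall>y\<in>Ob C. y \<notin> T \<longrightarrow> p (x, y) = \<zero>\<^bsub>Mor C x y\<^esub>}"
    show ?case
    proof (cases "T = {}")
      case True
      have "?S {} \<subseteq> {\<zero>\<^bsub>A\<^esub>}"
      proof
        fix p assume "p \<in> ?S {}"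
        then have p: "p \<in> carrier A" "\<And>y. y \<in> Ob C \<Longrightarrow> p (x, y) = \<zero>\<^bsub>Mor C x y\<^esub>"
          "\<And>y z. \<lbrakk>y \<in> Ob C; z \<in> Ob C; y \<noteq> x\<rbrakk> \<Longrightarrow> p (y, z) = \<zero>\<^bsub>Mor C y z\<^esub>" by (simp_all add: P)
        have "p = \<zero>\<^bsub>A\<^esub>"
        proof (rule A_eqI)
          fix u v assume uv: "u \<in> Ob C" "v \<in> Ob C"
          then show "p (u, v) = \<zero>\<^bsub>A\<^esub> (u, v)" using p(2,3) by (cases "u = x") simp_all
        qed (use p ring.ring_simprules(2)[OF A_ring] in simp_all)
        then show "p \<in> {\<zero>\<^bsub>A\<^esub>}" by simp
      qed
      moreover have "\<zero>\<^bsub>A\<^esub> \<in> ?S {}" using P.M.zero_closed x by simp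
      ultimately have "?S {} = {\<zero>\<^bsub>A\<^esub>}" by (intro equalityI) simp_all
      then show ?thesis using True standard_filtered.zero[of C E pre "idem_projective C (x, e)"] by simp
    next
      case False
      obtain z where z: "z \<in> T" "up_closed (T - {z})" using up_closed_remove_minimal[OF psubset.prems False] by blast
      have zO: "z \<in> Ob C" using z(1) psubset.prems unfolding up_closed_def by blast
      have ins: "insert z (T - {z}) = T" using z(1) by blast
      have "T - {z} \<subset> T" using z(1) by blast
      then have "standard_filtered C E pre (idem_projective C (x, e)) (?S (T - {z}))"
        by (rule psubset.IH[OF _ z(2)])
      moreover have "?S (T - {z}) = layer x e (T - {z}) z {\<zero>\<^bsub>Mor C x z\<^esub>}"
        using zO unfolding layer_def by (intro Collect_cong) auto
      ultimately have base: "standard_filtered C E pre (idem_projective C (x, e))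
          (layer x e (T - {z}) z {\<zero>\<^bsub>Mor C x z\<^esub>})" by (simp only:)
      have "standard_filtered C E pre (idem_projective C (x, e)) (layer x e (T - {z}) z (summand x e z))"
        by (rule layer_standard_filtered[OF x zO _ z(2) _ base summand_idem_filtered[OF K fd x zO proj[OF zO]]])
           (use ins psubset.prems in auto)
      moreover have "layer x e (T - {z}) z (summand x e z) = ?S T"
        unfolding layer_def ins by (rule Collect_cong) (use zO x(1) in \<open>auto simp: summand_def P\<close>)
      ultimately show ?thesis by (simp only:)
    qed
  qed
qed

end

theorem theorem1p1:
  fixes K :: "'k ring" and C :: "('k, 'o, 'm) lincat"
    and leq :: "('o \<times> 'o) set" and E :: "'o \<Rightarrow> 'm set"
  assumes "algebraically_closed K"
    and "linear_category K C"
    and "skeletal C"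
    and "finite (Ob C)"
    and "locally_finite K C"
    and "directed_category C leq"
    and "\<And>x. x \<in> Ob C \<Longrightarrow> complete_primitive_idempotents (end_ring C x) (E x)"
  shows "standardly_stratified C E (canonical_preorder C E leq) \<longleftrightarrow>
         (\<forall>x\<in>Ob C. \<forall>y\<in>Ob C. projective_module (end_ring C y) (mor_left_module C x y))"
proof -
  interpret directed_linear_category K C leq E
    using assms by (intro directed_linear_category.intro directed_linear_category_axioms.intro)
  have K: "field K" using assms(1) by (rule algebraically_closed.axioms)
  show ?thesis
  proof
    assume "standardly_stratified C E pre"
    then have "has_standard_filtration C E pre (idem_projective C (x, e))" if "x \<in> Ob C" "e \<in> E x" for x e
      using that by (auto simp: standardly_stratified_def idem_index_def)
    then show "\<forall>x\<in>Ob C. \<forall>y\<in>Ob C. projective_module (end_ring C y) (mor_left_module C x y)"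
      using projective_from_summands filtration_imp_summand_projective by blast
  next
    assume proj: "\<forall>x\<in>Ob C. \<forall>y\<in>Ob C. projective_module (end_ring C y) (mor_left_module C x y)"
    show "standardly_stratified C E pre"
      unfolding standardly_stratified_def
    proof
      fix l assume "l \<in> idem_index C E"
      then obtain x e where l: "l = (x, e)" and x: "x \<in> Ob C" "e \<in> E x" by (auto simp: idem_index_def)
      \<comment> \<open>For \<open>T = Ob C\<close> the support condition is void, and the filtered
        module is all of \<open>C e\<close>.\<close>
      have "up_closed (Ob C)" by (simp add: up_closed_def)
      then have "standard_filtered C E pre (idem_projective C (x, e)) (carrier (idem_projective C (x, e)))"
        using up_closed_standard_filtered[OF K assms(5) x, of "Ob C"] proj x by simp
      then show "has_standard_filtration C E pre (idem_projective C l)"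
        unfolding l by (rule standard_filtered_imp_filtration[OF idem_projective_left_module[OF x]])
    qed
  qed
qed

end
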